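(* Let $n\ge 1$ be an integer and, for each integer $k\ge 0$, let $M_{n,k}$ denote the set of all elements $w\in S_n$ such that $w=w^{-1}$ and $w$ has exactly $k$ fixed points. For $g\in S_n$ and $w\in S_n$ with $w=w^{-1}$, let $i_1(g,w)$ be the number of pairs of indices $i<j$ in $\{1,\dots,n\}$ such that $w(i)=j$ and $g(i)>g(j)$. Define a representation $\rho_1$ of $S_n$ on the space $\mathbf{C}[M_{n,k}]$ of complex-valued functions on $M_{n,k}$ by $$(\rho_1(g)f)(w)=(-1)^{i_1(g^{-1},w)}f(g^{-1}wg)\qquad(g\in S_n,\ w\in M_{n,k}).$$ Then, whenever $M_{n,k}$ is non-empty (equivalently, $0\le k\le n$ and $n-k$ is even), $$\mathbf{C}[M_{n,k}]\cong\bigoplus_{\lambda}V_\lambda,$$ where the sum is over all partitions $\lambda$ of $n$ with exactly $k$ odd columns. In particular, if $M_n=\coprod_k M_{n,k}$ is the set of all $w\in S_n$ with $w^2=\mathrm{id}$, then $\mathbf{C}[M_n]=\bigoplus_k\mathbf{C}[M_{n,k}]$ is a Gelfand model for $S_n$, i.e., it contains each irreducible complex representation of $S_n$ exactly once.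
   Context: For a partition $\lambda=(\lambda_1,\dots,\lambda_l)$ of $n$, let $X_\lambda$ be the set of ordered set partitions $(S_1,\dots,S_l)$ of $\{1,\dots,n\}$ with $|S_i|=\lambda_i$, with the natural action of $S_n$, and let $\mathbf{C}[X_\lambda]$ be the corresponding permutation representation. Let $\epsilon$ be the sign character of $S_n$ and $\lambda'$ the conjugate partition, $\lambda'_i=\#\{j\mid\lambda_j\ge i\}$. $V_\lambda$ denotes the unique irreducible complex representation of $S_n$ which occurs in both $\mathbf{C}[X_\lambda]$ and $\mathbf{C}[X_{\lambda'}]\otimes\epsilon$; as $\lambda$ runs over partitions of $n$, the $V_\lambda$ form a set of representatives of isomorphism classes of irreducible complex representations of $S_n$. The columns of $\lambda$ are the (nonzero) parts of $\lambda'$; "$\lambda$ has $k$ odd columns" means that exactly $k$ of the parts of $\lambda'$ are odd. Products of permutations are composed as functions: $(gh)(i)=g(h(i))$. *)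

theory Defs
  imports
    Complex_Main
    "HOL-Algebra.Sym_Groups"
    "HOL-Library.Function_Algebras"
begin

section \<open>Complex vector spaces\<close>

class complex_vector = ab_group_add +
  fixes scaleC :: "complex \<Rightarrow> 'a \<Rightarrow> 'a"  (infixr \<open>*\<^sub>C\<close> 75)
  assumes scaleC_add_right: "a *\<^sub>C (x + y) = a *\<^sub>C x + a *\<^sub>C y"
    and scaleC_add_left: "(a + b) *\<^sub>C x = a *\<^sub>C x + b *\<^sub>C x"
    and scaleC_scaleC: "a *\<^sub>C b *\<^sub>C x = (a * b) *\<^sub>C x"
    and scaleC_one: "1 *\<^sub>C x = x"

global_interpretation complex_vector: vector_space "scaleC :: complex \<Rightarrow> 'a \<Rightarrow> 'a::complex_vector"
  by unfold_locales
    (rule scaleC_add_right scaleC_add_left scaleC_scaleC scaleC_one)+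

instantiation complex :: complex_vector
begin
definition scaleC_complex_def: "scaleC (a::complex) (x::complex) = a * x"
instance by standard (auto simp: scaleC_complex_def algebra_simps)
end

instantiation "fun" :: (type, complex_vector) complex_vector
begin
definition scaleC_fun_def: "scaleC a f = (\<lambda>x. a *\<^sub>C f x)"
instance by standard
  (auto simp: scaleC_fun_def fun_eq_iff scaleC_add_right scaleC_add_left scaleC_scaleC scaleC_one)
end

section \<open>Representations of groups on complex vector spaces\<close>

text \<open>The vector space is a linear subspace of the ambient type; the values of \<open>act\<close> outside
  this subspace are irrelevant.\<close>

record ('g, 'v) rep =
  rep_space :: "'v set"
  act :: "'g \<Rightarrow> 'v \<Rightarrow> 'v"

definition linear_map_on ::
    "'v::complex_vector set \<Rightarrow> 'w::complex_vector set \<Rightarrow> ('v \<Rightarrow> 'w) \<Rightarrow> bool" where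
  "linear_map_on V W T \<longleftrightarrow> T \<in> V \<rightarrow> W \<and>
     (\<forall>x\<in>V. \<forall>y\<in>V. T (x + y) = T x + T y) \<and> (\<forall>a. \<forall>x\<in>V. T (a *\<^sub>C x) = a *\<^sub>C T x)"

locale group_representation = group G
  for G :: "('g, 'b) monoid_scheme" (structure) and R :: "('g, 'v::complex_vector) rep" +
  assumes subspace: "complex_vector.subspace (rep_space R)"
    and linear: "g \<in> carrier G \<Longrightarrow> linear_map_on (rep_space R) (rep_space R) (act R g)"
    and act_one: "x \<in> rep_space R \<Longrightarrow> act R \<one> x = x"
    and act_mult: "\<lbrakk>g \<in> carrier G; h \<in> carrier G; x \<in> rep_space R\<rbrakk> \<Longrightarrow>
      act R (g \<otimes> h) x = act R g (act R h x)"

definition rep_iso ::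
    "('g, 'b) monoid_scheme \<Rightarrow> ('g, 'v::complex_vector) rep \<Rightarrow> ('g, 'w::complex_vector) rep \<Rightarrow> bool"
  where
  "rep_iso G R S \<longleftrightarrow> group_representation G R \<and> group_representation G S \<and>
     (\<exists>T. linear_map_on (rep_space R) (rep_space S) T \<and> bij_betw T (rep_space R) (rep_space S) \<and>
        (\<forall>g\<in>carrier G. \<forall>x\<in>rep_space R. T (act R g x) = act S g (T x)))"

definition invariant_subspace ::
    "('g, 'b) monoid_scheme \<Rightarrow> ('g, 'v::complex_vector) rep \<Rightarrow> 'v set \<Rightarrow> bool" where
  "invariant_subspace G R U \<longleftrightarrow> complex_vector.subspace U \<and> U \<subseteq> rep_space R \<and>
     (\<forall>g\<in>carrier G. \<forall>x\<in>U. act R g x \<in> U)"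

definition subrep :: "('g, 'v) rep \<Rightarrow> 'v set \<Rightarrow> ('g, 'v) rep" where
  "subrep R U = R\<lparr>rep_space := U\<rparr>"

definition irreducible_rep ::
    "('g, 'b) monoid_scheme \<Rightarrow> ('g, 'v::complex_vector) rep \<Rightarrow> bool" where
  "irreducible_rep G R \<longleftrightarrow> group_representation G R \<and> rep_space R \<noteq> {0} \<and>
     (\<forall>U. invariant_subspace G R U \<longrightarrow> U = {0} \<or> U = rep_space R)"

definition occurs_in ::
    "('g, 'b) monoid_scheme \<Rightarrow> ('g, 'v::complex_vector) rep \<Rightarrow> ('g, 'w::complex_vector) rep \<Rightarrow> bool"
  where
  "occurs_in G S R \<longleftrightarrow> (\<exists>U. invariant_subspace G R U \<and> rep_iso G S (subrep R U))"

definition direct_sum_rep :: "'i set \<Rightarrow> ('i \<Rightarrow> ('g, 'v::complex_vector) rep) \<Rightarrow> ('g, 'i \<Rightarrow> 'v) rep"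
  where
  "direct_sum_rep I R =
     \<lparr>rep_space = {f. (\<forall>i\<in>I. f i \<in> rep_space (R i)) \<and> (\<forall>i. i \<notin> I \<longrightarrow> f i = 0) \<and> finite {i. f i \<noteq> 0}},
      act = (\<lambda>g f i. if i \<in> I then act (R i) g (f i) else 0)\<rparr>"

text \<open>A Gelfand model is a direct sum of irreducible representations such that each irreducible
  representation is isomorphic to exactly one summand.  The type argument fixes the ambient type of
  the irreducible representations against which this is tested; as a free type variable of a theorem
  it is universally quantified.\<close>

definition gelfand_model ::
    "'v::complex_vector itself \<Rightarrow> ('g, 'b) monoid_scheme \<Rightarrow> ('g, 'w::complex_vector) rep \<Rightarrow> bool" where
  "gelfand_model (_ :: 'v itself) G R \<longleftrightarrow>
     (\<exists>\<U>. (\<forall>U\<in>\<U>. invariant_subspace G R U \<and> irreducible_rep G (subrep R U)) \<and>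
          rep_iso G R (direct_sum_rep \<U> (subrep R)) \<and>
          (\<forall>S :: ('g, 'v) rep. irreducible_rep G S \<longrightarrow> (\<exists>!U. U \<in> \<U> \<and> rep_iso G S (subrep R U))))"

section \<open>Function spaces on finite sets\<close>

text \<open>Functions on \<open>X\<close> are functions on the ambient type vanishing outside \<open>X\<close>.\<close>

definition functions_on :: "'x set \<Rightarrow> ('x \<Rightarrow> complex) set" where
  "functions_on X = {f. \<forall>x. x \<notin> X \<longrightarrow> f x = 0}"

definition perm_rep ::
    "('g, 'b) monoid_scheme \<Rightarrow> 'x set \<Rightarrow> ('g \<Rightarrow> 'x \<Rightarrow> 'x) \<Rightarrow> ('g, 'x \<Rightarrow> complex) rep" where
  "perm_rep G X \<phi> = \<lparr>rep_space = functions_on X, act = (\<lambda>g f x. f (\<phi> (inv\<^bsub>G\<^esub> g) x))\<rparr>"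

text \<open>The tensor product with the (one-dimensional) sign representation, on the same space.\<close>

definition sign_twist ::
    "(nat \<Rightarrow> nat, 'v::complex_vector) rep \<Rightarrow> (nat \<Rightarrow> nat, 'v) rep" where
  "sign_twist R = R\<lparr>act := (\<lambda>g x. of_int (sign g) *\<^sub>C act R g x)\<rparr>"

section \<open>Partitions and the irreducible representations of the symmetric group\<close>

definition partitions :: "nat \<Rightarrow> nat list set" where
  "partitions n = {lam. sorted_wrt (\<ge>) lam \<and> 0 \<notin> set lam \<and> sum_list lam = n}"

definition conjugate :: "nat list \<Rightarrow> nat list" where
  "conjugate lam =
     map (\<lambda>i. card {j. j < length lam \<and> lam ! j \<ge> i}) [1..<Suc (Max (insert 0 (set lam)))]"

definition odd_columns :: "nat list \<Rightarrow> nat" where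
  "odd_columns lam = length (filter odd (conjugate lam))"

definition ordered_set_partitions :: "nat \<Rightarrow> nat list \<Rightarrow> nat set list set" where
  "ordered_set_partitions n lam =
     {S. map card S = lam \<and> \<Union>(set S) = {1..n} \<and>
         (\<forall>i<length S. \<forall>j<length S. i \<noteq> j \<longrightarrow> S ! i \<inter> S ! j = {})}"

definition young_perm_rep :: "nat \<Rightarrow> nat list \<Rightarrow> (nat \<Rightarrow> nat, nat set list \<Rightarrow> complex) rep" where
  "young_perm_rep n lam =
     perm_rep (sym_group n) (ordered_set_partitions n lam) (\<lambda>g. map (image g))"

text \<open>For a partition of \<open>n\<close> the representation below exists and is unique up to isomorphism; since
  it occurs in \<open>young_perm_rep n lam\<close>, it has a representative on the type chosen here.\<close>

definition irrep_of_partition :: "nat \<Rightarrow> nat list \<Rightarrow> (nat \<Rightarrow> nat, nat set list \<Rightarrow> complex) rep" where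
  "irrep_of_partition n lam =
     (SOME R. irreducible_rep (sym_group n) R \<and>
              occurs_in (sym_group n) R (young_perm_rep n lam) \<and>
              occurs_in (sym_group n) R (sign_twist (young_perm_rep n (conjugate lam))))"

section \<open>Involutions and the signed conjugation action\<close>

definition involutions :: "nat \<Rightarrow> (nat \<Rightarrow> nat) set" where
  "involutions n = {w \<in> carrier (sym_group n). w \<circ> w = id}"

definition involutions_fix :: "nat \<Rightarrow> nat \<Rightarrow> (nat \<Rightarrow> nat) set" where
  "involutions_fix n k =
     {w \<in> carrier (sym_group n). w = inv\<^bsub>sym_group n\<^esub> w \<and> card {i\<in>{1..n}. w i = i} = k}"

definition i1 :: "nat \<Rightarrow> (nat \<Rightarrow> nat) \<Rightarrow> (nat \<Rightarrow> nat) \<Rightarrow> nat" where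
  "i1 n g w = card {(i, j). i \<in> {1..n} \<and> j \<in> {1..n} \<and> i < j \<and> w i = j \<and> g i > g j}"

text \<open>The representation \<open>\<rho>\<^sub>1\<close> on the functions on a conjugation-invariant set \<open>M\<close> of involutions.\<close>

definition rho1 :: "nat \<Rightarrow> (nat \<Rightarrow> nat) set \<Rightarrow> (nat \<Rightarrow> nat, (nat \<Rightarrow> nat) \<Rightarrow> complex) rep" where
  "rho1 n M =
     \<lparr>rep_space = functions_on M,
      act = (\<lambda>g f w. (-1) ^ i1 n (inv\<^bsub>sym_group n\<^esub> g) w * f (inv\<^bsub>sym_group n\<^esub> g \<circ> w \<circ> g))\<rparr>"

end

theory Submission
  imports Defs "HOL-Combinatorics.Orbits"
begin

text \<open>For a tableau of shape \<open>\<lambda>\<close> let \<open>a\<close> be the sum over its row stabilizer, \<open>b\<close> the signed sum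
  over its column stabilizer and \<open>e\<^sub>\<lambda> = a b a\<close>.  Then \<open>e\<^sub>\<lambda> x e\<^sub>\<lambda>\<close> is a multiple of \<open>e\<^sub>\<lambda>\<close> and
  \<open>e\<^sub>\<lambda> x e\<^sub>\<mu> = 0\<close> for \<open>\<lambda> \<noteq> \<mu>\<close>; by positivity of \<open>x\<^sup>* x\<close> the left ideal \<open>\<complex>[S\<^sub>n] e\<^sub>\<lambda>\<close> is irreducible, it is
  \<open>V\<^sub>\<lambda>\<close>, and it embeds into every representation on which \<open>e\<^sub>\<lambda>\<close> does not act as zero.

  There are as many partitions as conjugacy classes, so the conjugation averages of the \<open>e\<^sub>\<lambda>\<close>, being
  linearly independent, span the centre.  In particular 1 is a combination of elements \<open>g e\<^sub>\<lambda> g\<inverse>\<close>, so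
  no representation is killed by all the \<open>e\<^sub>\<lambda>\<close> and every irreducible representation is some \<open>V\<^sub>\<lambda>\<close>.
  When \<open>u\<close> and \<open>v\<close> run through a basis of \<open>\<complex>[S\<^sub>n] e\<^sub>\<lambda>\<close>, the products of \<open>u\<close> with the image of \<open>v\<close> under
  the anti-automorphism \<open>g \<mapsto> g\<inverse>\<close> form, for all \<open>\<lambda>\<close> together, a basis of \<open>\<complex>[S\<^sub>n]\<close>.  The
  anti-automorphism permutes it by \<open>(u, v) \<mapsto> (v, u)\<close>; comparing traces, the sum of the dimensions of
  the \<open>V\<^sub>\<lambda>\<close> is the number of involutions.

  It remains to see that \<open>e\<^sub>\<lambda>\<close> acts nontrivially on \<open>\<complex>[M\<^sub>n\<^sub>,\<^sub>k]\<close> if \<open>\<lambda>\<close> has \<open>k\<close> odd columns.  Let \<open>w\<close>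
  exchange, within each column of the tableau, the entries of the first and second row, of the third
  and fourth row, and so on.  The coefficient of \<open>w\<close> in \<open>a b w\<close> is a sum over the row and column
  permutations \<open>p\<close>, \<open>q\<close> for which \<open>p q\<close> commutes with \<open>w\<close>.  In this case both \<open>p\<close> and \<open>q\<close> commute with
  \<open>w\<close>, the sign of \<open>q\<close> cancels against the sign of its action, and every term is 1.\<close>

text \<open>The symmetrizer is \<open>a b a\<close> rather than the customary \<open>a b\<close>
  because it is fixed by both \<open>star\<close> (the adjoint) and \<open>flip\<close> (linear
  inversion). The first symmetry gives, for nonzero \<open>y = x e\<close>, the identity
  \<open>star y y = e (star x x) e\<close>, a nonzero multiple of \<open>e\<close>: the generator is
  recovered from any nonzero element, and this serves where one would otherwise invoke Maschke's
  theorem and Schur's lemma. The second makes \<open>flip\<close> exchange the two factors of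
  \<open>u flip v\<close>. No multiplicity in the model is ever computed. One vector per partition
  that its \<open>e\<close> does not annihilate gives an embedded copy of the irreducible module,
  orthogonality makes the copies for different partitions independent, and the count of dimensions
  leaves no room for anything else. As these vectors can be chosen inside the part with the right
  number of fixed points, the decomposition of the whole model restricts to each part. The scalars
  \<open>c\<close> with \<open>e e = c e\<close> are never evaluated; only that they are nonzero
  matters.\<close>

declare One_nat_def [simp del]

section \<open>Linear algebra over the complex numbers\<close>

lemma sum_fun_apply: "(\<Sum>i\<in>I. f i) x = (\<Sum>i\<in>I. f i x)"
  for f :: "'i \<Rightarrow> 'x \<Rightarrow> 'a::comm_monoid_add"
  by (induction I rule: infinite_finite_induct) auto

lemma scaleC_fun_apply: "(a *\<^sub>C f) x = a *\<^sub>C f x"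
  for f :: "'x \<Rightarrow> 'v::complex_vector"
  by (simp add: scaleC_fun_def)

lemma scaleC_complex: "(a::complex) *\<^sub>C (x::complex) = a * x"
  by (simp add: scaleC_complex_def)

lemmas fun_apply_simps = sum_fun_apply scaleC_fun_apply scaleC_complex

text \<open>Unlike independence of the image set, this also forbids repeated vectors, so dimensions
  can be counted on the index set.\<close>

definition lin_indep :: "'i set \<Rightarrow> ('i \<Rightarrow> 'v::complex_vector) \<Rightarrow> bool" where
  "lin_indep I f \<longleftrightarrow> (\<forall>u. (\<Sum>i\<in>I. u i *\<^sub>C f i) = 0 \<longrightarrow> (\<forall>i\<in>I. u i = 0))"

lemma lin_indep_inj_on:
  assumes "finite I" "lin_indep I f"
  shows "inj_on f I"
proof (rule inj_onI, rule ccontr)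
  fix i j assume ij: "i \<in> I" "j \<in> I" "f i = f j" "i \<noteq> j"
  define u where "u = (\<lambda>k. if k = i then 1 else if k = j then -1 else 0 :: complex)"
  have "(\<Sum>k\<in>I. u k *\<^sub>C f k) = (\<Sum>k\<in>{i,j}. u k *\<^sub>C f k)"
    using ij assms(1) by (intro sum.mono_neutral_right) (auto simp: u_def)
  also have "\<dots> = 0"
    using ij by (simp add: u_def complex_vector.scale_minus_left)
  finally have "u i = 0" using assms(2) ij by (auto simp: lin_indep_def)
  then show False by (simp add: u_def)
qed

lemma lin_indep_independent:
  assumes "finite I" "lin_indep I f"
  shows "complex_vector.independent (f ` I)"
proof -
  have inj: "inj_on f I" using assms by (rule lin_indep_inj_on)
  show ?thesis
  proof (rule complex_vector.independent_if_scalars_zero)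
    show "finite (f ` I)" using assms by simp
    fix u x assume "(\<Sum>x\<in>f ` I. u x *\<^sub>C x) = 0" "x \<in> f ` I"
    then have "(\<Sum>i\<in>I. (u \<circ> f) i *\<^sub>C f i) = 0" by (simp add: sum.reindex[OF inj])
    then have "\<forall>i\<in>I. (u \<circ> f) i = 0" using assms(2) unfolding lin_indep_def by blast
    then show "u x = 0" using \<open>x \<in> f ` I\<close> by auto
  qed
qed

text \<open>A vector of the span of \<open>T\<close> outside the span of the family would enlarge it
  to an independent set with more than \<open>card T\<close> elements. Every dimension count of the
  proof ends here: for the class functions and for the involution model.\<close>

lemma lin_indep_spans:
  assumes "finite I" "lin_indep I f" "finite T" "f ` I \<subseteq> complex_vector.span T" "card T \<le> card I"
  shows "complex_vector.span T \<subseteq> complex_vector.span (f ` I)"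
proof (rule ccontr)
  assume "\<not> ?thesis"
  then obtain y where y: "y \<in> complex_vector.span T" "y \<notin> complex_vector.span (f ` I)" by blast
  have "complex_vector.independent (insert y (f ` I))"
    using y assms by (intro complex_vector.independent_insertI lin_indep_independent)
  then have "card (insert y (f ` I)) \<le> card T"
    using complex_vector.independent_span_bound[of T "insert y (f ` I)"] assms y by blast
  moreover have "y \<notin> f ` I" using y(2) complex_vector.span_base by blast
  ultimately show False
    using assms lin_indep_inj_on[OF assms(1,2)] by (simp add: card_image)
qed

lemma in_span_image:
  assumes "finite I" "x \<in> complex_vector.span (f ` I)"
  shows "\<exists>u. x = (\<Sum>i\<in>I. u i *\<^sub>C f i)"
  using assms(2)
proof (induction rule: complex_vector.span_induct_alt)
  case base
  then show ?case by (intro exI[of _ "\<lambda>_. 0"]) simp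
next
  case (step c z y)
  then obtain u i where ui: "y = (\<Sum>i\<in>I. u i *\<^sub>C f i)" "i \<in> I" "z = f i" by auto
  have "(\<Sum>j\<in>I. (u j + (if j = i then c else 0)) *\<^sub>C f j)
      = (\<Sum>j\<in>I. u j *\<^sub>C f j) + (\<Sum>j\<in>I. if j = i then c *\<^sub>C f j else 0)"
    by (subst sum.distrib[symmetric]) (auto intro!: sum.cong simp: scaleC_add_left)
  also have "\<dots> = c *\<^sub>C z + y" using ui assms(1) by simp
  finally show ?case by metis
qed

lemma subspace_functions_on: "complex_vector.subspace (functions_on X)"
  by (auto simp: complex_vector.subspace_def functions_on_def fun_apply_simps)

definition delta :: "'x \<Rightarrow> 'x \<Rightarrow> complex" where
  "delta x = (\<lambda>y. if y = x then 1 else 0)"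

lemma delta_in_functions_on [simp]: "x \<in> X \<Longrightarrow> delta x \<in> functions_on X"
  by (auto simp: functions_on_def delta_def)

lemma functions_on_expand:
  assumes "finite X" "f \<in> functions_on X"
  shows "f = (\<Sum>x\<in>X. f x *\<^sub>C delta x)"
proof
  fix y
  have "(\<Sum>x\<in>X. f x *\<^sub>C delta x) y = (\<Sum>x\<in>X. if x = y then f x else 0)"
    by (auto simp: fun_apply_simps delta_def intro!: sum.cong)
  also have "\<dots> = f y" using assms by (auto simp: functions_on_def)
  finally show "f y = (\<Sum>x\<in>X. f x *\<^sub>C delta x) y" by simp
qed

lemma span_delta:
  assumes "finite X"
  shows "complex_vector.span (delta ` X) = functions_on X"
proof
  show "complex_vector.span (delta ` X) \<subseteq> functions_on X"
    by (intro complex_vector.span_minimal subspace_functions_on) auto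
  show "functions_on X \<subseteq> complex_vector.span (delta ` X)"
  proof
    fix f :: "'a \<Rightarrow> complex" assume "f \<in> functions_on X"
    then have "f = (\<Sum>x\<in>X. f x *\<^sub>C delta x)" by (rule functions_on_expand[OF assms])
    also have "\<dots> \<in> complex_vector.span (delta ` X)"
      by (intro complex_vector.span_sum complex_vector.span_scale complex_vector.span_base imageI)
    finally show "f \<in> complex_vector.span (delta ` X)" .
  qed
qed

lemma basis_of_subspace:
  fixes U :: "('x \<Rightarrow> complex) set"
  assumes "complex_vector.subspace U" "U \<subseteq> functions_on X" "finite X"
  shows "\<exists>B. finite B \<and> B \<subseteq> U \<and> complex_vector.independent B \<and> complex_vector.span B = U"
proof -
  obtain B where B: "B \<subseteq> U" "complex_vector.independent B" "U \<subseteq> complex_vector.span B"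
    using complex_vector.maximal_independent_subset[of U] by blast
  have "finite B"
    using complex_vector.independent_span_bound[of "delta ` X" B] B assms
    by (auto simp: span_delta)
  moreover have "complex_vector.span B = U"
    using B assms(1) by (simp add: complex_vector.span_minimal subset_antisym)
  ultimately show ?thesis using B by blast
qed

section \<open>Isomorphisms and direct sums of representations\<close>

lemma linear_map_onD:
  assumes "linear_map_on V W T"
  shows "x \<in> V \<Longrightarrow> T x \<in> W" "x \<in> V \<Longrightarrow> y \<in> V \<Longrightarrow> T (x + y) = T x + T y"
    "x \<in> V \<Longrightarrow> T (a *\<^sub>C x) = a *\<^sub>C T x"
  using assms by (auto simp: linear_map_on_def)

lemma linear_map_on_zero:
  assumes "linear_map_on V W T" "complex_vector.subspace V"
  shows "T 0 = 0"
  using linear_map_onD(3)[OF assms(1), of 0 0] complex_vector.subspace_0[OF assms(2)] by simp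

lemma linear_map_on_sum:
  assumes "linear_map_on V W T" "complex_vector.subspace V" "\<And>i. i \<in> I \<Longrightarrow> f i \<in> V"
  shows "T (\<Sum>i\<in>I. f i) = (\<Sum>i\<in>I. T (f i))"
  using assms(3)
proof (induction I rule: infinite_finite_induct)
  case (insert i I)
  then show ?case
    using linear_map_onD(2)[OF assms(1), of "f i" "sum f I"]
      complex_vector.subspace_sum[OF assms(2), of I f] by simp
qed (auto simp: linear_map_on_zero[OF assms(1,2)])

lemma linear_map_on_inj_onI:
  assumes "linear_map_on V W T" "complex_vector.subspace V" "\<And>x. x \<in> V \<Longrightarrow> T x = 0 \<Longrightarrow> x = 0"
  shows "inj_on T V"
proof (rule inj_onI)
  fix x y assume xy: "x \<in> V" "y \<in> V" "T x = T y"
  have m: "(-1) *\<^sub>C y \<in> V" using assms(2) xy(2) by (rule complex_vector.subspace_scale)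
  have "T (x + (-1) *\<^sub>C y) = T x + (-1) *\<^sub>C T y"
    using linear_map_onD[OF assms(1)] xy m by metis
  then have "x + (-1) *\<^sub>C y = 0"
    using xy complex_vector.subspace_add[OF assms(2) xy(1) m]
    by (intro assms(3)) (simp_all add: complex_vector.scale_minus_left)
  then show "x = y" by (simp add: complex_vector.scale_minus_left)
qed

lemma linear_map_on_inv_into:
  assumes T: "linear_map_on V W T" and bij: "bij_betw T V W" and sub: "complex_vector.subspace V"
  shows "linear_map_on W V (inv_into V T)"
  unfolding linear_map_on_def
proof (intro conjI ballI allI)
  note D = linear_map_onD[OF T]
  have inj: "inj_on T V" and im: "T ` V = W" using bij by (auto simp: bij_betw_def)
  show "inv_into V T \<in> W \<rightarrow> V" using im by (auto intro: inv_into_into)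
  fix x y assume "x \<in> W" "y \<in> W"
  then obtain x' y' where xy: "x' \<in> V" "y' \<in> V" "x = T x'" "y = T y'" using im by auto
  then have "x + y = T (x' + y')" "x' + y' \<in> V" using D sub by (auto simp: complex_vector.subspace_def)
  then show "inv_into V T (x + y) = inv_into V T x + inv_into V T y"
    using xy inj by (simp add: inv_into_f_f)
next
  note D = linear_map_onD[OF T]
  have inj: "inj_on T V" and im: "T ` V = W" using bij by (auto simp: bij_betw_def)
  fix a x assume "x \<in> W"
  then obtain x' where xy: "x' \<in> V" "x = T x'" using im by auto
  then have "a *\<^sub>C x = T (a *\<^sub>C x')" "a *\<^sub>C x' \<in> V" using D sub by (auto simp: complex_vector.subspace_def)
  then show "inv_into V T (a *\<^sub>C x) = a *\<^sub>C inv_into V T x"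
    using xy inj by (simp add: inv_into_f_f)
qed

lemma rep_iso_sym:
  assumes "rep_iso G R S"
  shows "rep_iso G S R"
proof -
  obtain T where T: "linear_map_on (rep_space R) (rep_space S) T"
    "bij_betw T (rep_space R) (rep_space S)"
    "\<And>g x. g \<in> carrier G \<Longrightarrow> x \<in> rep_space R \<Longrightarrow> T (act R g x) = act S g (T x)"
    and RS: "group_representation G R" "group_representation G S"
    using assms by (auto simp: rep_iso_def)
  interpret R: group_representation G R by fact
  have inj: "inj_on T (rep_space R)" and im: "T ` rep_space R = rep_space S"
    using T by (auto simp: bij_betw_def)
  have "inv_into (rep_space R) T (act S g x) = act R g (inv_into (rep_space R) T x)"
    if g: "g \<in> carrier G" and x: "x \<in> rep_space S" for g x
  proof -
    obtain y where y: "y \<in> rep_space R" "x = T y" using im x by blast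
    have e: "act S g x = T (act R g y)" unfolding y(2) by (rule T(3)[OF g y(1), symmetric])
    have a: "act R g y \<in> rep_space R" using R.linear[OF g] y(1) by (rule linear_map_onD(1))
    show ?thesis unfolding e unfolding y(2) inv_into_f_f[OF inj a] inv_into_f_f[OF inj y(1)] ..
  qed
  then show ?thesis
    using RS linear_map_on_inv_into[OF T(1,2) R.subspace] bij_betw_inv_into[OF T(2)]
    unfolding rep_iso_def by blast
qed

lemma rep_iso_trans:
  assumes "rep_iso G R S" "rep_iso G S Q"
  shows "rep_iso G R Q"
proof -
  obtain T where T: "linear_map_on (rep_space R) (rep_space S) T"
    "bij_betw T (rep_space R) (rep_space S)"
    "\<forall>g\<in>carrier G. \<forall>x\<in>rep_space R. T (act R g x) = act S g (T x)"
    using assms by (auto simp: rep_iso_def)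
  obtain U where U: "linear_map_on (rep_space S) (rep_space Q) U"
    "bij_betw U (rep_space S) (rep_space Q)"
    "\<forall>g\<in>carrier G. \<forall>x\<in>rep_space S. U (act S g x) = act Q g (U x)"
    using assms by (auto simp: rep_iso_def)
  note DT = linear_map_onD[OF T(1)] and DU = linear_map_onD[OF U(1)]
  have "linear_map_on (rep_space R) (rep_space Q) (U \<circ> T)"
    unfolding linear_map_on_def using DT DU by auto
  moreover have "bij_betw (U \<circ> T) (rep_space R) (rep_space Q)"
    using T U by (auto intro: bij_betw_trans)
  moreover have "\<forall>g\<in>carrier G. \<forall>x\<in>rep_space R. (U \<circ> T) (act R g x) = act Q g ((U \<circ> T) x)"
    using T U DT by auto
  ultimately show ?thesis using assms unfolding rep_iso_def by blast
qed

lemma rep_space_subrep [simp]: "rep_space (subrep R U) = U"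
  and act_subrep [simp]: "act (subrep R U) = act R"
  by (simp_all add: subrep_def)

context group_representation
begin

lemma act_in: "g \<in> carrier G \<Longrightarrow> x \<in> rep_space R \<Longrightarrow> act R g x \<in> rep_space R"
  using linear by (auto dest: linear_map_onD)

lemma act_add:
  "g \<in> carrier G \<Longrightarrow> x \<in> rep_space R \<Longrightarrow> y \<in> rep_space R \<Longrightarrow> act R g (x + y) = act R g x + act R g y"
  using linear by (auto dest: linear_map_onD)

lemma act_scale:
  "g \<in> carrier G \<Longrightarrow> x \<in> rep_space R \<Longrightarrow> act R g (a *\<^sub>C x) = a *\<^sub>C act R g x"
  using linear by (auto dest: linear_map_onD)

lemma act_zero: "g \<in> carrier G \<Longrightarrow> act R g 0 = 0"
  using linear_map_on_zero[OF linear subspace] by blast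

lemma act_sum:
  "g \<in> carrier G \<Longrightarrow> (\<And>i. i \<in> I \<Longrightarrow> f i \<in> rep_space R) \<Longrightarrow>
    act R g (\<Sum>i\<in>I. f i) = (\<Sum>i\<in>I. act R g (f i))"
  using linear_map_on_sum[OF linear subspace] by blast

lemma subrep_representation:
  assumes "invariant_subspace G R U"
  shows "group_representation G (subrep R U)"
proof
  have U: "complex_vector.subspace U" "U \<subseteq> rep_space R"
    "\<And>g x. g \<in> carrier G \<Longrightarrow> x \<in> U \<Longrightarrow> act R g x \<in> U"
    using assms by (auto simp: invariant_subspace_def)
  show "complex_vector.subspace (rep_space (subrep R U))" using U by simp
  show "linear_map_on (rep_space (subrep R U)) (rep_space (subrep R U)) (act (subrep R U) g)"
    if "g \<in> carrier G" for g
    using that U act_add act_scale by (auto simp: linear_map_on_def subset_iff)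
  show "act (subrep R U) \<one> x = x" if "x \<in> rep_space (subrep R U)" for x
    using that U act_one by auto
  show "act (subrep R U) (g \<otimes> h) x = act (subrep R U) g (act (subrep R U) h x)"
    if "g \<in> carrier G" "h \<in> carrier G" "x \<in> rep_space (subrep R U)" for g h x
    using that U act_mult by auto
qed

end

lemma subrep_rep_space [simp]: "subrep R (rep_space R) = R"
  by (simp add: subrep_def)

lemma rep_space_direct_sum:
  "f \<in> rep_space (direct_sum_rep I R) \<longleftrightarrow>
     (\<forall>i\<in>I. f i \<in> rep_space (R i)) \<and> (\<forall>i. i \<notin> I \<longrightarrow> f i = 0) \<and> finite {i. f i \<noteq> 0}"
  by (simp add: direct_sum_rep_def)

lemma act_direct_sum:
  "act (direct_sum_rep I R) g f = (\<lambda>i. if i \<in> I then act (R i) g (f i) else 0)"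
  by (simp add: direct_sum_rep_def)

lemma direct_sum_representation:
  fixes G (structure)
  assumes G: "group G" and R: "\<And>i. i \<in> I \<Longrightarrow> group_representation G (R i)"
  shows "group_representation G (direct_sum_rep I R)"
proof -
  interpret group G by fact
  note ss = group_representation.subspace[OF R]
  show ?thesis
  proof
    show "complex_vector.subspace (rep_space (direct_sum_rep I R))"
    proof (rule complex_vector.subspaceI)
      show "0 \<in> rep_space (direct_sum_rep I R)"
        using ss by (simp add: rep_space_direct_sum complex_vector.subspace_0)
    next
      fix x y assume xy: "x \<in> rep_space (direct_sum_rep I R)" "y \<in> rep_space (direct_sum_rep I R)"
      have "finite {i. (x + y) i \<noteq> 0}"
        by (rule finite_subset[of _ "{i. x i \<noteq> 0} \<union> {i. y i \<noteq> 0}"]) (use xy in \<open>auto simp: rep_space_direct_sum\<close>)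
      then show "x + y \<in> rep_space (direct_sum_rep I R)"
        using xy ss by (simp add: rep_space_direct_sum complex_vector.subspace_add)
    next
      fix c x assume x: "x \<in> rep_space (direct_sum_rep I R)"
      have "finite {i. (c *\<^sub>C x) i \<noteq> 0}"
        by (rule finite_subset[of _ "{i. x i \<noteq> 0}"]) (use x in \<open>auto simp: rep_space_direct_sum scaleC_fun_apply\<close>)
      then show "c *\<^sub>C x \<in> rep_space (direct_sum_rep I R)"
        using x ss by (simp add: rep_space_direct_sum complex_vector.subspace_scale scaleC_fun_apply)
    qed
  next
    fix g assume g: "g \<in> carrier G"
    have fin: "finite {i. act (direct_sum_rep I R) g x i \<noteq> 0}" if "finite {i. x i \<noteq> 0}" for x
      using that by (rule finite_subset[rotated])
        (auto simp: act_direct_sum group_representation.act_zero[OF R g])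
    show "linear_map_on (rep_space (direct_sum_rep I R)) (rep_space (direct_sum_rep I R))
        (act (direct_sum_rep I R) g)"
      unfolding linear_map_on_def
    proof (intro conjI ballI allI funcsetI)
      fix x assume x: "x \<in> rep_space (direct_sum_rep I R)"
      show "act (direct_sum_rep I R) g x \<in> rep_space (direct_sum_rep I R)"
        using x fin[of x] g
        by (simp add: rep_space_direct_sum act_direct_sum group_representation.act_in[OF R])
      show "act (direct_sum_rep I R) g (a *\<^sub>C x) = a *\<^sub>C act (direct_sum_rep I R) g x" for a
        using x g by (intro ext)
          (simp add: rep_space_direct_sum act_direct_sum scaleC_fun_apply group_representation.act_scale[OF R])
      fix y assume y: "y \<in> rep_space (direct_sum_rep I R)"
      show "act (direct_sum_rep I R) g (x + y)
          = act (direct_sum_rep I R) g x + act (direct_sum_rep I R) g y"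
        using x y g by (intro ext)
          (simp add: rep_space_direct_sum act_direct_sum group_representation.act_add[OF R])
    qed
  next
    fix x assume "x \<in> rep_space (direct_sum_rep I R)"
    then show "act (direct_sum_rep I R) \<one> x = x"
      by (intro ext) (simp add: rep_space_direct_sum act_direct_sum group_representation.act_one[OF R])
  next
    fix g h x
    assume "g \<in> carrier G" "h \<in> carrier G" "x \<in> rep_space (direct_sum_rep I R)"
    then show "act (direct_sum_rep I R) (g \<otimes> h) x
        = act (direct_sum_rep I R) g (act (direct_sum_rep I R) h x)"
      by (intro ext) (simp add: rep_space_direct_sum act_direct_sum group_representation.act_mult[OF R])
  qed
qed

text \<open>The map goes from the external sum to \<open>R\<close> and adds up the
  \<open>\<phi> i (f i)\<close> over the support of \<open>f\<close>. The hypotheses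
  \<open>inj\<close> and \<open>surj\<close> are its injectivity and surjectivity, stated for finite
  subfamilies so that applications need not deal with supports.\<close>

lemma rep_iso_direct_sumI:
  fixes S :: "'i \<Rightarrow> ('g, 'v::complex_vector) rep" and R :: "('g, 'w::complex_vector) rep"
  assumes R: "group_representation G R" and S: "\<And>i. i \<in> I \<Longrightarrow> group_representation G (S i)"
    and lin: "\<And>i. i \<in> I \<Longrightarrow> linear_map_on (rep_space (S i)) (rep_space R) (\<phi> i)"
    and equiv: "\<And>i g x. i \<in> I \<Longrightarrow> g \<in> carrier G \<Longrightarrow> x \<in> rep_space (S i) \<Longrightarrow>
      \<phi> i (act (S i) g x) = act R g (\<phi> i x)"
    and inj: "\<And>J f. finite J \<Longrightarrow> J \<subseteq> I \<Longrightarrow> (\<And>i. i \<in> J \<Longrightarrow> f i \<in> rep_space (S i)) \<Longrightarrow>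
      (\<Sum>i\<in>J. \<phi> i (f i)) = 0 \<Longrightarrow> \<forall>i\<in>J. f i = 0"
    and surj: "\<And>r. r \<in> rep_space R \<Longrightarrow> \<exists>J f. finite J \<and> J \<subseteq> I \<and>
      (\<forall>i\<in>J. f i \<in> rep_space (S i)) \<and> r = (\<Sum>i\<in>J. \<phi> i (f i))"
  shows "rep_iso G R (direct_sum_rep I S)"
proof -
  interpret R: group_representation G R by fact
  let ?D = "direct_sum_rep I S"
  have D: "group_representation G ?D"
    using direct_sum_representation[OF R.group_axioms S] .
  interpret D: group_representation G ?D by fact
  note Sss = group_representation.subspace[OF S]
  note lz = linear_map_on_zero[OF lin Sss]
  define \<Phi> where "\<Phi> f = (\<Sum>i\<in>{i. f i \<noteq> 0}. \<phi> i (f i))" for f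
  \<comment> \<open>Since \<open>\<phi> i 0 = 0\<close>, any finite set containing the support may
    be summed over; additivity needs this because the supports of \<open>f\<close>, \<open>h\<close>
    and \<open>f + h\<close> differ.\<close>
  have Phi: "\<Phi> f = (\<Sum>i\<in>J. \<phi> i (f i))"
    if "f \<in> rep_space ?D" "finite J" "J \<subseteq> I" "{i. f i \<noteq> 0} \<subseteq> J" for f J
    unfolding \<Phi>_def using that lz by (intro sum.mono_neutral_left) (auto simp: subset_iff)
  have mem: "f i \<in> rep_space (S i)" if "f \<in> rep_space ?D" "i \<in> I" for f i
    using that by (simp add: rep_space_direct_sum)
  have supp: "finite {i. f i \<noteq> 0}" "{i. f i \<noteq> 0} \<subseteq> I" if "f \<in> rep_space ?D" for f
    using that by (auto simp: rep_space_direct_sum)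
  have "linear_map_on (rep_space ?D) (rep_space R) \<Phi>"
    unfolding linear_map_on_def
  proof (intro conjI ballI allI funcsetI)
    fix f assume f: "f \<in> rep_space ?D"
    show "\<Phi> f \<in> rep_space R" unfolding \<Phi>_def
      using supp[OF f] mem[OF f] lin
      by (intro complex_vector.subspace_sum[OF R.subspace]) (auto dest: linear_map_onD)
    fix a
    have "a *\<^sub>C f \<in> rep_space ?D" using f D.subspace complex_vector.subspace_scale by blast
    then have "\<Phi> (a *\<^sub>C f) = (\<Sum>i\<in>{i. f i \<noteq> 0}. \<phi> i ((a *\<^sub>C f) i))"
      using supp[OF f] by (intro Phi) (auto simp: scaleC_fun_apply)
    also have "\<dots> = a *\<^sub>C \<Phi> f" unfolding \<Phi>_def complex_vector.scale_sum_right
      using supp[OF f] mem[OF f] lin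
      by (intro sum.cong) (auto simp: scaleC_fun_apply dest: linear_map_onD)
    finally show "\<Phi> (a *\<^sub>C f) = a *\<^sub>C \<Phi> f" .
  next
    fix f h assume f: "f \<in> rep_space ?D" and h: "h \<in> rep_space ?D"
    let ?J = "{i. f i \<noteq> 0} \<union> {i. h i \<noteq> 0}"
    have J: "finite ?J" "?J \<subseteq> I" using supp f h by auto
    have "f + h \<in> rep_space ?D" using f h D.subspace complex_vector.subspace_add by blast
    then have "\<Phi> (f + h) = (\<Sum>i\<in>?J. \<phi> i ((f + h) i))"
      using J by (intro Phi) auto
    also have "\<dots> = (\<Sum>i\<in>?J. \<phi> i (f i) + \<phi> i (h i))"
      using J(2) linear_map_onD(2)[OF lin mem[OF f] mem[OF h]] by (intro sum.cong) (auto simp del: Un_iff)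
    also have "\<dots> = \<Phi> f + \<Phi> h"
      using Phi[OF f J] Phi[OF h J] by (simp add: sum.distrib)
    finally show "\<Phi> (f + h) = \<Phi> f + \<Phi> h" .
  qed
  moreover have "bij_betw \<Phi> (rep_space ?D) (rep_space R)"
    unfolding bij_betw_def
  proof
    show "inj_on \<Phi> (rep_space ?D)"
    proof (rule linear_map_on_inj_onI[OF calculation D.subspace])
      fix f assume f: "f \<in> rep_space ?D" "\<Phi> f = 0"
      have "\<forall>i\<in>{i. f i \<noteq> 0}. f i = 0"
        using supp[OF f(1)] mem[OF f(1)] f(2) by (intro inj) (auto simp: \<Phi>_def)
      then show "f = 0" by auto
    qed
    show "\<Phi> ` rep_space ?D = rep_space R"
    proof
      show "\<Phi> ` rep_space ?D \<subseteq> rep_space R"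
        using calculation by (auto dest: linear_map_onD)
      show "rep_space R \<subseteq> \<Phi> ` rep_space ?D"
      proof
        fix r assume "r \<in> rep_space R"
        from surj[OF this] obtain J f where J: "finite J" "J \<subseteq> I" "\<forall>i\<in>J. f i \<in> rep_space (S i)"
          "r = (\<Sum>i\<in>J. \<phi> i (f i))" by (elim exE conjE)
        define f' where "f' = (\<lambda>i. if i \<in> J then f i else 0)"
        have "{i. f' i \<noteq> 0} \<subseteq> J" by (auto simp: f'_def)
        then have f': "f' \<in> rep_space ?D"
          using J Sss by (auto simp: rep_space_direct_sum f'_def complex_vector.subspace_0 finite_subset)
        then have "\<Phi> f' = r" using J by (subst Phi[OF f' J(1,2)]) (auto simp: f'_def)
        then show "r \<in> \<Phi> ` rep_space ?D" using f' by blast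
      qed
    qed
  qed
  moreover have "\<Phi> (act ?D g f) = act R g (\<Phi> f)" if g: "g \<in> carrier G" and f: "f \<in> rep_space ?D" for g f
  proof -
    have "{i. act ?D g f i \<noteq> 0} \<subseteq> {i. f i \<noteq> 0}"
      using group_representation.act_zero[OF S] g by (auto simp: act_direct_sum split: if_splits)
    then have "\<Phi> (act ?D g f) = (\<Sum>i\<in>{i. f i \<noteq> 0}. \<phi> i (act ?D g f i))"
      using supp[OF f] D.act_in[OF g f] by (intro Phi) auto
    also have "\<dots> = (\<Sum>i\<in>{i. f i \<noteq> 0}. act R g (\<phi> i (f i)))"
      using supp[OF f] mem[OF f] equiv g by (intro sum.cong) (auto simp: act_direct_sum)
    also have "\<dots> = act R g (\<Phi> f)" unfolding \<Phi>_def
      using supp[OF f] mem[OF f] lin g by (intro R.act_sum[symmetric]) (auto dest: linear_map_onD(1))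
    finally show ?thesis .
  qed
  ultimately have "rep_iso G ?D R" unfolding rep_iso_def using R D by blast
  then show ?thesis by (rule rep_iso_sym)
qed

section \<open>The group algebra of a finite group\<close>

locale finite_group = group G for G :: "('g, 'b) monoid_scheme" (structure) +
  assumes finite_carrier [simp]: "finite (carrier G)"
begin

abbreviation galg :: "('g \<Rightarrow> complex) set" where
  "galg \<equiv> functions_on (carrier G)"

definition conv :: "('g \<Rightarrow> complex) \<Rightarrow> ('g \<Rightarrow> complex) \<Rightarrow> 'g \<Rightarrow> complex"  (infixl \<open>\<star>\<close> 70) where
  "f \<star> h = (\<lambda>x. if x \<in> carrier G then \<Sum>g\<in>carrier G. f g * h (inv g \<otimes> x) else 0)"

definition alg_act :: "('g, 'v::complex_vector) rep \<Rightarrow> ('g \<Rightarrow> complex) \<Rightarrow> 'v \<Rightarrow> 'v" where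
  "alg_act R f v = (\<Sum>g\<in>carrier G. f g *\<^sub>C act R g v)"

definition regular_rep :: "('g, 'g \<Rightarrow> complex) rep" where
  "regular_rep = \<lparr>rep_space = galg,
     act = (\<lambda>g f x. if x \<in> carrier G then f (inv g \<otimes> x) else 0)\<rparr>"

text \<open>The linear extension of inversion. Being linear, it has a trace, which is computed below
  in two bases.\<close>

definition flip :: "('g \<Rightarrow> complex) \<Rightarrow> 'g \<Rightarrow> complex" where
  "flip f = (\<lambda>x. if x \<in> carrier G then f (inv x) else 0)"

text \<open>The conjugate-linear companion of \<open>flip\<close>: left multiplication by
  \<open>star f\<close> is adjoint to left multiplication by \<open>f\<close> for the standard inner
  product.\<close>

definition star :: "('g \<Rightarrow> complex) \<Rightarrow> 'g \<Rightarrow> complex" where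
  "star f = (\<lambda>x. if x \<in> carrier G then cnj (f (inv x)) else 0)"

lemma sum_translate:
  assumes "g \<in> carrier G"
  shows "(\<Sum>x\<in>carrier G. F (g \<otimes> x)) = (\<Sum>x\<in>carrier G. F x)"
  using assms by (intro sum.reindex_bij_betw) (auto simp: bij_betw_def inj_on_cmult surj_const_mult)

lemma sum_inv: "(\<Sum>x\<in>carrier G. F (inv x)) = (\<Sum>x\<in>carrier G. F x)"
  by (intro sum.reindex_bij_witness[of _ "\<lambda>x. inv x" "\<lambda>x. inv x"]) auto

lemma inv_mult_cancel: "g \<in> carrier G \<Longrightarrow> x \<in> carrier G \<Longrightarrow> inv g \<otimes> (g \<otimes> x) = x"
  by (simp add: m_assoc[symmetric])

lemma mult_inv_cancel: "g \<in> carrier G \<Longrightarrow> x \<in> carrier G \<Longrightarrow> g \<otimes> (inv g \<otimes> x) = x"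
  by (simp add: m_assoc[symmetric])

lemma conv_in [simp]: "f \<star> h \<in> galg"
  by (simp add: functions_on_def conv_def)

lemma flip_in [simp]: "flip f \<in> galg"
  by (simp add: functions_on_def flip_def)

lemma star_in [simp]: "star f \<in> galg"
  by (simp add: functions_on_def star_def)

lemma galg_eqI: "f \<in> galg \<Longrightarrow> h \<in> galg \<Longrightarrow> (\<And>x. x \<in> carrier G \<Longrightarrow> f x = h x) \<Longrightarrow> f = h"
  by (rule ext, case_tac "x \<in> carrier G") (auto simp: functions_on_def)

text \<open>Substituting \<open>g \<otimes> x\<close> for \<open>x\<close> in the inner sum. With
  values of \<open>F\<close> in an arbitrary vector space, the module law
  \<open>alg_act_conv\<close> and associativity of convolution are both instances.\<close>

lemma sum_conv:
  "(\<Sum>x\<in>carrier G. (f \<star> h) x *\<^sub>C F x) = (\<Sum>g\<in>carrier G. \<Sum>x\<in>carrier G. (f g * h x) *\<^sub>C F (g \<otimes> x))"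
proof -
  have "(\<Sum>x\<in>carrier G. (f \<star> h) x *\<^sub>C F x)
      = (\<Sum>x\<in>carrier G. \<Sum>g\<in>carrier G. (f g * h (inv g \<otimes> x)) *\<^sub>C F x)"
    by (simp add: conv_def complex_vector.scale_sum_left)
  also have "\<dots> = (\<Sum>g\<in>carrier G. \<Sum>x\<in>carrier G. (f g * h (inv g \<otimes> x)) *\<^sub>C F x)"
    by (rule sum.swap)
  also have "\<dots> = (\<Sum>g\<in>carrier G. \<Sum>x\<in>carrier G. (f g * h (inv g \<otimes> (g \<otimes> x))) *\<^sub>C F (g \<otimes> x))"
    by (rule sum.cong[OF refl], rule sum_translate[symmetric])
  also have "\<dots> = (\<Sum>g\<in>carrier G. \<Sum>x\<in>carrier G. (f g * h x) *\<^sub>C F (g \<otimes> x))"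
    by (intro sum.cong refl) (simp add: inv_mult_cancel)
  finally show ?thesis .
qed

lemma alg_act_conv:
  assumes "group_representation G R" "v \<in> rep_space R"
  shows "alg_act R (f \<star> h) v = alg_act R f (alg_act R h v)"
proof -
  interpret R: group_representation G R by fact
  have "alg_act R (f \<star> h) v
      = (\<Sum>g\<in>carrier G. \<Sum>x\<in>carrier G. (f g * h x) *\<^sub>C act R g (act R x v))"
    unfolding alg_act_def sum_conv using R.act_mult assms(2) by (intro sum.cong refl) auto
  also have "\<dots> = (\<Sum>g\<in>carrier G. f g *\<^sub>C act R g (alg_act R h v))"
  proof (intro sum.cong refl)
    fix g assume g: "g \<in> carrier G"
    have "act R g (alg_act R h v) = (\<Sum>x\<in>carrier G. act R g (h x *\<^sub>C act R x v))"
      unfolding alg_act_def using g assms(2) R.act_in R.subspace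
      by (intro R.act_sum) (auto simp: complex_vector.subspace_scale)
    also have "\<dots> = (\<Sum>x\<in>carrier G. h x *\<^sub>C act R g (act R x v))"
      using g assms(2) R.act_in by (intro sum.cong refl R.act_scale) auto
    finally show "(\<Sum>x\<in>carrier G. (f g * h x) *\<^sub>C act R g (act R x v)) = f g *\<^sub>C act R g (alg_act R h v)"
      by (simp add: complex_vector.scale_sum_right)
  qed
  finally show ?thesis by (simp add: alg_act_def)
qed

lemma conv_assoc: "f \<star> h \<star> k = f \<star> (h \<star> k)"
proof (rule galg_eqI)
  fix x assume x: "x \<in> carrier G"
  have "(f \<star> h \<star> k) x = (\<Sum>y\<in>carrier G. (f \<star> h) y *\<^sub>C k (inv y \<otimes> x))"
    using x by (simp add: conv_def[of _ k] scaleC_complex)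
  also have "\<dots> = (\<Sum>g\<in>carrier G. \<Sum>y\<in>carrier G. (f g * h y) *\<^sub>C k (inv (g \<otimes> y) \<otimes> x))"
    by (rule sum_conv)
  also have "\<dots> = (f \<star> (h \<star> k)) x"
    using x by (simp add: conv_def[of f] conv_def[of h] scaleC_complex inv_mult_group m_assoc
        sum_distrib_left mult.assoc cong: sum.cong)
  finally show "(f \<star> h \<star> k) x = (f \<star> (h \<star> k)) x" .
qed auto

lemma conv_add_left: "(f + f') \<star> h = f \<star> h + f' \<star> h"
  by (rule ext) (simp add: conv_def distrib_right sum.distrib)

lemma conv_add_right: "f \<star> (h + h') = f \<star> h + f \<star> h'"
  by (rule ext) (simp add: conv_def distrib_left sum.distrib)

lemma conv_scale_left: "(a *\<^sub>C f) \<star> h = a *\<^sub>C (f \<star> h)"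
  by (rule ext) (simp add: conv_def fun_apply_simps sum_distrib_left mult.assoc)

lemma conv_scale_right: "f \<star> (a *\<^sub>C h) = a *\<^sub>C (f \<star> h)"
  by (rule ext) (simp add: conv_def fun_apply_simps sum_distrib_left mult.left_commute)

lemma conv_zero_left [simp]: "0 \<star> h = 0"
  by (rule ext) (simp add: conv_def)

lemma conv_zero_right [simp]: "f \<star> 0 = 0"
  by (rule ext) (simp add: conv_def)

lemma conv_sum_left: "(\<Sum>i\<in>I. f i) \<star> h = (\<Sum>i\<in>I. f i \<star> h)"
  by (induction I rule: infinite_finite_induct) (simp_all only: sum.infinite sum.empty sum.insert simp_thms conv_add_left conv_zero_left)

lemma conv_sum_right: "h \<star> (\<Sum>i\<in>I. f i) = (\<Sum>i\<in>I. h \<star> f i)"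
  by (induction I rule: infinite_finite_induct) (simp_all only: sum.infinite sum.empty sum.insert simp_thms conv_add_right conv_zero_right)

lemma delta_conv:
  assumes "g \<in> carrier G"
  shows "(delta g \<star> f) x = (if x \<in> carrier G then f (inv g \<otimes> x) else 0)"
  using assms by (simp add: conv_def delta_def if_distrib[of "\<lambda>t. t * _"] cong: if_cong)

lemma conv_delta:
  assumes "g \<in> carrier G"
  shows "(f \<star> delta g) x = (if x \<in> carrier G then f (x \<otimes> inv g) else 0)"
proof (cases "x \<in> carrier G")
  case True
  have "inv h \<otimes> x = g \<longleftrightarrow> h = x \<otimes> inv g" if "h \<in> carrier G" for h
    using that True assms by (metis inv_solve_left inv_solve_right)
  then have "(f \<star> delta g) x = (\<Sum>h\<in>carrier G. if h = x \<otimes> inv g then f h else 0)"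
    using True by (simp add: conv_def delta_def if_distrib[of "\<lambda>t. _ * t"] cong: if_cong)
  then show ?thesis using True assms by simp
qed (simp add: conv_def)

lemma delta_one_conv: "f \<in> galg \<Longrightarrow> delta \<one> \<star> f = f"
  by (rule galg_eqI) (auto simp: delta_conv)

lemma delta_mult: "g \<in> carrier G \<Longrightarrow> h \<in> carrier G \<Longrightarrow> delta g \<star> delta h = delta (g \<otimes> h)"
  by (rule galg_eqI)
    (simp_all add: delta_conv, use inv_mult_cancel mult_inv_cancel in \<open>auto simp: delta_def\<close>)

lemma galg_expand: "f \<in> galg \<Longrightarrow> f = (\<Sum>g\<in>carrier G. f g *\<^sub>C delta g)"
  by (rule functions_on_expand) auto

lemma regular_representation: "group_representation G regular_rep"
proof
  fix g assume g: "g \<in> carrier G"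
  show "linear_map_on (rep_space regular_rep) (rep_space regular_rep) (act regular_rep g)"
    by (auto simp: linear_map_on_def regular_rep_def functions_on_def fun_eq_iff fun_apply_simps)
next
  fix g h x assume "g \<in> carrier G" "h \<in> carrier G"
  then show "act regular_rep (g \<otimes> h) x = act regular_rep g (act regular_rep h x)"
    by (auto simp: regular_rep_def fun_eq_iff inv_mult_group m_assoc)
qed (simp_all add: regular_rep_def subspace_functions_on, auto simp: functions_on_def fun_eq_iff)

lemma rep_space_regular [simp]: "rep_space regular_rep = galg"
  by (simp add: regular_rep_def)

lemma act_regular: "g \<in> carrier G \<Longrightarrow> act regular_rep g f = delta g \<star> f"
  by (rule ext) (simp add: regular_rep_def delta_conv)

lemma alg_act_regular: "alg_act regular_rep f h = f \<star> h"
  by (rule ext) (simp add: alg_act_def regular_rep_def conv_def fun_apply_simps)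

lemma alg_act_scale_left: "alg_act R (a *\<^sub>C f) v = a *\<^sub>C alg_act R f v"
  by (simp add: alg_act_def complex_vector.scale_sum_right fun_apply_simps)

lemma alg_act_add_left: "alg_act R (f + h) v = alg_act R f v + alg_act R h v"
  by (simp add: alg_act_def sum.distrib scaleC_add_left)

lemma alg_act_zero_left [simp]: "alg_act R 0 v = 0"
  by (simp add: alg_act_def)

lemma alg_act_sum_left: "alg_act R (\<Sum>i\<in>I. f i) v = (\<Sum>i\<in>I. alg_act R (f i) v)"
  by (induction I rule: infinite_finite_induct) (simp_all only: sum.infinite sum.empty sum.insert simp_thms alg_act_add_left alg_act_zero_left)

lemma alg_act_delta: "g \<in> carrier G \<Longrightarrow> alg_act R (delta g) v = act R g v"
proof -
  assume g: "g \<in> carrier G"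
  have "alg_act R (delta g) v = (\<Sum>h\<in>carrier G. if h = g then act R h v else 0)"
    unfolding alg_act_def by (intro sum.cong) (auto simp: delta_def)
  then show ?thesis using g by simp
qed

lemma linear_alg_act:
  assumes "group_representation G R"
  shows "linear_map_on (rep_space R) (rep_space R) (alg_act R f)"
proof -
  interpret R: group_representation G R by fact
  show ?thesis
    unfolding linear_map_on_def alg_act_def
    using R.subspace R.act_in
    by (auto simp: R.act_add R.act_scale scaleC_add_right sum.distrib
        complex_vector.scale_sum_right mult.commute
        intro!: complex_vector.subspace_sum complex_vector.subspace_scale)
qed

lemma alg_act_in: "group_representation G R \<Longrightarrow> v \<in> rep_space R \<Longrightarrow> alg_act R f v \<in> rep_space R"
  using linear_map_onD(1)[OF linear_alg_act] .

lemma alg_act_sum_right: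
  "group_representation G R \<Longrightarrow> (\<And>i. i \<in> I \<Longrightarrow> v i \<in> rep_space R) \<Longrightarrow>
    alg_act R f (\<Sum>i\<in>I. v i) = (\<Sum>i\<in>I. alg_act R f (v i))"
  using linear_map_on_sum[OF linear_alg_act group_representation.subspace] by blast

lemma alg_act_zero_right: "group_representation G R \<Longrightarrow> alg_act R f 0 = 0"
  using linear_map_on_zero[OF linear_alg_act group_representation.subspace] by blast

lemma alg_act_subspace:
  assumes "invariant_subspace G R U" "v \<in> U"
  shows "alg_act R f v \<in> U"
  using assms unfolding alg_act_def invariant_subspace_def
  by (intro complex_vector.subspace_sum complex_vector.subspace_scale) auto

lemma alg_act_subrep [simp]: "alg_act (subrep R U) f v = alg_act R f v"
  by (simp add: alg_act_def)

lemma equivariant_alg_act: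
  assumes "group_representation G R" "linear_map_on (rep_space R) W T" "v \<in> rep_space R"
    "\<And>g x. g \<in> carrier G \<Longrightarrow> x \<in> rep_space R \<Longrightarrow> T (act R g x) = act S g (T x)"
  shows "T (alg_act R f v) = alg_act S f (T v)"
proof -
  interpret R: group_representation G R by fact
  have "T (alg_act R f v) = (\<Sum>g\<in>carrier G. T (f g *\<^sub>C act R g v))"
    unfolding alg_act_def using assms(3) R.act_in R.subspace
    by (intro linear_map_on_sum[OF assms(2) R.subspace]) (auto simp: complex_vector.subspace_scale)
  also have "\<dots> = alg_act S f (T v)"
    unfolding alg_act_def using assms(3,4) R.act_in
    by (intro sum.cong refl) (auto simp: linear_map_onD(3)[OF assms(2)])
  finally show ?thesis .
qed

lemma rep_iso_alg_act_nonzero: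
  assumes "rep_iso G R S" "v \<in> rep_space R" "alg_act R f v \<noteq> 0"
  shows "\<exists>w\<in>rep_space S. alg_act S f w \<noteq> 0"
proof -
  obtain T where T: "linear_map_on (rep_space R) (rep_space S) T"
    "bij_betw T (rep_space R) (rep_space S)"
    "\<And>g x. g \<in> carrier G \<Longrightarrow> x \<in> rep_space R \<Longrightarrow> T (act R g x) = act S g (T x)"
    and R: "group_representation G R"
    using assms(1) by (auto simp: rep_iso_def)
  have "T (alg_act R f v) = alg_act S f (T v)"
    by (rule equivariant_alg_act[OF R T(1) assms(2) T(3)])
  moreover have "T (alg_act R f v) \<noteq> T 0"
    using T(2) assms(2,3) alg_act_in[OF R assms(2)]
      complex_vector.subspace_0[OF group_representation.subspace[OF R]]
    by (auto simp: bij_betw_def inj_on_def)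
  ultimately show ?thesis
    using linear_map_on_zero[OF T(1) group_representation.subspace[OF R]]
      linear_map_onD(1)[OF T(1) assms(2)] by auto
qed

lemma invariant_alg_orbit:
  assumes "group_representation G R" "v \<in> rep_space R"
  shows "invariant_subspace G R {alg_act R x v |x. x \<in> galg}"
proof -
  let ?U = "{alg_act R x v |x. x \<in> galg}"
  have ss: "complex_vector.subspace galg" by (rule subspace_functions_on)
  have "complex_vector.subspace ?U"
  proof (rule complex_vector.subspaceI)
    show "0 \<in> ?U" using complex_vector.subspace_0[OF ss] alg_act_zero_left[of R v] by force
    show "x + y \<in> ?U" if "x \<in> ?U" "y \<in> ?U" for x y
      using that complex_vector.subspace_add[OF ss] by (force simp: alg_act_add_left[symmetric])
    show "c *\<^sub>C x \<in> ?U" if "x \<in> ?U" for c x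
      using that complex_vector.subspace_scale[OF ss] by (force simp: alg_act_scale_left[symmetric])
  qed
  moreover have "act R g u \<in> ?U" if "g \<in> carrier G" "u \<in> ?U" for g u
  proof -
    obtain x where "u = alg_act R x v" using \<open>u \<in> ?U\<close> by blast
    then have "act R g u = alg_act R (delta g \<star> x) v"
      using that assms by (simp add: alg_act_conv alg_act_delta)
    then show ?thesis by auto
  qed
  ultimately show ?thesis
    using alg_act_in[OF assms] by (auto simp: invariant_subspace_def)
qed

text \<open>The orbit of \<open>s\<close> under the group algebra is an invariant subspace
  containing \<open>s\<close>, hence the whole space.\<close>

lemma irreducible_generated:
  assumes "irreducible_rep G S" "s \<in> rep_space S" "s \<noteq> 0" "t \<in> rep_space S"
  shows "\<exists>x\<in>galg. t = alg_act S x s"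
proof -
  have S: "group_representation G S" using assms(1) by (simp add: irreducible_rep_def)
  have "s \<in> {alg_act S x s |x. x \<in> galg}"
    using alg_act_delta[of \<one> S s] group_representation.act_one[OF S assms(2)]
    by (force intro!: exI[of _ "delta \<one>"])
  then have "{alg_act S x s |x. x \<in> galg} = rep_space S"
    using invariant_alg_orbit[OF S assms(2)] assms(1,3) unfolding irreducible_rep_def by blast
  then show ?thesis using assms(4) by blast
qed

section \<open>The anti-automorphisms \<open>flip\<close> and \<open>star\<close>, and
  positivity\<close>

lemma flip_conv: "flip (f \<star> h) = flip h \<star> flip f"
proof (rule galg_eqI)
  fix x assume x: "x \<in> carrier G"
  have "(flip h \<star> flip f) x = (\<Sum>y\<in>carrier G. h (inv y) * f (inv x \<otimes> y))"
    using x by (simp add: conv_def flip_def inv_mult_group cong: sum.cong)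
  also have "\<dots> = (\<Sum>g\<in>carrier G. h (inv (x \<otimes> g)) * f (inv x \<otimes> (x \<otimes> g)))"
    by (rule sum_translate[OF x, symmetric])
  also have "\<dots> = flip (f \<star> h) x"
    using x by (simp add: conv_def flip_def inv_mult_group inv_mult_cancel mult.commute cong: sum.cong)
  finally show "flip (f \<star> h) x = (flip h \<star> flip f) x" ..
qed auto

lemma star_conv: "star (f \<star> h) = star h \<star> star f"
proof (rule galg_eqI)
  fix x assume x: "x \<in> carrier G"
  have "(star h \<star> star f) x = (\<Sum>y\<in>carrier G. cnj (h (inv y) * f (inv x \<otimes> y)))"
    using x by (simp add: conv_def star_def inv_mult_group cong: sum.cong)
  also have "\<dots> = (\<Sum>g\<in>carrier G. cnj (h (inv (x \<otimes> g)) * f (inv x \<otimes> (x \<otimes> g))))"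
    by (rule sum_translate[OF x, symmetric])
  also have "\<dots> = star (f \<star> h) x"
    using x by (simp add: conv_def star_def inv_mult_group inv_mult_cancel mult.commute cong: sum.cong)
  finally show "star (f \<star> h) x = (star h \<star> star f) x" ..
qed auto

lemma flip_flip: "f \<in> galg \<Longrightarrow> flip (flip f) = f"
  by (rule galg_eqI) (simp_all, simp add: flip_def)

lemma flip_scale: "flip (a *\<^sub>C f) = a *\<^sub>C flip f"
  by (rule ext) (simp add: flip_def fun_apply_simps)

lemma flip_add: "flip (f + h) = flip f + flip h"
  by (rule ext) (simp add: flip_def)

lemma flip_zero [simp]: "flip 0 = 0"
  by (rule ext) (simp add: flip_def)

lemma flip_sum: "flip (\<Sum>i\<in>I. f i) = (\<Sum>i\<in>I. flip (f i))"
  by (induction I rule: infinite_finite_induct) (simp_all only: sum.infinite sum.empty sum.insert simp_thms flip_add flip_zero)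

lemma flip_delta: "g \<in> carrier G \<Longrightarrow> flip (delta g) = delta (inv g)"
  by (rule galg_eqI) (simp_all, auto simp: flip_def delta_def)

text \<open>The value at the identity is the sum of the squared absolute values of the coefficients
  of \<open>f\<close>.\<close>

lemma star_conv_self_one:
  assumes "f \<in> galg" "f \<noteq> 0"
  shows "(star f \<star> f) \<one> \<noteq> 0"
proof
  assume z: "(star f \<star> f) \<one> = 0"
  have "(star f \<star> f) \<one> = (\<Sum>g\<in>carrier G. cnj (f (inv g)) * f (inv g))"
    by (simp add: conv_def star_def)
  also have "\<dots> = (\<Sum>g\<in>carrier G. cnj (f g) * f g)"
    by (rule sum_inv)
  also have "\<dots> = of_real (\<Sum>g\<in>carrier G. (cmod (f g))\<^sup>2)"
    by (simp add: complex_norm_square mult.commute del: of_real_power)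
  finally have "(\<Sum>g\<in>carrier G. (cmod (f g))\<^sup>2) = 0"
    using z by (metis of_real_eq_0_iff)
  then have "f g = 0" if "g \<in> carrier G" for g
    using that by (subst (asm) sum_nonneg_eq_0_iff) auto
  then have "f = 0" using assms(1) by (intro galg_eqI) (auto simp: functions_on_def)
  then show False using assms(2) by simp
qed

lemma star_conv_self_nonzero: "f \<in> galg \<Longrightarrow> f \<noteq> 0 \<Longrightarrow> star f \<star> f \<noteq> 0"
  using star_conv_self_one by fastforce

subsection \<open>Primitive elements and the left ideals they generate\<close>

text \<open>A nonzero multiple of a self-adjoint primitive idempotent: the last clause says that
  \<open>e A e\<close> is a line, where \<open>A\<close> is the group algebra. Leaving
  \<open>e\<close> unnormalised avoids computing the scalar in \<open>e e = c e\<close>. The clause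
  \<open>flip e = e\<close> serves the symmetric basis \<open>matrix_unit\<close>.\<close>

definition primitive :: "('g \<Rightarrow> complex) \<Rightarrow> bool" where
  "primitive e \<longleftrightarrow> e \<in> galg \<and> e \<noteq> 0 \<and> star e = e \<and> flip e = e \<and>
     (\<forall>x\<in>galg. \<exists>c. e \<star> x \<star> e = c *\<^sub>C e)"

definition left_ideal :: "('g \<Rightarrow> complex) \<Rightarrow> ('g \<Rightarrow> complex) set" where
  "left_ideal e = {x \<star> e |x. x \<in> galg}"

abbreviation ideal_rep :: "('g \<Rightarrow> complex) \<Rightarrow> ('g, 'g \<Rightarrow> complex) rep" where
  "ideal_rep e \<equiv> subrep regular_rep (left_ideal e)"

lemma left_ideal_subset: "left_ideal e \<subseteq> galg"
  by (auto simp: left_ideal_def)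

lemma primitive_in_left_ideal: "primitive e \<Longrightarrow> e \<in> left_ideal e"
  unfolding left_ideal_def primitive_def using delta_one_conv[of e]
  by (force intro!: exI[of _ "delta \<one>"])

lemma invariant_left_ideal: 
  assumes "e \<in> galg" shows "invariant_subspace G regular_rep (left_ideal e)"
  using invariant_alg_orbit[OF regular_representation, of e] assms
  by (simp add: left_ideal_def alg_act_regular)

lemma subspace_left_ideal: "e \<in> galg \<Longrightarrow> complex_vector.subspace (left_ideal e)"
  using invariant_left_ideal by (auto simp: invariant_subspace_def)

lemma ideal_representation: "e \<in> galg \<Longrightarrow> group_representation G (ideal_rep e)"
  using group_representation.subrep_representation[OF regular_representation invariant_left_ideal] .

lemma conv_left_ideal: "y \<in> left_ideal e \<Longrightarrow> x \<star> y \<in> left_ideal e"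
  unfolding left_ideal_def by (auto simp: conv_assoc[symmetric])

text \<open>This consequence of positivity takes the place of semisimplicity of the group algebra.\<close>

lemma star_self_primitive:
  assumes "primitive e" "y \<in> left_ideal e" "y \<noteq> 0"
  shows "\<exists>c. c \<noteq> 0 \<and> star y \<star> y = c *\<^sub>C e"
proof -
  obtain x where x: "y = x \<star> e" using assms(2) by (auto simp: left_ideal_def)
  have "star y \<star> y = e \<star> (star x \<star> x) \<star> e"
    using assms(1) by (simp add: x star_conv primitive_def conv_assoc)
  then obtain c where c: "star y \<star> y = c *\<^sub>C e" using assms(1) unfolding primitive_def by force
  have "y \<in> galg" using assms(2) left_ideal_subset by blast
  then have "star y \<star> y \<noteq> 0" using assms(3) by (rule star_conv_self_nonzero)
  then show ?thesis using c by force
qed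

lemma primitive_square:
  assumes "primitive e"
  shows "\<exists>c. c \<noteq> 0 \<and> e \<star> e = c *\<^sub>C e"
  using star_self_primitive[OF assms primitive_in_left_ideal[OF assms]] assms
  by (simp add: primitive_def)

text \<open>Multiplying a nonzero \<open>y\<close> of an invariant subspace by \<open>star y\<close>
  yields a nonzero multiple of the generator \<open>e\<close>, so the subspace is
  everything.\<close>

lemma ideal_rep_irreducible:
  assumes "primitive e"
  shows "irreducible_rep G (ideal_rep e)"
  unfolding irreducible_rep_def
proof (intro conjI allI impI)
  have e: "e \<in> galg" "e \<noteq> 0" using assms by (auto simp: primitive_def)
  show rep: "group_representation G (ideal_rep e)" using e by (intro ideal_representation)
  show "rep_space (ideal_rep e) \<noteq> {0}" using primitive_in_left_ideal[OF assms] e by auto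
  fix U assume U: "invariant_subspace G (ideal_rep e) U"
  show "U = {0} \<or> U = rep_space (ideal_rep e)"
  proof (cases "U = {0}")
    case False
    have sub: "complex_vector.subspace U" and UL: "U \<subseteq> left_ideal e"
      using U by (auto simp: invariant_subspace_def)
    obtain y where y: "y \<in> U" "y \<noteq> 0"
      using False complex_vector.subspace_0[OF sub] by blast
    have mult: "x \<star> u \<in> U" if "u \<in> U" for x u
      using alg_act_subspace[OF U that, of x] by (simp add: alg_act_regular)
    obtain c where c: "c \<noteq> 0" "star y \<star> y = c *\<^sub>C e"
      using star_self_primitive[OF assms _ y(2)] UL y(1) by blast
    have "e = (1 / c) *\<^sub>C (star y \<star> y)" using c by simp
    then have "e \<in> U" using mult[OF y(1)] complex_vector.subspace_scale[OF sub] by metis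
    then have "left_ideal e \<subseteq> U" using mult by (auto simp: left_ideal_def)
    then show ?thesis using UL by auto
  qed simp
qed

text \<open>This is the injectivity of \<open>y \<mapsto> y r\<close> on the left ideal: applying
  \<open>star y\<close> to \<open>y r = 0\<close> would give a nonzero multiple of
  \<open>e r\<close>.\<close>

lemma primitive_alg_act_zero:
  assumes "primitive e" "group_representation G R" "r \<in> rep_space R" "alg_act R e r \<noteq> 0"
    "y \<in> left_ideal e" "alg_act R y r = 0"
  shows "y = 0"
proof (rule ccontr)
  assume "y \<noteq> 0"
  then obtain c where c: "c \<noteq> 0" "star y \<star> y = c *\<^sub>C e"
    using star_self_primitive[OF assms(1,5)] by blast
  have "c *\<^sub>C alg_act R e r = alg_act R (star y) (alg_act R y r)"
    using c(2) alg_act_conv[OF assms(2,3)] alg_act_scale_left by metis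
  also have "\<dots> = 0" using assms(6) alg_act_zero_right[OF assms(2)] by simp
  finally show False using c(1) assms(4) by simp
qed

lemma linear_alg_act_left:
  assumes "group_representation G R" "r \<in> rep_space R" "V \<subseteq> galg"
  shows "linear_map_on V (rep_space R) (\<lambda>y. alg_act R y r)"
  using alg_act_in[OF assms(1,2)] by (auto simp: linear_map_on_def alg_act_add_left alg_act_scale_left)

text \<open>The embedding is \<open>y \<mapsto> y r\<close>. Occurrence of the irreducible module in
  \<open>R\<close> is thus certified by a single vector on which \<open>e\<close> does not
  vanish.\<close>

lemma ideal_embeds:
  assumes "primitive e" "group_representation G R" "r \<in> rep_space R" "alg_act R e r \<noteq> 0"
  defines "U \<equiv> (\<lambda>y. alg_act R y r) ` left_ideal e"
  shows "invariant_subspace G R U" "rep_iso G (ideal_rep e) (subrep R U)"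
proof -
  have e: "e \<in> galg" using assms(1) by (simp add: primitive_def)
  show inv: "invariant_subspace G R U"
  proof -
    have "U = {alg_act R x (alg_act R e r) |x. x \<in> galg}"
      unfolding U_def left_ideal_def alg_act_conv[OF assms(2,3), symmetric] by blast
    then show ?thesis using invariant_alg_orbit[OF assms(2) alg_act_in[OF assms(2,3)]] by simp
  qed
  let ?T = "\<lambda>y. alg_act R y r"
  have lin: "linear_map_on (left_ideal e) U ?T"
    using linear_alg_act_left[OF assms(2,3) left_ideal_subset]
    unfolding linear_map_on_def U_def by auto
  have "inj_on ?T (left_ideal e)"
    using primitive_alg_act_zero[OF assms(1-4)]
    by (intro linear_map_on_inj_onI[OF lin subspace_left_ideal[OF e]]) auto
  then have "bij_betw ?T (left_ideal e) U" by (simp add: bij_betw_def U_def)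
  moreover have "?T (act (ideal_rep e) g y) = act (subrep R U) g (?T y)" if "g \<in> carrier G" for g y
    using that by (simp add: act_regular alg_act_conv[OF assms(2,3)] alg_act_delta)
  ultimately show "rep_iso G (ideal_rep e) (subrep R U)"
    unfolding rep_iso_def
    using lin ideal_representation[OF e] group_representation.subrep_representation[OF assms(2) inv]
    by auto
qed

lemma irreducible_iso_ideal:
  assumes "primitive e" "irreducible_rep G S" "s \<in> rep_space S" "alg_act S e s \<noteq> 0"
  shows "rep_iso G S (ideal_rep e)"
proof -
  have S: "group_representation G S" using assms(2) by (simp add: irreducible_rep_def)
  define U where "U = (\<lambda>y. alg_act S y s) ` left_ideal e"
  note U = ideal_embeds[OF assms(1) S assms(3,4), folded U_def]
  have "alg_act S e s \<in> U" unfolding U_def using primitive_in_left_ideal[OF assms(1)] by blast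
  then have "U = rep_space S" using U(1) assms(2,4) unfolding irreducible_rep_def by blast
  then show ?thesis using rep_iso_sym[OF U(2)] by simp
qed

section \<open>Central elements obtained by conjugation\<close>

lemma star_delta: "g \<in> carrier G \<Longrightarrow> star (delta g) = delta (inv g)"
  by (rule galg_eqI) (simp_all, auto simp: star_def delta_def)

lemma star_add: "star (f + h) = star f + star h"
  by (rule ext) (simp add: star_def)

lemma star_zero [simp]: "star 0 = 0"
  by (rule ext) (simp add: star_def)

lemma star_sum: "star (\<Sum>i\<in>I. f i) = (\<Sum>i\<in>I. star (f i))"
  by (induction I rule: infinite_finite_induct)
    (simp_all only: sum.infinite sum.empty sum.insert simp_thms star_add star_zero)

text \<open>The sum runs over the group, not over a class: on the group algebra it is
  \<open>card (carrier G)\<close> times the projection onto the centre.\<close>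

definition class_sum :: "('g \<Rightarrow> complex) \<Rightarrow> 'g \<Rightarrow> complex" where
  "class_sum f = (\<Sum>g\<in>carrier G. delta g \<star> f \<star> delta (inv g))"

lemma class_sum_in [simp]: "class_sum f \<in> galg"
  unfolding class_sum_def by (rule complex_vector.subspace_sum[OF subspace_functions_on]) auto

lemma class_sum_commute:
  assumes h: "h \<in> carrier G"
  shows "delta h \<star> class_sum f = class_sum f \<star> delta h"
proof -
  have "class_sum f \<star> delta h = (\<Sum>g\<in>carrier G. delta g \<star> f \<star> delta (inv g) \<star> delta h)"
    by (simp add: class_sum_def conv_sum_left)
  also have "\<dots> = (\<Sum>g\<in>carrier G. delta (h \<otimes> g) \<star> f \<star> delta (inv (h \<otimes> g)) \<star> delta h)"
    by (rule sum_translate[OF h, symmetric])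
  also have "\<dots> = (\<Sum>g\<in>carrier G. delta h \<star> (delta g \<star> f \<star> delta (inv g)))"
  proof (rule sum.cong[OF refl])
    fix g assume g: "g \<in> carrier G"
    have "inv (h \<otimes> g) \<otimes> h = inv g" using g h by (simp add: inv_mult_group m_assoc)
    then show "delta (h \<otimes> g) \<star> f \<star> delta (inv (h \<otimes> g)) \<star> delta h = delta h \<star> (delta g \<star> f \<star> delta (inv g))"
      using g h by (simp add: conv_assoc delta_mult[of "inv (h \<otimes> g)" h] delta_mult[of h g, symmetric])
  qed
  finally show ?thesis by (simp add: class_sum_def conv_sum_right)
qed

lemma class_sum_conj:
  assumes "h \<in> carrier G" "x \<in> carrier G"
  shows "class_sum f (h \<otimes> x \<otimes> inv h) = class_sum f x"
proof -
  have "class_sum f (h \<otimes> x \<otimes> inv h) = (class_sum f \<star> delta h) (h \<otimes> x)"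
    using assms by (simp add: conv_delta)
  also have "\<dots> = (delta h \<star> class_sum f) (h \<otimes> x)"
    using assms by (simp add: class_sum_commute)
  also have "\<dots> = class_sum f x"
    using assms by (simp add: delta_conv inv_mult_cancel)
  finally show ?thesis .
qed

text \<open>As \<open>star e = e\<close>, the value of \<open>e e = c e\<close> at the identity is a
  squared norm.\<close>

lemma primitive_one:
  assumes "primitive e"
  shows "e \<one> \<noteq> 0"
proof -
  obtain c where "e \<star> e = c *\<^sub>C e" using primitive_square[OF assms] by blast
  moreover have "(e \<star> e) \<one> \<noteq> 0"
    using star_conv_self_one[of e] assms by (simp add: primitive_def)
  ultimately show ?thesis by (auto simp: fun_apply_simps)
qed

text \<open>Let \<open>z = class_sum e\<close>. Since \<open>z\<close> is central,
  \<open>z z\<close> is the sum of the conjugates of \<open>e z\<close>, so \<open>e z = 0\<close>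
  would give \<open>z z = 0\<close>. But \<open>z\<close> is self-adjoint and nonzero, its value at
  the identity being a positive multiple of that of \<open>e\<close>.\<close>

lemma class_sum_primitive:
  assumes "primitive e"
  shows "e \<star> class_sum e \<noteq> 0"
proof
  let ?z = "class_sum e"
  assume z: "e \<star> ?z = 0"
  have "?z \<star> ?z = (\<Sum>g\<in>carrier G. delta g \<star> e \<star> delta (inv g) \<star> ?z)"
    by (subst (1) class_sum_def) (rule conv_sum_left)
  also have "\<dots> = (\<Sum>g\<in>carrier G. delta g \<star> (e \<star> ?z) \<star> delta (inv g))"
    by (intro sum.cong refl) (simp add: conv_assoc class_sum_commute)
  finally have "?z \<star> ?z = (\<Sum>g\<in>carrier G. delta g \<star> (e \<star> ?z) \<star> delta (inv g))" .
  then have "?z \<star> ?z = 0" by (simp add: z)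
  moreover have "star ?z = ?z"
    using assms unfolding class_sum_def star_sum
    by (intro sum.cong refl) (simp add: star_conv star_delta conv_assoc primitive_def)
  moreover have "?z \<one> = of_nat (card (carrier G)) * e \<one>"
  proof -
    have "(delta g \<star> e \<star> delta (inv g)) \<one> = e \<one>" if "g \<in> carrier G" for g
      using that by (simp add: conv_delta delta_conv)
    then show ?thesis by (simp add: class_sum_def sum_fun_apply)
  qed
  then have "?z \<noteq> 0"
    using primitive_one[OF assms] carrier_not_empty by auto
  ultimately show False using star_conv_self_nonzero[of ?z] by simp
qed

text \<open>Both sides are the trace of \<^term>\<open>flip\<close>, computed in the basis of the
  \<^term>\<open>delta g\<close> and in the basis \<^term>\<open>E\<close>.\<close>

lemma card_involutions_eq_card_fixed:
  assumes K: "finite K" and E: "\<And>k. k \<in> K \<Longrightarrow> E k \<in> galg" and indep: "lin_indep K E"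
    and span: "\<And>g. g \<in> carrier G \<Longrightarrow> delta g \<in> complex_vector.span (E ` K)"
    and T: "\<And>k. k \<in> K \<Longrightarrow> T k \<in> K" "\<And>k. k \<in> K \<Longrightarrow> flip (E k) = E (T k)"
  shows "card {g \<in> carrier G. inv g = g} = card {k \<in> K. T k = k}"
proof -
  have "\<exists>u. delta g = (\<Sum>k\<in>K. u k *\<^sub>C E k)" if "g \<in> carrier G" for g
    using in_span_image[OF K span[OF that]] .
  then obtain P where P: "\<And>g. g \<in> carrier G \<Longrightarrow> delta g = (\<Sum>k\<in>K. P g k *\<^sub>C E k)"
    by metis
  \<comment> \<open>\<open>E k g\<close> and \<open>P g l\<close> are the two change-of-basis
    matrices; independence of the family shows that their product is the identity.\<close>
  have dual: "(\<Sum>g\<in>carrier G. E k g * P g l) = (if l = k then 1 else 0)" if kl: "k \<in> K" "l \<in> K" for k l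
  proof -
    define u where "u l = (\<Sum>g\<in>carrier G. E k g * P g l) - (if l = k then 1 else 0)" for l
    have "E k = (\<Sum>g\<in>carrier G. E k g *\<^sub>C (\<Sum>l\<in>K. P g l *\<^sub>C E l))"
      using galg_expand[OF E[OF kl(1)]] P by (simp cong: sum.cong)
    also have "\<dots> = (\<Sum>g\<in>carrier G. \<Sum>l\<in>K. (E k g * P g l) *\<^sub>C E l)"
      by (simp add: complex_vector.scale_sum_right)
    also have "\<dots> = (\<Sum>l\<in>K. \<Sum>g\<in>carrier G. (E k g * P g l) *\<^sub>C E l)"
      by (rule sum.swap)
    also have "\<dots> = (\<Sum>l\<in>K. (\<Sum>g\<in>carrier G. E k g * P g l) *\<^sub>C E l)"
      by (simp add: complex_vector.scale_sum_left)
    finally have 1: "E k = (\<Sum>l\<in>K. (\<Sum>g\<in>carrier G. E k g * P g l) *\<^sub>C E l)" .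
    have "(\<Sum>l\<in>K. (if l = k then 1 else 0) *\<^sub>C E l) = (\<Sum>l\<in>K. if l = k then E l else 0)"
      by (intro sum.cong) auto
    then have 2: "(\<Sum>l\<in>K. (if l = k then 1 else 0) *\<^sub>C E l) = E k"
      using kl K by simp
    have "(\<Sum>l\<in>K. u l *\<^sub>C E l) = 0"
      unfolding u_def complex_vector.scale_left_diff_distrib sum_subtractf 1[symmetric] 2 by simp
    then have "u l = 0" using indep kl by (auto simp: lin_indep_def)
    then show ?thesis by (simp add: u_def)
  qed
  \<comment> \<open>\<open>delta g (inv g)\<close> is the diagonal entry of \<open>flip\<close> at
    \<open>g\<close>.\<close>
  have "of_nat (card {g \<in> carrier G. inv g = g}) = (\<Sum>g\<in>carrier G. delta g (inv g))"
    by (simp add: delta_def sum.If_cases Int_def)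
  also have "\<dots> = (\<Sum>g\<in>carrier G. \<Sum>k\<in>K. E (T k) g * P g k)"
  proof (rule sum.cong[OF refl])
    fix g assume g: "g \<in> carrier G"
    have "E k (inv g) = E (T k) g" if "k \<in> K" for k
      using g T(2)[OF that, symmetric] by (simp add: flip_def)
    then show "delta g (inv g) = (\<Sum>k\<in>K. E (T k) g * P g k)"
      by (subst P[OF g]) (simp add: fun_apply_simps mult.commute cong: sum.cong)
  qed
  also have "\<dots> = (\<Sum>k\<in>K. \<Sum>g\<in>carrier G. E (T k) g * P g k)"
    by (rule sum.swap)
  also have "\<dots> = (\<Sum>k\<in>K. if T k = k then 1 else 0)"
    using T(1) dual by (intro sum.cong) auto
  also have "\<dots> = of_nat (card {k \<in> K. T k = k})"
    using K by (simp add: sum.If_cases Int_def)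
  finally show ?thesis by (simp only: of_nat_eq_iff)
qed

end

section \<open>Complete families of orthogonal primitive elements\<close>

text \<open>Orthogonality is asked with every algebra element in between: it says that there are no
  nonzero module maps between different left ideals.\<close>

locale primitive_family = finite_group G for G :: "('g, 'b) monoid_scheme" (structure) +
  fixes I :: "'i set" and e :: "'i \<Rightarrow> 'g \<Rightarrow> complex"
  assumes finite_index: "finite I"
    and primitive: "i \<in> I \<Longrightarrow> primitive (e i)"
    and orthogonal: "i \<in> I \<Longrightarrow> j \<in> I \<Longrightarrow> i \<noteq> j \<Longrightarrow> x \<in> galg \<Longrightarrow> e i \<star> x \<star> e j = 0"
begin

lemma e_in: "i \<in> I \<Longrightarrow> e i \<in> galg"
  using primitive by (auto simp: primitive_def)

lemma star_ideal_orthogonal: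
  assumes "i \<in> I" "j \<in> I" "i \<noteq> j" "y \<in> left_ideal (e i)" "y' \<in> left_ideal (e j)"
  shows "star y \<star> y' = 0"
proof -
  obtain x x' where x: "y = x \<star> e i" "y' = x' \<star> e j"
    using assms(4,5) by (auto simp: left_ideal_def)
  have "star (e i) = e i" using primitive[OF assms(1)] by (simp add: primitive_def)
  then have "star y \<star> y' = e i \<star> (star x \<star> x') \<star> e j"
    by (simp add: x star_conv conv_assoc)
  also have "\<dots> = 0" using assms by (intro orthogonal) auto
  finally show ?thesis .
qed

text \<open>Applying \<open>star (y j)\<close> annihilates every summand except the
  \<open>j\<close>-th, which becomes a nonzero multiple of \<open>e j\<close> applied to
  \<open>r j\<close>. Hence the embedded copies of different ideals form a direct sum.\<close>

lemma ideal_sum_zero: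
  assumes R: "group_representation G R" and J: "finite J" "J \<subseteq> I"
    and r: "\<And>i. i \<in> J \<Longrightarrow> r i \<in> rep_space R" "\<And>i. i \<in> J \<Longrightarrow> alg_act R (e i) (r i) \<noteq> 0"
    and y: "\<And>i. i \<in> J \<Longrightarrow> y i \<in> left_ideal (e i)"
    and sum: "(\<Sum>i\<in>J. alg_act R (y i) (r i)) = 0"
  shows "\<forall>i\<in>J. y i = 0"
proof (rule ballI, rule ccontr)
  fix j assume j: "j \<in> J" "y j \<noteq> 0"
  then obtain c where c: "c \<noteq> 0" "star (y j) \<star> y j = c *\<^sub>C e j"
    using star_self_primitive[OF primitive y] J by blast
  have ort: "star (y j) \<star> y i = 0" if "i \<in> J" "i \<noteq> j" for i
    using that j J y by (intro star_ideal_orthogonal[of j i]) auto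
  have "0 = alg_act R (star (y j)) (\<Sum>i\<in>J. alg_act R (y i) (r i))"
    by (simp add: sum alg_act_zero_right[OF R])
  also have "\<dots> = (\<Sum>i\<in>J. alg_act R (star (y j)) (alg_act R (y i) (r i)))"
    using r alg_act_in[OF R] by (intro alg_act_sum_right[OF R]) auto
  also have "\<dots> = (\<Sum>i\<in>J. alg_act R (star (y j) \<star> y i) (r i))"
    using r by (intro sum.cong refl) (simp add: alg_act_conv[OF R])
  also have "\<dots> = (\<Sum>i\<in>J. if i = j then c *\<^sub>C alg_act R (e j) (r j) else 0)"
    using ort c(2) by (intro sum.cong) (auto simp: alg_act_scale_left)
  also have "\<dots> = c *\<^sub>C alg_act R (e j) (r j)" using J j by simp
  finally show False using c(1) r(2)[OF j(1)] by simp
qed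

text \<open>Left multiplication by \<open>e j\<close> isolates the \<open>j\<close>-th coefficient:
  orthogonality kills the conjugates of the other \<open>e i\<close>, and
  \<open>class_sum_primitive\<close> keeps the \<open>j\<close>-th term alive.\<close>

lemma lin_indep_class_sum: "lin_indep I (\<lambda>i. class_sum (e i))"
  unfolding lin_indep_def
proof (intro allI impI ballI)
  fix u j assume u: "(\<Sum>i\<in>I. u i *\<^sub>C class_sum (e i)) = 0" and j: "j \<in> I"
  have "e j \<star> class_sum (e i) = 0" if "i \<in> I" "i \<noteq> j" for i
  proof -
    have "e j \<star> (delta g \<star> e i \<star> delta (inv g)) = 0" if g: "g \<in> carrier G" for g
      using orthogonal[OF j \<open>i \<in> I\<close> _, of "delta g"] that \<open>i \<noteq> j\<close>
      by (simp add: conv_assoc[symmetric])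
    then show ?thesis by (simp add: class_sum_def conv_sum_right)
  qed
  then have "e j \<star> (\<Sum>i\<in>I. u i *\<^sub>C class_sum (e i))
      = (\<Sum>i\<in>I. if i = j then u j *\<^sub>C (e j \<star> class_sum (e j)) else 0)"
    unfolding conv_sum_right by (intro sum.cong) (auto simp: conv_scale_right)
  also have "\<dots> = u j *\<^sub>C (e j \<star> class_sum (e j))" using j finite_index by simp
  finally show "u j = 0"
    using class_sum_primitive[OF primitive[OF j]] u by simp
qed

end

text \<open>The span of \<open>K\<close> contains all class functions, so
  \<open>card K \<le> card I\<close> says that there are at least as many primitive elements as the
  centre has dimensions. This is the completeness of the family.\<close>

locale complete_family = primitive_family G I e
  for G :: "('g, 'b) monoid_scheme" (structure) and I :: "'i set" and e :: "'i \<Rightarrow> 'g \<Rightarrow> complex" +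
  fixes K :: "('g \<Rightarrow> complex) set"
  assumes finite_K: "finite K" and card_K: "card K \<le> card I"
    and class_functions: "f \<in> galg \<Longrightarrow>
      (\<And>h x. h \<in> carrier G \<Longrightarrow> x \<in> carrier G \<Longrightarrow> f (h \<otimes> x \<otimes> inv h) = f x) \<Longrightarrow>
      f \<in> complex_vector.span K"
begin

text \<open>The unit is a class function, and the independent elements
  \<open>class_sum (e i)\<close>, at least as many as \<open>K\<close> has members, span all that
  \<open>K\<close> spans.\<close>

lemma delta_one_expand: "\<exists>u. delta \<one> = (\<Sum>i\<in>I. u i *\<^sub>C class_sum (e i))"
proof (rule in_span_image[OF finite_index])
  have "h \<otimes> x \<otimes> inv h = \<one> \<longleftrightarrow> x = \<one>" if "h \<in> carrier G" "x \<in> carrier G" for h x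
  proof
    assume 1: "h \<otimes> x \<otimes> inv h = \<one>"
    have "h \<otimes> x = h \<otimes> x \<otimes> inv h \<otimes> h" using that by (simp add: m_assoc)
    then have "h \<otimes> x = h" using 1 that by simp
    then show "x = \<one>" using that by simp
  qed (use that in simp)
  then have "delta \<one> \<in> complex_vector.span K"
    by (intro class_functions) (auto simp: delta_def functions_on_def)
  moreover have "(\<lambda>i. class_sum (e i)) ` I \<subseteq> complex_vector.span K"
    using class_sum_conj by (auto intro!: class_functions)
  ultimately show "delta \<one> \<in> complex_vector.span ((\<lambda>i. class_sum (e i)) ` I)"
    using lin_indep_spans[OF finite_index lin_indep_class_sum finite_K] card_K by blast
qed

text \<open>If every \<open>e i\<close> acted as zero, so would all its conjugates, hence by
  \<open>delta_one_expand\<close> the identity.\<close>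

lemma family_acts_nonzero:
  assumes S: "group_representation G S" and s: "s \<in> rep_space S" "s \<noteq> 0"
  shows "\<exists>i\<in>I. \<exists>t\<in>rep_space S. alg_act S (e i) t \<noteq> 0"
proof (rule ccontr)
  assume "\<not> ?thesis"
  then have 0: "alg_act S (e i) t = 0" if "i \<in> I" "t \<in> rep_space S" for i t
    using that by blast
  obtain u where u: "delta \<one> = (\<Sum>i\<in>I. u i *\<^sub>C class_sum (e i))"
    using delta_one_expand by blast
  have "alg_act S (class_sum (e i)) s = 0" if "i \<in> I" for i
    unfolding class_sum_def alg_act_sum_left
    using 0[OF that alg_act_in[OF S s(1)]]
    by (intro sum.neutral ballI) (simp add: alg_act_conv[OF S s(1)] alg_act_conv[OF S alg_act_in[OF S s(1)]]
        alg_act_zero_right[OF S])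
  then have "alg_act S (delta \<one>) s = 0"
    unfolding u by (simp add: alg_act_sum_left alg_act_scale_left)
  then show False
    using s group_representation.act_one[OF S] by (simp add: alg_act_delta)
qed

lemma irreducible_classification:
  assumes "irreducible_rep G S"
  shows "\<exists>i\<in>I. rep_iso G S (ideal_rep (e i))"
proof -
  have S: "group_representation G S" and "rep_space S \<noteq> {0}"
    using assms by (auto simp: irreducible_rep_def)
  then obtain s where "s \<in> rep_space S" "s \<noteq> 0"
    using complex_vector.subspace_0[OF group_representation.subspace[OF S]] by blast
  then show ?thesis
    using family_acts_nonzero[OF S] irreducible_iso_ideal[OF primitive assms] by blast
qed

section \<open>A basis of the group algebra built from the left ideals\<close>

definition ideal_basis :: "'i \<Rightarrow> ('g \<Rightarrow> complex) set" where
  "ideal_basis i = (SOME B. finite B \<and> B \<subseteq> left_ideal (e i) \<and>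
     complex_vector.independent B \<and> complex_vector.span B = left_ideal (e i))"

lemma ideal_basis:
  assumes "i \<in> I"
  shows "finite (ideal_basis i)" "ideal_basis i \<subseteq> left_ideal (e i)"
    "complex_vector.independent (ideal_basis i)" "complex_vector.span (ideal_basis i) = left_ideal (e i)"
proof -
  have "\<exists>B. finite B \<and> B \<subseteq> left_ideal (e i) \<and>
     complex_vector.independent B \<and> complex_vector.span B = left_ideal (e i)"
    using basis_of_subspace[OF subspace_left_ideal[OF e_in[OF assms]] left_ideal_subset] by simp
  from someI_ex[OF this] show "finite (ideal_basis i)" "ideal_basis i \<subseteq> left_ideal (e i)"
    "complex_vector.independent (ideal_basis i)" "complex_vector.span (ideal_basis i) = left_ideal (e i)"
    unfolding ideal_basis_def by auto
qed

lemma ideal_basis_in: "i \<in> I \<Longrightarrow> u \<in> ideal_basis i \<Longrightarrow> u \<in> galg"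
  using ideal_basis(2) left_ideal_subset by blast

lemma sum_ideal_basis:
  assumes "i \<in> I"
  shows "(\<Sum>u\<in>ideal_basis i. c u *\<^sub>C u) \<in> left_ideal (e i)"
  using ideal_basis[OF assms] subspace_left_ideal[OF e_in[OF assms]]
  by (auto intro!: complex_vector.subspace_sum complex_vector.subspace_scale)

definition matrix_index :: "('i \<times> ('g \<Rightarrow> complex) \<times> ('g \<Rightarrow> complex)) set" where
  "matrix_index = (SIGMA i:I. ideal_basis i \<times> ideal_basis i)"

text \<open>\<open>flip v\<close> lies in the right ideal of \<open>e i\<close>, so
  \<open>u \<star> flip v\<close> maps the left ideal of \<open>e i\<close> into the line of
  \<open>u\<close>. These products take the place of the matrix units in the Wedderburn
  blocks.\<close>

definition matrix_unit :: "'i \<times> ('g \<Rightarrow> complex) \<times> ('g \<Rightarrow> complex) \<Rightarrow> 'g \<Rightarrow> complex" where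
  "matrix_unit = (\<lambda>(i, u, v). u \<star> flip v)"

lemma finite_matrix_index: "finite matrix_index"
  unfolding matrix_index_def using finite_index ideal_basis(1) by auto

lemma conv_flip_ideal:
  assumes "i \<in> I" "v \<in> left_ideal (e i)" "e i \<star> e i = c *\<^sub>C e i"
  shows "e i \<star> flip v = c *\<^sub>C flip v"
proof -
  obtain x where x: "v = x \<star> e i" using assms(2) by (auto simp: left_ideal_def)
  have "flip (e i) = e i" using primitive[OF assms(1)] by (simp add: primitive_def)
  then have "e i \<star> flip v = flip (v \<star> e i)" by (simp add: flip_conv)
  also have "v \<star> e i = c *\<^sub>C v" by (simp add: x conv_assoc assms(3) conv_scale_right)
  finally show ?thesis by (simp add: flip_scale)
qed

text \<open>A relation is grouped by the right factor \<open>v\<close>, with left coefficients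
  \<open>l i v\<close>. If some \<open>l j w\<close> were nonzero, multiplying by its
  \<open>star\<close> would kill the other blocks and leave a relation among the
  \<open>flip v\<close> alone; this contradicts the independence of the \<open>v\<close>, because
  the coefficient at \<open>w\<close> comes from \<open>star (l j w) \<star> l j w\<close>.\<close>

lemma lin_indep_matrix_unit: "lin_indep matrix_index matrix_unit"
  unfolding lin_indep_def
proof (intro allI impI)
  fix t assume "(\<Sum>k\<in>matrix_index. t k *\<^sub>C matrix_unit k) = 0"
  define l where "l i v = (\<Sum>u\<in>ideal_basis i. t (i, u, v) *\<^sub>C u)" for i v
  have l: "l i v \<in> left_ideal (e i)" if "i \<in> I" for i v
    unfolding l_def using that by (rule sum_ideal_basis)
  have "(\<Sum>k\<in>matrix_index. t k *\<^sub>C matrix_unit k)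
      = (\<Sum>i\<in>I. \<Sum>p\<in>ideal_basis i \<times> ideal_basis i. t (i, p) *\<^sub>C matrix_unit (i, p))"
    unfolding matrix_index_def using finite_index ideal_basis(1) by (subst sum.Sigma) auto
  also have "\<dots> = (\<Sum>i\<in>I. \<Sum>v\<in>ideal_basis i. \<Sum>u\<in>ideal_basis i. t (i, u, v) *\<^sub>C (u \<star> flip v))"
    unfolding sum.cartesian_product' matrix_unit_def prod.case
    by (rule sum.cong[OF refl], rule sum.swap)
  also have "\<dots> = (\<Sum>i\<in>I. \<Sum>v\<in>ideal_basis i. l i v \<star> flip v)"
    by (simp add: l_def conv_sum_left conv_scale_left)
  finally have zero: "(\<Sum>i\<in>I. \<Sum>v\<in>ideal_basis i. l i v \<star> flip v) = 0"
    using \<open>(\<Sum>k\<in>matrix_index. t k *\<^sub>C matrix_unit k) = 0\<close> by simp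
  have l0: "l j w = 0" if jw: "j \<in> I" "w \<in> ideal_basis j" for j w
  proof (rule ccontr)
    assume nz: "l j w \<noteq> 0"
    let ?s = "star (l j w)"
    \<comment> \<open>Both factors come from the left ideal of \<open>e j\<close>, so the product
      has the form \<open>e j x e j\<close>.\<close>
    have "\<exists>c. ?s \<star> l j v = c *\<^sub>C e j" for v
    proof -
      obtain x where x: "l j w = x \<star> e j"
        using l[OF jw(1), of w] by (auto simp: left_ideal_def)
      obtain x' where x': "l j v = x' \<star> e j"
        using l[OF jw(1), of v] by (auto simp: left_ideal_def)
      have "star (e j) = e j" using primitive[OF jw(1)] by (simp add: primitive_def)
      then have "?s \<star> l j v = e j \<star> (star x \<star> x') \<star> e j"
        by (simp add: x x' star_conv conv_assoc)
      then show ?thesis using primitive[OF jw(1)] by (simp add: primitive_def)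
    qed
    then obtain c where c: "\<And>v. ?s \<star> l j v = c v *\<^sub>C e j" by metis
    obtain d where d0: "d \<noteq> 0" "e j \<star> e j = d *\<^sub>C e j"
      using primitive_square[OF primitive[OF jw(1)]] by blast
    have d: "e j \<star> flip v = d *\<^sub>C flip v" if "v \<in> ideal_basis j" for v
      using conv_flip_ideal[OF jw(1) _ d0(2)] ideal_basis(2)[OF jw(1)] that by blast
    have "0 = ?s \<star> (\<Sum>i\<in>I. \<Sum>v\<in>ideal_basis i. l i v \<star> flip v)"
      by (simp add: zero)
    also have "\<dots> = (\<Sum>i\<in>I. \<Sum>v\<in>ideal_basis i. (?s \<star> l i v) \<star> flip v)"
      by (simp add: conv_sum_right conv_assoc)
    also have "\<dots> = (\<Sum>i\<in>I. if i = j then \<Sum>v\<in>ideal_basis j. (?s \<star> l j v) \<star> flip v else 0)"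
      using star_ideal_orthogonal[OF jw(1) _ _ l[OF jw(1)] l] by (intro sum.cong) auto
    also have "\<dots> = (\<Sum>v\<in>ideal_basis j. (?s \<star> l j v) \<star> flip v)"
      using jw(1) finite_index by simp
    also have "\<dots> = (\<Sum>v\<in>ideal_basis j. (c v * d) *\<^sub>C flip v)"
      by (intro sum.cong refl) (simp add: c d conv_scale_left)
    \<comment> \<open>Undoing \<open>flip\<close> turns the relation into one among basis vectors of
      the ideal.\<close>
    also have "\<dots> = flip (\<Sum>v\<in>ideal_basis j. (c v * d) *\<^sub>C v)"
      by (simp add: flip_sum flip_scale)
    finally have "flip (flip (\<Sum>v\<in>ideal_basis j. (c v * d) *\<^sub>C v)) = 0" by simp
    moreover have "(\<Sum>v\<in>ideal_basis j. (c v * d) *\<^sub>C v) \<in> galg"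
      by (rule subsetD[OF left_ideal_subset sum_ideal_basis[OF jw(1)]])
    ultimately have "(\<Sum>v\<in>ideal_basis j. (c v * d) *\<^sub>C v) = 0" by (simp add: flip_flip)
    then have "c w * d = 0"
      by (rule complex_vector.independentD[OF ideal_basis(3,1)[OF jw(1)] subset_refl _ jw(2)])
    then have "?s \<star> l j w = 0" using c[of w] d0(1) by simp
    then show False
      using star_conv_self_nonzero[of "l j w"] nz l[OF jw(1)] left_ideal_subset by blast
  qed
  show "\<forall>k\<in>matrix_index. t k = 0"
  proof
    fix k assume "k \<in> matrix_index"
    then obtain i u v where k: "k = (i, u, v)" "i \<in> I" "u \<in> ideal_basis i" "v \<in> ideal_basis i"
      by (auto simp: matrix_index_def)
    have "(\<Sum>u\<in>ideal_basis i. t (i, u, v) *\<^sub>C u) = 0" using l0[OF k(2,4)] by (simp add: l_def)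
    then have "t (i, u, v) = 0"
      by (rule complex_vector.independentD[OF ideal_basis(3,1)[OF k(2)] subset_refl _ k(3)])
    then show "t k = 0" by (simp add: k(1))
  qed
qed

lemma conv_ideals_in_span:
  assumes i: "i \<in> I" and a: "a \<in> left_ideal (e i)" and b: "b \<in> left_ideal (e i)"
  shows "a \<star> flip b \<in> complex_vector.span (matrix_unit ` matrix_index)"
proof -
  let ?B = "ideal_basis i"
  have ex: "\<exists>u. y = (\<Sum>x\<in>?B. u x *\<^sub>C x)" if "y \<in> left_ideal (e i)" for y
    using in_span_image[OF ideal_basis(1)[OF i], of y "\<lambda>x. x"] that ideal_basis(4)[OF i] by simp
  obtain u where u: "a = (\<Sum>x\<in>?B. u x *\<^sub>C x)" using ex[OF a] by (elim exE)
  obtain v where v: "b = (\<Sum>x\<in>?B. v x *\<^sub>C x)" using ex[OF b] by (elim exE)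
  have "a \<star> flip b = (\<Sum>x\<in>?B. u x *\<^sub>C (x \<star> flip b))"
    unfolding u conv_sum_left conv_scale_left ..
  also have "\<dots> = (\<Sum>x\<in>?B. u x *\<^sub>C (\<Sum>y\<in>?B. v y *\<^sub>C (x \<star> flip y)))"
    unfolding v flip_sum flip_scale conv_sum_right conv_scale_right ..
  also have "\<dots> \<in> complex_vector.span (matrix_unit ` matrix_index)"
  proof (intro complex_vector.span_sum complex_vector.span_scale complex_vector.span_base)
    fix x y assume "x \<in> ?B" "y \<in> ?B"
    then show "x \<star> flip y \<in> matrix_unit ` matrix_index"
      using i by (force simp: matrix_unit_def matrix_index_def image_iff)
  qed
  finally show ?thesis .
qed

text \<open>Expanding the unit writes \<open>delta g\<close> through terms
  \<open>g h e h\<inverse>\<close>. Since \<open>e\<close> is proportional to \<open>e e\<close>,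
  each term is a multiple of \<open>(g h e) \<star> flip (h e)\<close>, a product of the required
  shape.\<close>

lemma delta_in_span_matrix_unit:
  assumes g: "g \<in> carrier G"
  shows "delta g \<in> complex_vector.span (matrix_unit ` matrix_index)"
proof -
  obtain u where u: "delta \<one> = (\<Sum>i\<in>I. u i *\<^sub>C class_sum (e i))"
    using delta_one_expand by blast
  have "delta g = delta g \<star> delta \<one>" using g by (simp add: delta_mult)
  also have "\<dots> = (\<Sum>i\<in>I. u i *\<^sub>C (\<Sum>h\<in>carrier G. (delta g \<star> delta h \<star> e i) \<star> delta (inv h)))"
    unfolding u by (simp add: conv_sum_right conv_scale_right class_sum_def conv_assoc)
  also have "\<dots> \<in> complex_vector.span (matrix_unit ` matrix_index)"
  proof (intro complex_vector.span_sum complex_vector.span_scale)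
    fix i h assume i: "i \<in> I" and h: "h \<in> carrier G"
    obtain c where c: "c \<noteq> 0" "e i \<star> e i = c *\<^sub>C e i"
      using primitive_square[OF primitive[OF i]] by blast
    let ?a = "delta g \<star> delta h \<star> e i" and ?b = "delta h \<star> e i"
    have "flip ?b = e i \<star> delta (inv h)"
      using primitive[OF i] h by (simp add: flip_conv flip_delta primitive_def)
    then have "?a \<star> flip ?b = (delta g \<star> delta h) \<star> (e i \<star> e i) \<star> delta (inv h)"
      by (simp add: conv_assoc)
    also have "\<dots> = c *\<^sub>C (?a \<star> delta (inv h))"
      by (simp add: c conv_scale_left conv_scale_right)
    finally have "?a \<star> delta (inv h) = (1 / c) *\<^sub>C (?a \<star> flip ?b)" using c by simp
    moreover have "?a \<star> flip ?b \<in> complex_vector.span (matrix_unit ` matrix_index)"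
      using conv_left_ideal[OF primitive_in_left_ideal[OF primitive[OF i]]]
      by (intro conv_ideals_in_span[OF i]) auto
    ultimately show "?a \<star> delta (inv h) \<in> complex_vector.span (matrix_unit ` matrix_index)"
      by (simp add: complex_vector.span_scale)
  qed
  finally show ?thesis .
qed

text \<open>\<open>flip\<close> swaps the two factors of a matrix unit, so the fixed indices are the
  diagonal ones: one for each basis vector of each ideal.\<close>

lemma sum_ideal_dims: "(\<Sum>i\<in>I. card (ideal_basis i)) = card {g \<in> carrier G. inv g = g}"
proof -
  let ?T = "\<lambda>(i, u, v). (i, v, u) :: 'i \<times> ('g \<Rightarrow> complex) \<times> ('g \<Rightarrow> complex)"
  have "card {g \<in> carrier G. inv g = g} = card {k \<in> matrix_index. ?T k = k}"
  proof (rule card_involutions_eq_card_fixed[OF finite_matrix_index _ lin_indep_matrix_unit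
        delta_in_span_matrix_unit])
    fix k assume k: "k \<in> matrix_index"
    show "matrix_unit k \<in> galg" by (auto simp: matrix_unit_def split: prod.split)
    show "?T k \<in> matrix_index" using k by (auto simp: matrix_index_def)
    show "flip (matrix_unit k) = matrix_unit (?T k)"
      using k ideal_basis_in by (auto simp: matrix_index_def matrix_unit_def flip_conv flip_flip)
  qed
  also have "{k \<in> matrix_index. ?T k = k} = (\<lambda>(i, u). (i, u, u)) ` (SIGMA i:I. ideal_basis i)"
    by (auto simp: matrix_index_def image_iff)
  also have "card \<dots> = card (SIGMA i:I. ideal_basis i)"
    by (rule card_image) (auto simp: inj_on_def)
  also have "\<dots> = (\<Sum>i\<in>I. card (ideal_basis i))"
    using finite_index ideal_basis(1) by (intro card_SigmaI) auto
  finally show ?thesis by simp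
qed

text \<open>The vectors \<open>u r_i\<close>, with \<open>u\<close> in a basis of the
  \<open>i\<close>-th ideal, are independent by \<open>ideal_sum_zero\<close>, and by
  \<open>sum_ideal_dims\<close> there are at least \<open>card M\<close> of them. Hence they
  span.\<close>

lemma model_decomposition:
  fixes R :: "('g, 'm \<Rightarrow> complex) rep"
  assumes R: "group_representation G R" and M: "rep_space R = functions_on M" "finite M"
    and card: "card M \<le> card {g \<in> carrier G. inv g = g}"
    and r: "\<And>i. i \<in> I \<Longrightarrow> r i \<in> rep_space R" "\<And>i. i \<in> I \<Longrightarrow> alg_act R (e i) (r i) \<noteq> 0"
    and s: "s \<in> rep_space R"
  shows "\<exists>y. (\<forall>i\<in>I. y i \<in> left_ideal (e i)) \<and> s = (\<Sum>i\<in>I. alg_act R (y i) (r i))"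
proof -
  define K where "K = (SIGMA i:I. ideal_basis i)"
  define f where "f = (\<lambda>(i, u). alg_act R u (r i))"
  have K: "finite K" unfolding K_def using finite_index ideal_basis(1) by auto
  have sum_K: "(\<Sum>k\<in>K. c k *\<^sub>C f k) = (\<Sum>i\<in>I. alg_act R (\<Sum>u\<in>ideal_basis i. c (i, u) *\<^sub>C u) (r i))" for c
  proof -
    have "(\<Sum>k\<in>K. c k *\<^sub>C f k) = (\<Sum>i\<in>I. \<Sum>u\<in>ideal_basis i. c (i, u) *\<^sub>C f (i, u))"
      unfolding K_def using finite_index ideal_basis(1) by (subst sum.Sigma) auto
    then show ?thesis by (simp add: f_def alg_act_sum_left alg_act_scale_left)
  qed
  have indep: "lin_indep K f"
    unfolding lin_indep_def
  proof (intro allI impI ballI)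
    fix c k assume c: "(\<Sum>k\<in>K. c k *\<^sub>C f k) = 0" and "k \<in> K"
    then obtain i u where k: "k = (i, u)" "i \<in> I" "u \<in> ideal_basis i" by (auto simp: K_def)
    have "\<forall>i\<in>I. (\<Sum>u\<in>ideal_basis i. c (i, u) *\<^sub>C u) = 0"
      using c unfolding sum_K
      by (intro ideal_sum_zero[OF R finite_index _ r]) (auto intro: sum_ideal_basis)
    then have "(\<Sum>u\<in>ideal_basis i. c (i, u) *\<^sub>C u) = 0" using k by blast
    then have "c (i, u) = 0"
      by (rule complex_vector.independentD[OF ideal_basis(3,1)[OF k(2)] subset_refl _ k(3)])
    then show "c k = 0" by (simp add: k(1))
  qed
  have "card K = (\<Sum>i\<in>I. card (ideal_basis i))"
    unfolding K_def using finite_index ideal_basis(1) by (intro card_SigmaI) auto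
  then have "card (delta ` M) \<le> card K"
    using card card_image_le[OF M(2), of delta] sum_ideal_dims by simp
  moreover have "f ` K \<subseteq> complex_vector.span (delta ` M)"
    using alg_act_in[OF R r(1)] by (auto simp: span_delta[OF M(2)] M(1)[symmetric] K_def f_def)
  ultimately have "s \<in> complex_vector.span (f ` K)"
    using lin_indep_spans[OF K indep, of "delta ` M"] M s by (auto simp: span_delta)
  then obtain c where "s = (\<Sum>k\<in>K. c k *\<^sub>C f k)" using in_span_image[OF K] by blast
  then have "s = (\<Sum>i\<in>I. alg_act R (\<Sum>u\<in>ideal_basis i. c (i, u) *\<^sub>C u) (r i))"
    unfolding sum_K .
  then show ?thesis
    by (intro exI[of _ "\<lambda>i. \<Sum>u\<in>ideal_basis i. c (i, u) *\<^sub>C u"]) (auto intro: sum_ideal_basis)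
qed

end

section \<open>Young symmetrizers\<close>

locale sym_grp = fixes n :: nat

sublocale sym_grp \<subseteq> finite_group "sym_group n"
proof -
  interpret group "sym_group n" by (rule sym_group_is_group)
  show "finite_group (sym_group n)"
    by unfold_locales (simp add: sym_group_def finite_permutations)
qed

lemma (in sym_grp) inv_sym:
  assumes "g permutes {1..n}"
  shows "inv\<^bsub>sym_group n\<^esub> g = inv' g"
  using assms by (intro inv_equality) (auto simp: sym_group_def permutes_inv permutes_inv_o)

text \<open>With the following lemma this replaces the dominance order on partitions: a column of a
  tableau occupies an initial segment of rows, hence minimises the sum of row numbers among sets of
  its size.\<close>

lemma sum_nat_set_ge:
  fixes A :: "nat set"
  assumes "finite A"
  shows "\<Sum>{..<card A} \<le> \<Sum>A"
  using card_sum_le_nat_sum[of A] by (simp add: lessThan_atLeast0)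

text \<open>Otherwise some element \<open>a \<ge> card A\<close> could be exchanged for a missing
  \<open>b < card A\<close>, giving a set of the same size with a sum below the minimum.\<close>

lemma sum_nat_set_eq:
  fixes A :: "nat set"
  assumes A: "finite A" and eq: "\<Sum>A = \<Sum>{..<card A}"
  shows "A = {..<card A}"
proof (rule ccontr)
  assume ne: "A \<noteq> {..<card A}"
  have "\<not> A \<subseteq> {..<card A}" using ne A by (metis card_lessThan card_subset_eq finite_lessThan)
  then obtain a where a: "a \<in> A" "a \<ge> card A" by (meson lessThan_iff not_le subsetI)
  have "\<not> {..<card A} \<subseteq> A" using ne A by (metis card_lessThan card_subset_eq)
  then obtain b where b: "b < card A" "b \<notin> A" by auto
  let ?A = "insert b (A - {a})"
  have "card ?A = card A"
    using A a b by (simp add: card_gt_0_iff)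
  then have "\<Sum>{..<card A} \<le> \<Sum>?A" using sum_nat_set_ge[of ?A] A by simp
  moreover have "\<Sum>?A = b + \<Sum>(A - {a})" using A b by simp
  moreover have "\<Sum>A = a + \<Sum>(A - {a})" using A a by (simp add: sum.remove)
  ultimately show False using eq a b by linarith
qed

text \<open>A tableau is a bijection \<open>i \<mapsto> (r i, c i)\<close> from the entries to the cells
  (row, column) of a diagram \<open>D\<close>, both coordinates starting at 0.\<close>

definition tableau :: "nat \<Rightarrow> (nat \<times> nat) set \<Rightarrow> (nat \<Rightarrow> nat) \<Rightarrow> (nat \<Rightarrow> nat) \<Rightarrow> bool" where
  "tableau n D r c \<longleftrightarrow> bij_betw (\<lambda>i. (r i, c i)) {1..n} D \<and>
     (\<forall>x y x'. (x, y) \<in> D \<longrightarrow> x' < x \<longrightarrow> (x', y) \<in> D)"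

lemma tableau_column:
  assumes "tableau n D r c"
  shows "r ` {i \<in> {1..n}. c i = y} = {..<card {i \<in> {1..n}. c i = y}}"
    and "inj_on r {i \<in> {1..n}. c i = y}"
proof -
  let ?B = "{i \<in> {1..n}. c i = y}"
  have bij: "bij_betw (\<lambda>i. (r i, c i)) {1..n} D" using assms by (simp add: tableau_def)
  have inj0: "inj_on (\<lambda>i. (r i, c i)) {1..n}" and D: "D = (\<lambda>i. (r i, c i)) ` {1..n}"
    using bij by (simp_all add: bij_betw_def)
  show inj: "inj_on r ?B"
    by (rule inj_onI, rule inj_onD[OF inj0]) auto
  have im: "r ` ?B = {x. (x, y) \<in> D}"
    unfolding D by auto
  have down: "x' \<in> r ` ?B" if "x \<in> r ` ?B" "x' < x" for x x'
    using assms that unfolding im tableau_def by blast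
  have "finite (r ` ?B)" by simp
  have "\<exists>m. r ` ?B = {..<m}"
  proof (cases "r ` ?B = {}")
    case False
    have "r ` ?B = {..<Suc (Max (r ` ?B))}"
    proof
      show "r ` ?B \<subseteq> {..<Suc (Max (r ` ?B))}" using Max_ge[OF \<open>finite (r ` ?B)\<close>] by (auto simp: less_Suc_eq_le)
      have "x \<in> r ` ?B" if "x < Suc (Max (r ` ?B))" for x
        using that Max_in[OF \<open>finite (r ` ?B)\<close> False] down[of "Max (r ` ?B)" x]
        by (cases "x = Max (r ` ?B)") simp_all
      then show "{..<Suc (Max (r ` ?B))} \<subseteq> r ` ?B" by blast
    qed
    then show ?thesis by blast
  qed auto
  then obtain m where m: "r ` ?B = {..<m}" by blast
  have "card ?B = m" using card_image[OF inj] m by simp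
  then show "r ` ?B = {..<card ?B}" using m by simp
qed

lemma permutes_of_bij_betw:
  assumes "bij_betw f A A"
  shows "(\<lambda>i. if i \<in> A then f i else i) permutes A"
  using assms by (intro bij_imp_permutes) (auto cong: bij_betw_cong)

text \<open>\<open>c'' i\<close> plays the role of the column of \<open>g\<inverse> i\<close> in the second tableau.\<close>

lemma tableau_row_sum_le:
  assumes T: "tableau n D' r' c'"
    and count: "\<And>y. card {i \<in> {1..n}. c'' i = y} = card {i \<in> {1..n}. c' i = y}"
    and inj: "inj_on (\<lambda>i. (r i, c'' i)) {1..n}"
  shows "(\<Sum>i=1..n. r' i) \<le> (\<Sum>i=1..n. r i)"
    and "(\<Sum>i=1..n. r i) \<le> (\<Sum>i=1..n. r' i) \<Longrightarrow>
      \<exists>p. p permutes {1..n} \<and> (\<forall>i\<in>{1..n}. r' (p i) = r i \<and> c' (p i) = c'' i)"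
proof -
  let ?A = "\<lambda>y. {i \<in> {1..n}. c'' i = y}" and ?B = "\<lambda>y. {i \<in> {1..n}. c' i = y}"
  define Y where "Y = c' ` {1..n} \<union> c'' ` {1..n}"
  have Y: "finite Y" by (simp add: Y_def)
  have injA: "inj_on r (?A y)" for y
    by (rule inj_onI, rule inj_onD[OF inj]) auto
  have sumA: "(\<Sum>i\<in>?A y. r i) = \<Sum>(r ` ?A y)" for y
    using sum.reindex[OF injA, of "\<lambda>x. x" y] by (simp add: o_def)
  have sumB: "(\<Sum>i\<in>?B y. r' i) = \<Sum>{..<card (?A y)}" for y
    using sum.reindex[OF tableau_column(2)[OF T], of "\<lambda>x. x" y] tableau_column(1)[OF T, of y] count[of y]
    by (simp add: o_def)
  have cardA: "card (r ` ?A y) = card (?A y)" for y by (rule card_image[OF injA])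
  \<comment> \<open>On a fibre of \<open>c''\<close> the function \<open>r\<close> takes distinct
    values; on the equally large fibre of \<open>c'\<close> the function \<open>r'\<close> takes the
    smallest possible distinct values.\<close>
  have le: "(\<Sum>i\<in>?B y. r' i) \<le> (\<Sum>i\<in>?A y. r i)" for y
    unfolding sumA sumB using sum_nat_set_ge[of "r ` ?A y"] cardA by simp
  have A: "(\<Sum>i=1..n. r i) = (\<Sum>y\<in>Y. \<Sum>i\<in>?A y. r i)"
    by (rule sum.group[symmetric]) (auto simp: Y_def)
  have B: "(\<Sum>i=1..n. r' i) = (\<Sum>y\<in>Y. \<Sum>i\<in>?B y. r' i)"
    by (rule sum.group[symmetric]) (auto simp: Y_def)
  show 1: "(\<Sum>i=1..n. r' i) \<le> (\<Sum>i=1..n. r i)"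
    unfolding A B by (intro sum_mono le)
  assume "(\<Sum>i=1..n. r i) \<le> (\<Sum>i=1..n. r' i)"
  with 1 have eq: "(\<Sum>y\<in>Y. \<Sum>i\<in>?B y. r' i) = (\<Sum>y\<in>Y. \<Sum>i\<in>?A y. r i)"
    unfolding A B by simp
  \<comment> \<open>Equality of the total sums forces equality in each column, and a minimal sum
    forces an initial segment.\<close>
  have imA: "r ` ?A y = r' ` ?B y" if "y \<in> Y" for y
  proof -
    have "\<Sum>{..<card (?A y)} = \<Sum>(r ` ?A y)"
      using sum_mono_inv[OF eq le that Y] unfolding sumA sumB .
    then have "r ` ?A y = {..<card (?A y)}"
      using sum_nat_set_eq[of "r ` ?A y"] cardA[of y] by simp
    then show ?thesis using tableau_column(1)[OF T, of y] count[of y] by simp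
  qed
  let ?T = "\<lambda>i. (r' i, c' i)" and ?U = "\<lambda>i. (r i, c'' i)"
  have T': "bij_betw ?T {1..n} D'" using T by (simp add: tableau_def)
  have "?U ` {1..n} = ?T ` {1..n}"
  proof (intro equalityI subsetI)
    fix z assume "z \<in> ?U ` {1..n}"
    then obtain i where i: "i \<in> {1..n}" "z = ?U i" by blast
    then have "r i \<in> r' ` ?B (c'' i)" using imA[of "c'' i"] by (auto simp: Y_def)
    then show "z \<in> ?T ` {1..n}" using i by force
  next
    fix z assume "z \<in> ?T ` {1..n}"
    then obtain i where i: "i \<in> {1..n}" "z = ?T i" by blast
    then have "r' i \<in> r ` ?A (c' i)" using imA[of "c' i"] by (auto simp: Y_def)
    then show "z \<in> ?U ` {1..n}" using i by force
  qed
  then have U: "bij_betw ?U {1..n} D'" using inj T' by (simp add: bij_betw_def)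
  \<comment> \<open>\<open>f\<close> sends an entry to the entry of the second tableau in the same
    cell.\<close>
  define f where "f = inv_into {1..n} ?T \<circ> ?U"
  have f: "bij_betw f {1..n} {1..n}"
    unfolding f_def by (rule bij_betw_trans[OF U bij_betw_inv_into[OF T']])
  have Tf: "?T (f i) = ?U i" if "i \<in> {1..n}" for i
    using bij_betw_inv_into_right[OF T'] bij_betwE[OF U] that by (auto simp: f_def)
  show "\<exists>p. p permutes {1..n} \<and> (\<forall>i\<in>{1..n}. r' (p i) = r i \<and> c' (p i) = c'' i)"
    using permutes_of_bij_betw[OF f] Tf by (intro exI[of _ "\<lambda>i. if i \<in> {1..n} then f i else i"]) auto
qed

section \<open>Row sums, column sums and their products\<close>

context sym_grp
begin

notation conv (infixl \<open>\<star>\<close> 70)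

text \<open>The Young subgroup preserving the fibres of \<open>c\<close>: the row or the column
  stabilizer, depending on which coordinate function is inserted.\<close>

definition stab :: "(nat \<Rightarrow> nat) \<Rightarrow> (nat \<Rightarrow> nat) set" where
  "stab c = {g. g permutes {1..n} \<and> (\<forall>i. c (g i) = c i)}"

definition row_sum :: "(nat \<Rightarrow> nat) \<Rightarrow> (nat \<Rightarrow> nat) \<Rightarrow> complex" where
  "row_sum r = (\<lambda>g. if g \<in> stab r then 1 else 0)"

definition col_sum :: "(nat \<Rightarrow> nat) \<Rightarrow> (nat \<Rightarrow> nat) \<Rightarrow> complex" where
  "col_sum c = (\<lambda>g. if g \<in> stab c then of_int (sign g) else 0)"

definition young :: "(nat \<Rightarrow> nat) \<Rightarrow> (nat \<Rightarrow> nat) \<Rightarrow> (nat \<Rightarrow> nat) \<Rightarrow> complex" where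
  "young r c = row_sum r \<star> col_sum c \<star> row_sum r"

lemma stab_perm: "g \<in> stab c \<Longrightarrow> g permutes {1..n}"
  by (simp add: stab_def)

lemma stab_carrier: "g \<in> stab c \<Longrightarrow> g \<in> carrier (sym_group n)"
  by (simp add: stab_def sym_group_carrier)

lemma id_stab: "id \<in> stab c"
  by (simp add: stab_def permutes_id)

lemma stab_eq: "g \<in> stab c \<Longrightarrow> c (g i) = c i"
  by (simp add: stab_def)

lemma stabI:
  assumes "g permutes {1..n}" "\<And>i. i \<in> {1..n} \<Longrightarrow> c (g i) = c i"
  shows "g \<in> stab c"
  unfolding stab_def
proof (intro CollectI conjI allI)
  show "c (g i) = c i" for i
    using assms permutes_not_in[OF assms(1), of i] by (cases "i \<in> {1..n}") auto
qed (rule assms(1))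

lemma comp_stab: "g \<in> stab c \<Longrightarrow> h \<in> stab c \<Longrightarrow> g \<circ> h \<in> stab c"
  by (simp add: stab_def permutes_compose)

lemma inv_stab:
  assumes "g \<in> stab c"
  shows "inv' g \<in> stab c"
proof (rule stabI)
  show "inv' g permutes {1..n}" using stab_perm[OF assms] by (rule permutes_inv)
  show "c (inv' g i) = c i" for i
    using stab_eq[OF assms, of "inv' g i"] permutes_inverses(1)[OF stab_perm[OF assms]] by simp
qed

lemma inv_sym_stab: "g \<in> stab c \<Longrightarrow> inv\<^bsub>sym_group n\<^esub> g = inv' g"
  by (rule inv_sym[OF stab_perm])

lemma inv_stab_iff:
  assumes "g permutes {1..n}"
  shows "inv' g \<in> stab c \<longleftrightarrow> g \<in> stab c"
  using inv_stab[of g c] inv_stab[of "inv' g" c] permutes_inv_inv[OF assms] by auto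

lemma comp_stab_iff:
  assumes "p \<in> stab c" "g permutes {1..n}"
  shows "p \<circ> g \<in> stab c \<longleftrightarrow> g \<in> stab c" "g \<circ> p \<in> stab c \<longleftrightarrow> g \<in> stab c"
proof -
  have e: "inv' p \<circ> (p \<circ> g) = g"
    unfolding o_assoc permutes_inv_o(2)[OF stab_perm[OF assms(1)]] by simp
  have e': "(g \<circ> p) \<circ> inv' p = g"
    unfolding comp_assoc permutes_inv_o(1)[OF stab_perm[OF assms(1)]] by simp
  show "p \<circ> g \<in> stab c \<longleftrightarrow> g \<in> stab c"
    using comp_stab[OF assms(1), of g] comp_stab[OF inv_stab[OF assms(1)], of "p \<circ> g"] e by auto
  show "g \<circ> p \<in> stab c \<longleftrightarrow> g \<in> stab c"
    using comp_stab[OF _ assms(1), of g] comp_stab[OF _ inv_stab[OF assms(1)], of "g \<circ> p"] e' by auto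
qed

lemma finite_stab [simp]: "finite (stab c)"
  by (rule finite_subset[OF _ finite_permutations[of "{1..n}"]]) (auto simp: stab_def)

lemma card_stab_pos: "card (stab c) > 0"
  using id_stab[of c] by (auto simp: card_gt_0_iff)

lemma sign_mult: "g permutes {1..n} \<Longrightarrow> h permutes {1..n} \<Longrightarrow> sign (g \<circ> h) = sign g * sign h"
  by (rule sign_compose) (auto simp: permutation_permutes)

lemma sign_inverse': "g permutes {1..n} \<Longrightarrow> sign (inv' g) = sign g"
  by (rule sign_inverse) (auto simp: permutation_permutes)

lemma row_sum_in [simp]: "row_sum r \<in> galg"
  by (auto simp: functions_on_def row_sum_def stab_carrier)

lemma col_sum_in [simp]: "col_sum c \<in> galg"
  by (auto simp: functions_on_def col_sum_def stab_carrier)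

lemma young_in [simp]: "young r c \<in> galg"
  by (simp add: young_def)

lemma row_sum_delta: "row_sum r = (\<Sum>p\<in>stab r. delta p)"
  by (rule ext) (simp add: row_sum_def sum_fun_apply delta_def)

lemma col_sum_delta: "col_sum c = (\<Sum>q\<in>stab c. of_int (sign q) *\<^sub>C delta q)"
  by (rule ext) (simp add: col_sum_def fun_apply_simps delta_def if_distrib[of "\<lambda>t. _ * t"] cong: if_cong)

lemma delta_row_sum: "p \<in> stab r \<Longrightarrow> delta p \<star> row_sum r = row_sum r"
  by (rule galg_eqI) (simp_all add: delta_conv stab_carrier inv_sym_stab sym_group_mult,
      simp add: row_sum_def comp_stab_iff[OF inv_stab] sym_group_carrier)

lemma row_sum_delta_right: "p \<in> stab r \<Longrightarrow> row_sum r \<star> delta p = row_sum r"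
  by (rule galg_eqI) (simp_all add: conv_delta stab_carrier inv_sym_stab sym_group_mult,
      simp add: row_sum_def comp_stab_iff[OF inv_stab] sym_group_carrier)

lemma sign_mult_self: "of_int (sign q) * (of_int (sign q) :: complex) = 1"
  by (simp add: sign_def)

lemma delta_col_sum: "q \<in> stab c \<Longrightarrow> delta q \<star> col_sum c = of_int (sign q) *\<^sub>C col_sum c"
  by (rule galg_eqI) (simp_all add: delta_conv stab_carrier inv_sym_stab sym_group_mult
      complex_vector.subspace_scale[OF subspace_functions_on],
      simp add: fun_apply_simps col_sum_def comp_stab_iff[OF inv_stab] sym_group_carrier sign_mult
        permutes_inv stab_perm sign_inverse')

lemma flip_row_sum [simp]: "flip (row_sum r) = row_sum r"
  by (rule galg_eqI) (simp_all, simp add: flip_def row_sum_def sym_group_carrier inv_sym inv_stab_iff)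

lemma star_row_sum [simp]: "star (row_sum r) = row_sum r"
  by (rule galg_eqI) (simp_all, simp add: star_def row_sum_def sym_group_carrier inv_sym inv_stab_iff)

lemma flip_col_sum [simp]: "flip (col_sum c) = col_sum c"
  by (rule galg_eqI)
    (simp_all, simp add: flip_def col_sum_def sym_group_carrier inv_sym inv_stab_iff sign_inverse')

lemma star_col_sum [simp]: "star (col_sum c) = col_sum c"
  by (rule galg_eqI)
    (simp_all, simp add: star_def col_sum_def sym_group_carrier inv_sym inv_stab_iff sign_inverse')

lemma row_sum_square: "row_sum r \<star> row_sum r = of_nat (card (stab r)) *\<^sub>C row_sum r"
proof -
  have "row_sum r \<star> row_sum r = (\<Sum>p\<in>stab r. row_sum r)"
    by (subst (1) row_sum_delta) (simp add: conv_sum_left delta_row_sum)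
  then show ?thesis by (simp only: complex_vector.sum_constant_scale)
qed

lemma col_sum_square: "col_sum c \<star> col_sum c = of_nat (card (stab c)) *\<^sub>C col_sum c"
proof -
  have "col_sum c \<star> col_sum c = (\<Sum>q\<in>stab c. col_sum c)"
    by (subst (1) col_sum_delta) (simp add: conv_sum_left conv_scale_left delta_col_sum sign_mult_self)
  then show ?thesis by (simp only: complex_vector.sum_constant_scale)
qed

text \<open>The transposition \<open>t\<close> of \<open>i\<close> and \<open>j\<close> is absorbed
  by the row sum, and \<open>s = g\<inverse> t g\<close> by the column sum with sign -1. As
  \<open>t g = g s\<close>, the product equals its own negative.\<close>

lemma row_col_zero:
  assumes g: "g permutes {1..n}" and ij: "i \<in> {1..n}" "j \<in> {1..n}" "i \<noteq> j"
    and r: "r i = r j" and c: "c (inv' g i) = c (inv' g j)"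
  shows "row_sum r \<star> delta g \<star> col_sum c = 0"
proof -
  let ?t = "transpose i j"
  have t: "?t permutes {1..n}" using ij by (simp add: permutes_swap_id)
  define s where "s = inv' g \<circ> ?t \<circ> g"
  have s: "s permutes {1..n}" unfolding s_def using g t by (intro permutes_compose permutes_inv)
  have tr: "?t \<in> stab r" using r by (intro stabI t) (simp add: transpose_def)
  have "c (inv' g (?t k)) = c (inv' g k)" for k
    using c by (simp add: transpose_def)
  then have sc: "s \<in> stab c"
    using s permutes_inverses(2)[OF g] by (simp add: stab_def s_def)
  have "sign s = sign (inv' g) * sign ?t * sign g"
    unfolding s_def using g t by (simp add: sign_mult permutes_compose permutes_inv)
  then have sign: "sign s = -1"
    using ij by (simp add: sign_inverse'[OF g] sign_swap_id)
  have "?t \<circ> g = g \<circ> s"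
    unfolding s_def o_assoc permutes_inv_o(1)[OF g] by simp
  then have "delta ?t \<star> delta g = delta g \<star> delta s"
    using t g s by (simp add: delta_mult sym_group_carrier sym_group_mult)
  then have "row_sum r \<star> delta g \<star> col_sum c = row_sum r \<star> delta g \<star> (delta s \<star> col_sum c)"
    using row_sum_delta_right[OF tr] by (metis conv_assoc)
  also have "\<dots> = (-1) *\<^sub>C (row_sum r \<star> delta g \<star> col_sum c)"
    by (simp only: delta_col_sum[OF sc] sign conv_scale_right of_int_minus of_int_1)
  finally have "(row_sum r \<star> delta g \<star> col_sum c) x
      = ((-1) *\<^sub>C (row_sum r \<star> delta g \<star> col_sum c)) x" for x
    by (rule fun_cong)
  then show ?thesis by (intro ext) (simp add: fun_apply_simps)
qed

text \<open>By \<open>row_col_zero\<close>, nonvanishing means that no two entries share both their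
  row under \<open>r\<close> and their column under \<open>c' \<circ> inv' g\<close>. This is the
  injectivity asked for by \<open>tableau_row_sum_le\<close>.\<close>

lemma row_delta_col_nonzero:
  assumes T: "tableau n D' r' c'" and g: "g permutes {1..n}"
    and nz: "row_sum r \<star> delta g \<star> col_sum c' \<noteq> 0"
  shows "(\<Sum>i=1..n. r' i) \<le> (\<Sum>i=1..n. r i)"
    and "(\<Sum>i=1..n. r i) \<le> (\<Sum>i=1..n. r' i) \<Longrightarrow>
      \<exists>p. p permutes {1..n} \<and> (\<forall>i\<in>{1..n}. r' (p i) = r i \<and> c' (p i) = c' (inv' g i))"
proof -
  have count: "card {i \<in> {1..n}. c' (inv' g i) = y} = card {i \<in> {1..n}. c' i = y}" for y
  proof (rule bij_betw_same_card[of "inv' g"])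
    show "bij_betw (inv' g) {i \<in> {1..n}. c' (inv' g i) = y} {i \<in> {1..n}. c' i = y}"
    proof (rule bij_betw_byWitness[where f' = g])
      show "g ` {i \<in> {1..n}. c' i = y} \<subseteq> {i \<in> {1..n}. c' (inv' g i) = y}"
        using permutes_in_image[OF g] permutes_inverses(2)[OF g] by auto
      show "inv' g ` {i \<in> {1..n}. c' (inv' g i) = y} \<subseteq> {i \<in> {1..n}. c' i = y}"
        using permutes_in_image[OF permutes_inv[OF g]] by auto
    qed (simp_all add: permutes_inverses[OF g])
  qed
  have inj: "inj_on (\<lambda>i. (r i, c' (inv' g i))) {1..n}"
  proof (rule inj_onI, rule ccontr)
    fix i j
    assume ij: "i \<in> {1..n}" "j \<in> {1..n}" "(r i, c' (inv' g i)) = (r j, c' (inv' g j))" "i \<noteq> j"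
    then show False using row_col_zero[OF g ij(1,2,4)] nz by simp
  qed
  show "(\<Sum>i=1..n. r' i) \<le> (\<Sum>i=1..n. r i)"
    by (rule tableau_row_sum_le(1)[OF T count inj])
  show "\<exists>p. p permutes {1..n} \<and> (\<forall>i\<in>{1..n}. r' (p i) = r i \<and> c' (p i) = c' (inv' g i))"
    if "(\<Sum>i=1..n. r i) \<le> (\<Sum>i=1..n. r' i)"
    by (rule tableau_row_sum_le(2)[OF T count inj that])
qed

text \<open>In the nonzero case both tableaux are the same, so the row sums agree and a permutation
  \<open>p\<close> matches the cells. Then \<open>p\<close> is a row and \<open>p \<circ> g\<close>
  a column permutation, and absorbing both leaves only a sign.\<close>

lemma row_delta_col:
  assumes T: "tableau n D r c" and g: "g permutes {1..n}"
  shows "\<exists>k. row_sum r \<star> delta g \<star> col_sum c = k *\<^sub>C (row_sum r \<star> col_sum c)"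
proof (cases "row_sum r \<star> delta g \<star> col_sum c = 0")
  case True
  then show ?thesis by (intro exI[of _ 0]) simp
next
  case False
  then obtain p where p: "p permutes {1..n}" "\<forall>i\<in>{1..n}. r (p i) = r i \<and> c (p i) = c (inv' g i)"
    using row_delta_col_nonzero(2)[OF T g] by blast
  have pr: "p \<in> stab r" using p by (intro stabI) auto
  have pc: "p \<circ> g \<in> stab c"
  proof (rule stabI)
    show "p \<circ> g permutes {1..n}" using g p(1) by (rule permutes_compose)
    fix i assume "i \<in> {1..n}"
    then have "g i \<in> {1..n}" using permutes_in_image[OF g] by blast
    then show "c ((p \<circ> g) i) = c i" using p permutes_inverses(2)[OF g] by simp
  qed
  have "row_sum r \<star> delta g \<star> col_sum c = row_sum r \<star> (delta p \<star> delta g) \<star> col_sum c"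
    by (simp add: row_sum_delta_right[OF pr] flip: conv_assoc)
  also have "delta p \<star> delta g = delta (p \<circ> g)"
    using p g by (simp add: delta_mult sym_group_carrier sym_group_mult)
  finally show ?thesis
    by (auto simp: conv_assoc delta_col_sum[OF pc] conv_scale_right)
qed

lemma row_conv_col:
  assumes T: "tableau n D r c" and x: "x \<in> galg"
  shows "\<exists>k. row_sum r \<star> x \<star> col_sum c = k *\<^sub>C (row_sum r \<star> col_sum c)"
proof -
  obtain k where k: "\<And>g. g \<in> carrier (sym_group n) \<Longrightarrow>
      row_sum r \<star> delta g \<star> col_sum c = k g *\<^sub>C (row_sum r \<star> col_sum c)"
    using row_delta_col[OF T] by (metis sym_group_carrier)
  have "row_sum r \<star> x \<star> col_sum c
      = (\<Sum>g\<in>carrier (sym_group n). x g *\<^sub>C (row_sum r \<star> delta g \<star> col_sum c))"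
    by (subst galg_expand[OF x]) (simp add: conv_sum_left conv_sum_right conv_scale_left conv_scale_right)
  also have "\<dots> = (\<Sum>g\<in>carrier (sym_group n). x g * k g) *\<^sub>C (row_sum r \<star> col_sum c)"
    by (simp add: k complex_vector.scale_sum_left)
  finally show ?thesis by blast
qed

lemma row_conv_col_nonzero:
  assumes T: "tableau n D' r' c'" and x: "x \<in> galg"
    and nz: "row_sum r \<star> x \<star> col_sum c' \<noteq> 0"
  shows "\<exists>g. g permutes {1..n} \<and> row_sum r \<star> delta g \<star> col_sum c' \<noteq> 0"
proof (rule ccontr)
  assume "\<not> ?thesis"
  then have 0: "row_sum r \<star> delta g \<star> col_sum c' = 0" if "g \<in> carrier (sym_group n)" for g
    using that by (auto simp: sym_group_carrier)
  have "row_sum r \<star> x \<star> col_sum c'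
      = (\<Sum>g\<in>carrier (sym_group n). x g *\<^sub>C (row_sum r \<star> delta g \<star> col_sum c'))"
    by (subst galg_expand[OF x]) (simp add: conv_sum_left conv_sum_right conv_scale_left conv_scale_right)
  also have "\<dots> = 0" using 0 by (intro sum.neutral) auto
  finally show False using nz by simp
qed

text \<open>A nonzero product contains nonzero factors of both shapes \<open>a x b'\<close> and
  \<open>b x a'\<close>. Each gives an inequality between the two sums of row numbers, in opposite
  directions; equality then provides the matching permutation.\<close>

lemma young_orthogonal:
  assumes T: "tableau n D r c" and T': "tableau n D' r' c'" and x: "x \<in> galg"
    and nz: "young r c \<star> x \<star> young r' c' \<noteq> 0"
  shows "\<exists>p. p permutes {1..n} \<and> (\<forall>i\<in>{1..n}. r' (p i) = r i)"
proof -
  let ?a = "row_sum r" and ?b = "col_sum c" and ?a' = "row_sum r'" and ?b' = "col_sum c'"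
  have "young r c \<star> x \<star> young r' c' = ?a \<star> (?b \<star> ?a \<star> x \<star> ?a') \<star> ?b' \<star> ?a'"
    by (simp add: young_def conv_assoc)
  then have 1: "?a \<star> (?b \<star> ?a \<star> x \<star> ?a') \<star> ?b' \<noteq> 0" using nz by auto
  have "?b \<star> (?a \<star> x) \<star> ?a' \<noteq> 0"
  proof
    assume "?b \<star> (?a \<star> x) \<star> ?a' = 0"
    moreover have "?a \<star> (?b \<star> ?a \<star> x \<star> ?a') \<star> ?b' = ?a \<star> (?b \<star> (?a \<star> x) \<star> ?a') \<star> ?b'"
      by (simp add: conv_assoc)
    ultimately show False using 1 by simp
  qed
  \<comment> \<open>\<open>flip\<close> reverses the order of the factors and fixes row and column
    sums, so \<open>b x a'\<close> takes the shape \<open>a' x b\<close> to which the criterion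
    applies.\<close>
  then have "flip (flip (?b \<star> (?a \<star> x) \<star> ?a')) \<noteq> 0"
    by (subst flip_flip) auto
  then have "flip (?b \<star> (?a \<star> x) \<star> ?a') \<noteq> 0" by auto
  then have 2: "?a' \<star> flip (?a \<star> x) \<star> ?b \<noteq> 0" by (simp add: flip_conv conv_assoc)
  obtain h where h: "h permutes {1..n}" "?a' \<star> delta h \<star> ?b \<noteq> 0"
    using row_conv_col_nonzero[OF T _ 2] by auto
  have le: "(\<Sum>i=1..n. r i) \<le> (\<Sum>i=1..n. r' i)"
    by (rule row_delta_col_nonzero(1)[OF T h])
  obtain g where g: "g permutes {1..n}" "?a \<star> delta g \<star> ?b' \<noteq> 0"
    using row_conv_col_nonzero[OF T' _ 1] by auto
  show ?thesis using row_delta_col_nonzero(2)[OF T' g le] by blast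
qed

lemma stab_row_col:
  assumes "tableau n D r c" "g \<in> stab r" "g \<in> stab c"
  shows "g = id"
proof
  fix i
  show "g i = id i"
  proof (cases "i \<in> {1..n}")
    case True
    have "inj_on (\<lambda>i. (r i, c i)) {1..n}" using assms(1) by (auto simp: tableau_def bij_betw_def)
    moreover have "g i \<in> {1..n}" using permutes_in_image[OF stab_perm[OF assms(2)]] True by blast
    ultimately show ?thesis
      using inj_onD[of "\<lambda>i. (r i, c i)" "{1..n}" "g i" i] stab_eq[OF assms(2)] stab_eq[OF assms(3)] True
      by simp
  next
    case False
    then show ?thesis using permutes_not_in[OF stab_perm[OF assms(2)]] by simp
  qed
qed

text \<open>The coefficient at the identity is 1, because only the identity preserves both rows and
  columns.\<close>

lemma row_col_nonzero:
  assumes "tableau n D r c"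
  shows "row_sum r \<star> col_sum c \<noteq> 0"
proof
  assume z: "row_sum r \<star> col_sum c = 0"
  have "(row_sum r \<star> col_sum c) id = (\<Sum>g\<in>carrier (sym_group n). row_sum r g * col_sum c (inv' g))"
    unfolding conv_def by (auto simp: sym_group_carrier sym_group_mult inv_sym permutes_id intro!: sum.cong)
  also have "\<dots> = (\<Sum>g\<in>carrier (sym_group n). if g = id then 1 else 0)"
  proof (intro sum.cong refl)
    fix g assume g: "g \<in> carrier (sym_group n)"
    show "row_sum r g * col_sum c (inv' g) = (if g = id then 1 else 0)"
      using stab_row_col[OF assms, of g] g id_stab
      by (auto simp: row_sum_def col_sum_def inv_stab_iff sym_group_carrier)
  qed
  also have "\<dots> = 1" by (simp add: sym_group_carrier permutes_id)
  finally show False using z by simp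
qed

text \<open>Symmetry comes from the palindromic form \<open>a b a\<close>. Up to the factor
  \<open>card (stab c)\<close> the element is \<open>star (b a) \<star> (b a)\<close>, hence nonzero
  by positivity. Compression to a line follows from \<open>row_conv_col\<close>, applied to
  \<open>a (b a x a) b\<close>.\<close>

lemma young_primitive:
  assumes T: "tableau n D r c"
  shows "primitive (young r c)"
  unfolding primitive_def
proof (intro conjI ballI)
  let ?a = "row_sum r" and ?b = "col_sum c"
  show "young r c \<in> galg" by simp
  show "star (young r c) = young r c" "flip (young r c) = young r c"
    by (simp_all add: young_def star_conv flip_conv conv_assoc)
  have "star (?b \<star> ?a) = ?a \<star> ?b" by (simp add: star_conv)
  then have "?b \<star> ?a \<noteq> 0" using row_col_nonzero[OF T] by auto
  then have "star (?b \<star> ?a) \<star> (?b \<star> ?a) \<noteq> 0" by (intro star_conv_self_nonzero) auto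
  moreover have "star (?b \<star> ?a) \<star> (?b \<star> ?a) = ?a \<star> (?b \<star> ?b) \<star> ?a"
    by (simp add: star_conv conv_assoc)
  ultimately show "young r c \<noteq> 0"
    by (auto simp: young_def col_sum_square conv_scale_left conv_scale_right)
  fix x
  obtain k where k: "?a \<star> (?b \<star> ?a \<star> x \<star> ?a) \<star> ?b = k *\<^sub>C (?a \<star> ?b)"
    using row_conv_col[OF T] by (metis conv_in)
  have "young r c \<star> x \<star> young r c = ?a \<star> (?b \<star> ?a \<star> x \<star> ?a) \<star> ?b \<star> ?a"
    by (simp add: young_def conv_assoc)
  then show "\<exists>k. young r c \<star> x \<star> young r c = k *\<^sub>C young r c"
    unfolding k by (auto simp: young_def conv_scale_left)
qed

text \<open>The witness is \<open>b v\<close>: one has \<open>a b a b = k (a b)\<close>, and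
  \<open>k = 0\<close> would annihilate the square of \<open>a b a\<close>. Later tests may
  therefore use the shorter product \<open>a b\<close>.\<close>

lemma young_acts_nonzero:
  assumes T: "tableau n D r c" and R: "group_representation (sym_group n) R"
    and v: "v \<in> rep_space R" and nz: "alg_act R (row_sum r \<star> col_sum c) v \<noteq> 0"
  shows "\<exists>w\<in>rep_space R. alg_act R (young r c) w \<noteq> 0"
proof
  let ?a = "row_sum r" and ?b = "col_sum c"
  show w: "alg_act R ?b v \<in> rep_space R" by (rule alg_act_in[OF R v])
  obtain k where k: "?a \<star> (?b \<star> ?a) \<star> ?b = k *\<^sub>C (?a \<star> ?b)"
    using row_conv_col[OF T, of "?b \<star> ?a"] by auto
  obtain l where l: "l \<noteq> 0" "young r c \<star> young r c = l *\<^sub>C young r c"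
    using primitive_square[OF young_primitive[OF T]] by blast
  have "k \<noteq> 0"
  proof
    assume "k = 0"
    have "young r c \<star> young r c = ?a \<star> ?b \<star> (?a \<star> ?a) \<star> ?b \<star> ?a"
      by (simp add: young_def conv_assoc)
    also have "\<dots> = of_nat (card (stab r)) *\<^sub>C (?a \<star> (?b \<star> ?a) \<star> ?b \<star> ?a)"
      unfolding row_sum_square by (simp add: conv_scale_left conv_scale_right conv_assoc)
    also have "\<dots> = 0" using k \<open>k = 0\<close> by simp
    finally show False using l young_primitive[OF T] by (auto simp: primitive_def)
  qed
  have "alg_act R (young r c) (alg_act R ?b v) = alg_act R (young r c \<star> ?b) v"
    by (simp add: alg_act_conv[OF R v])
  also have "young r c \<star> ?b = k *\<^sub>C (?a \<star> ?b)"
    unfolding k[symmetric] by (simp add: young_def conv_assoc)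
  finally show "alg_act R (young r c) (alg_act R ?b v) \<noteq> 0"
    using \<open>k \<noteq> 0\<close> nz by (simp add: alg_act_scale_left)
qed

text \<open>By irreducibility some \<open>x\<close> carries \<open>b t\<close> to \<open>s\<close>.
  Then \<open>a s = a x b t\<close> is nonzero and a multiple of \<open>a b t\<close>.\<close>

lemma irreducible_young_nonzero:
  assumes T: "tableau n D r c" and S: "irreducible_rep (sym_group n) S"
    and s: "s \<in> rep_space S" "alg_act S (row_sum r) s \<noteq> 0"
    and t: "t \<in> rep_space S" "alg_act S (col_sum c) t \<noteq> 0"
  shows "\<exists>w\<in>rep_space S. alg_act S (young r c) w \<noteq> 0"
proof -
  have R: "group_representation (sym_group n) S" using S by (simp add: irreducible_rep_def)
  obtain x where x: "x \<in> galg" "s = alg_act S x (alg_act S (col_sum c) t)"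
    using irreducible_generated[OF S alg_act_in[OF R t(1)] t(2) s(1)] by blast
  obtain k where "row_sum r \<star> x \<star> col_sum c = k *\<^sub>C (row_sum r \<star> col_sum c)"
    using row_conv_col[OF T x(1)] by blast
  then have "alg_act S (row_sum r) s = k *\<^sub>C alg_act S (row_sum r \<star> col_sum c) t"
    by (simp add: x(2) conv_assoc alg_act_scale_left flip: alg_act_conv[OF R t(1)])
  then show ?thesis using young_acts_nonzero[OF T R t(1)] s(2) by auto
qed

end

section \<open>Partitions and their tableaux\<close>

definition diagram :: "nat list \<Rightarrow> (nat \<times> nat) set" where
  "diagram lam = {(x, y). x < length lam \<and> y < lam ! x}"

lemma diagram_Sigma: "diagram lam = (SIGMA x:{..<length lam}. {..<lam ! x})"
  by (auto simp: diagram_def)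

lemma finite_diagram: "finite (diagram lam)"
  unfolding diagram_Sigma by auto

lemma card_diagram: "card (diagram lam) = sum_list lam"
  unfolding diagram_Sigma by (simp add: sum_list_sum_nth lessThan_atLeast0)

lemma diagram_column_closed:
  assumes "lam \<in> partitions n" "(x, y) \<in> diagram lam" "x' < x"
  shows "(x', y) \<in> diagram lam"
proof -
  have "sorted_wrt (\<ge>) lam" "x < length lam" "y < lam ! x"
    using assms by (auto simp: partitions_def diagram_def)
  then have "lam ! x \<le> lam ! x'" using assms(3) by (auto simp: sorted_wrt_iff_nth_less)
  then show ?thesis using assms(3) \<open>x < length lam\<close> \<open>y < lam ! x\<close> by (simp add: diagram_def)
qed

text \<open>Smaller entries in earlier rows make row permutations preserve the order inside each
  pair of \<open>pairing\<close>; this is what gives the vanishing exponent in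
  \<open>i1_row_stab\<close>.\<close>

definition reading_tableau :: "nat \<Rightarrow> nat list \<Rightarrow> (nat \<Rightarrow> nat) \<Rightarrow> (nat \<Rightarrow> nat) \<Rightarrow> bool" where
  "reading_tableau n lam r c \<longleftrightarrow> tableau n (diagram lam) r c \<and>
     (\<forall>i\<in>{1..n}. \<forall>j\<in>{1..n}. r i < r j \<longrightarrow> i < j)"

lemma ex_reading_tableau:
  assumes lam: "lam \<in> partitions n"
  shows "\<exists>r c. reading_tableau n lam r c"
proof -
  obtain xs0 where xs0: "set xs0 = diagram lam" "distinct xs0"
    using finite_distinct_list[OF finite_diagram] by blast
  \<comment> \<open>Entry \<open>i\<close> is placed in the cell at position \<open>i - 1\<close> of
    a list of all cells ordered by row.\<close>
  define xs where "xs = sort_key fst xs0"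
  have xs: "set xs = diagram lam" "distinct xs" "sorted (map fst xs)"
    using xs0 by (auto simp: xs_def)
  have len: "length xs = n"
    using xs distinct_card[of xs] card_diagram[of lam] lam by (simp add: partitions_def)
  have "bij_betw (\<lambda>i. i - 1) {1..n} {..<n}"
    by (rule bij_betw_byWitness[where f' = Suc]) auto
  moreover have "bij_betw ((!) xs) {..<n} (diagram lam)"
    using xs len by (intro bij_betw_nth) auto
  ultimately have bij: "bij_betw (\<lambda>i. xs ! (i - 1)) {1..n} (diagram lam)"
    using bij_betw_trans[of "\<lambda>i. i - 1" "{1..n}" "{..<n}" "(!) xs" "diagram lam"] by (simp add: o_def)
  let ?r = "\<lambda>i. fst (xs ! (i - 1))" and ?c = "\<lambda>i. snd (xs ! (i - 1))"
  have "tableau n (diagram lam) ?r ?c"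
    using bij diagram_column_closed[OF lam] by (auto simp: tableau_def)
  moreover have "i < j" if ij: "i \<in> {1..n}" "j \<in> {1..n}" "?r i < ?r j" for i j
  proof (rule ccontr)
    assume "\<not> i < j"
    moreover have "i - 1 < n" "j - 1 < n" using ij(1,2) unfolding atLeastAtMost_iff by arith+
    ultimately have "?r j \<le> ?r i"
      using sorted_nth_mono[OF xs(3), of "j - 1" "i - 1"] len by simp
    then show False using ij(3) by simp
  qed
  ultimately show ?thesis unfolding reading_tableau_def by blast
qed

definition row_of :: "nat \<Rightarrow> nat list \<Rightarrow> nat \<Rightarrow> nat" where
  "row_of n lam = (SOME r. \<exists>c. reading_tableau n lam r c)"

definition col_of :: "nat \<Rightarrow> nat list \<Rightarrow> nat \<Rightarrow> nat" where
  "col_of n lam = (SOME c. reading_tableau n lam (row_of n lam) c)"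

lemma reading_tableau:
  assumes "lam \<in> partitions n"
  shows "reading_tableau n lam (row_of n lam) (col_of n lam)"
proof -
  have "\<exists>c. reading_tableau n lam (row_of n lam) c"
    unfolding row_of_def using ex_reading_tableau[OF assms] by (rule someI_ex)
  then show ?thesis unfolding col_of_def by (rule someI_ex)
qed

lemma tableau_row_col_of: "lam \<in> partitions n \<Longrightarrow> tableau n (diagram lam) (row_of n lam) (col_of n lam)"
  using reading_tableau by (simp add: reading_tableau_def)

lemma tableau_cell:
  assumes "tableau n D r c" "i \<in> {1..n}"
  shows "(r i, c i) \<in> D"
  using assms bij_betwE[of "\<lambda>i. (r i, c i)" "{1..n}" D] by (auto simp: tableau_def)

lemma tableau_cellE:
  assumes "tableau n D r c" "(x, y) \<in> D"
  obtains i where "i \<in> {1..n}" "r i = x" "c i = y"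
proof -
  have "(x, y) \<in> (\<lambda>i. (r i, c i)) ` {1..n}" using assms by (simp add: tableau_def bij_betw_def)
  then show ?thesis using that by auto
qed

lemma tableau_inj:
  assumes "tableau n D r c" "i \<in> {1..n}" "j \<in> {1..n}" "r i = r j" "c i = c j"
  shows "i = j"
  using assms inj_onD[of "\<lambda>i. (r i, c i)" "{1..n}" i j] by (simp add: tableau_def bij_betw_def)

lemma tableau_row_card:
  assumes "tableau n D r c"
  shows "card {i \<in> {1..n}. r i = x} = card {y. (x, y) \<in> D}"
proof (rule bij_betw_same_card[of c])
  show "bij_betw c {i \<in> {1..n}. r i = x} {y. (x, y) \<in> D}"
    unfolding bij_betw_def
  proof
    show "inj_on c {i \<in> {1..n}. r i = x}"
      by (rule inj_onI, rule tableau_inj[OF assms]) auto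
    show "c ` {i \<in> {1..n}. r i = x} = {y. (x, y) \<in> D}"
      using tableau_cell[OF assms] by (auto elim!: tableau_cellE[OF assms])
  qed
qed

lemma tableau_col_card:
  assumes "tableau n D r c"
  shows "card {i \<in> {1..n}. c i = y} = card {x. (x, y) \<in> D}"
proof (rule bij_betw_same_card[of r])
  show "bij_betw r {i \<in> {1..n}. c i = y} {x. (x, y) \<in> D}"
    unfolding bij_betw_def
  proof
    show "inj_on r {i \<in> {1..n}. c i = y}"
      by (rule inj_onI, rule tableau_inj[OF assms]) auto
    show "r ` {i \<in> {1..n}. c i = y} = {x. (x, y) \<in> D}"
      using tableau_cell[OF assms] by (auto elim!: tableau_cellE[OF assms])
  qed
qed

lemma partition_row_card:
  assumes "tableau n (diagram lam) r c"
  shows "card {i \<in> {1..n}. r i = x} = (if x < length lam then lam ! x else 0)"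
  unfolding tableau_row_card[OF assms] by (simp add: diagram_def)

lemma partition_eqI:
  assumes lam: "lam \<in> partitions n" "mu \<in> partitions n"
    and eq: "\<And>x. (if x < length lam then lam ! x else 0) = (if x < length mu then mu ! x else 0)"
  shows "lam = mu"
proof -
  have pos: "lam ! x > 0" if "x < length lam" for x
    using lam(1) nth_mem[OF that] by (auto simp: partitions_def intro: ccontr)
  have pos': "mu ! x > 0" if "x < length mu" for x
    using lam(2) nth_mem[OF that] by (auto simp: partitions_def intro: ccontr)
  have "x < length lam \<longleftrightarrow> x < length mu" for x
    using eq[of x] pos[of x] pos'[of x] by (auto split: if_splits)
  then have len: "length lam = length mu" by (metis linorder_neqE_nat less_irrefl)
  show ?thesis
    using len eq by (intro nth_equalityI) (auto split: if_splits, metis)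
qed

text \<open>A permutation matching the row numbers maps each row onto the row with the same number,
  so all row lengths agree.\<close>

lemma tableaux_same_rows:
  assumes lam: "lam \<in> partitions n" "mu \<in> partitions n"
    and T: "tableau n (diagram lam) r c" "tableau n (diagram mu) r' c'"
    and p: "p permutes {1..n}" "\<And>i. i \<in> {1..n} \<Longrightarrow> r' (p i) = r i"
  shows "lam = mu"
proof (rule partition_eqI[OF lam])
  fix x
  have "bij_betw p {i \<in> {1..n}. r i = x} {i \<in> {1..n}. r' i = x}"
  proof (rule bij_betw_byWitness[where f' = "inv' p"])
    show "p ` {i \<in> {1..n}. r i = x} \<subseteq> {i \<in> {1..n}. r' i = x}"
      using p permutes_in_image[OF p(1)] by auto
    show "inv' p ` {i \<in> {1..n}. r' i = x} \<subseteq> {i \<in> {1..n}. r i = x}"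
    proof (rule image_subsetI)
      fix i assume i: "i \<in> {i \<in> {1..n}. r' i = x}"
      then have "inv' p i \<in> {1..n}"
        using permutes_in_image[OF permutes_inv[OF p(1)]] by blast
      then show "inv' p i \<in> {i \<in> {1..n}. r i = x}"
        using p(2)[of "inv' p i"] permutes_inverses(1)[OF p(1), of i] i by simp
    qed
  qed (simp_all add: permutes_inverses[OF p(1)])
  then have "card {i \<in> {1..n}. r i = x} = card {i \<in> {1..n}. r' i = x}"
    by (rule bij_betw_same_card)
  then show "(if x < length lam then lam ! x else 0) = (if x < length mu then mu ! x else 0)"
    using partition_row_card[OF T(1), of x] partition_row_card[OF T(2), of x] by simp
qed

lemma finite_partitions: "finite (partitions n)"
proof (rule finite_subset)
  show "partitions n \<subseteq> {xs. set xs \<subseteq> {..n} \<and> length xs \<le> n}"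
  proof
    fix lam assume lam: "lam \<in> partitions n"
    have "length lam \<le> sum_list lam" if "0 \<notin> set lam" for lam :: "nat list"
      using that by (induction lam) auto
    moreover have "x \<le> sum_list lam" if "x \<in> set lam" for x
      using that by (simp add: member_le_sum_list)
    ultimately show "lam \<in> {xs. set xs \<subseteq> {..n} \<and> length xs \<le> n}"
      using lam by (auto simp: partitions_def)
  qed
  show "finite {xs :: nat list. set xs \<subseteq> {..n} \<and> length xs \<le> n}"
    by (rule finite_lists_length_le) simp
qed

lemma length_conjugate: "length (conjugate lam) = Max (insert 0 (set lam))"
  by (simp add: conjugate_def One_nat_def)

lemma conjugate_nth:
  assumes "y < length (conjugate lam)"
  shows "conjugate lam ! y = card {x. (x, y) \<in> diagram lam}"
proof -
  let ?M = "Max (insert 0 (set lam))"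
  have y: "y < ?M" using assms by (simp only: length_conjugate)
  \<comment> \<open>Columns of the diagram are numbered from 0: column \<open>y\<close> counts the
    parts that are at least \<open>y + 1\<close>.\<close>
  then have "[1..<Suc ?M] ! y = Suc y" by (subst nth_upt) auto
  moreover have "conjugate lam ! y = card {j. j < length lam \<and> lam ! j \<ge> [1..<Suc ?M] ! y}"
    unfolding conjugate_def using y by (intro nth_map) (simp add: One_nat_def del: upt_Suc)
  ultimately show ?thesis by (simp add: diagram_def Suc_le_eq)
qed

lemma diagram_less_length_conjugate:
  assumes "(x, y) \<in> diagram lam"
  shows "y < length (conjugate lam)"
proof -
  have "y < lam ! x" "lam ! x \<in> set lam" using assms by (auto simp: diagram_def)
  then show ?thesis
    unfolding length_conjugate by (meson List.finite_set Max_ge finite_insert insertCI less_le_trans)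
qed

section \<open>Young's permutation modules\<close>

text \<open>Encodes an ordered set partition by the function giving the block number of each
  element; the group action then becomes composition with the inverse.\<close>

definition blocks :: "nat \<Rightarrow> (nat \<Rightarrow> nat) \<Rightarrow> nat \<Rightarrow> nat set list" where
  "blocks n c m = map (\<lambda>k. {i \<in> {1..n}. c i = k}) [0..<m]"

lemma ordered_set_partition_blocks:
  assumes x: "x \<in> ordered_set_partitions n mu"
  shows "\<exists>c. x = blocks n c (length mu) \<and> (\<forall>i\<in>{1..n}. c i < length mu) \<and>
    (\<forall>k<length mu. card {i \<in> {1..n}. c i = k} = mu ! k)"
proof -
  have x: "map card x = mu" "\<Union>(set x) = {1..n}"
    "\<And>i j. i < length x \<Longrightarrow> j < length x \<Longrightarrow> i \<noteq> j \<Longrightarrow> x ! i \<inter> x ! j = {}"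
    using x by (auto simp: ordered_set_partitions_def)
  have len: "length x = length mu" using x(1) by (metis length_map)
  have "\<exists>k<length x. i \<in> x ! k" if "i \<in> {1..n}" for i
    using that unfolding x(2)[symmetric] by (auto simp: in_set_conv_nth)
  then obtain c where c: "\<And>i. i \<in> {1..n} \<Longrightarrow> c i < length x \<and> i \<in> x ! (c i)" by metis
  have nth: "x ! k = {i \<in> {1..n}. c i = k}" if k: "k < length x" for k
  proof (intro equalityI subsetI)
    fix i assume i: "i \<in> x ! k"
    then have "i \<in> {1..n}" using k x(2) nth_mem[OF k] by blast
    then show "i \<in> {i \<in> {1..n}. c i = k}" using c[of i] x(3)[of "c i" k] i k by blast
  qed (use c in auto)
  have "x = blocks n c (length mu)"
    unfolding blocks_def using nth len by (intro nth_equalityI) auto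
  moreover have "card {i \<in> {1..n}. c i = k} = mu ! k" if "k < length mu" for k
    using nth[of k] x(1) that len by (metis nth_map)
  ultimately show ?thesis using c len by metis
qed

lemma blocks_in:
  assumes "\<And>i. i \<in> {1..n} \<Longrightarrow> c i < length mu"
    and "\<And>k. k < length mu \<Longrightarrow> card {i \<in> {1..n}. c i = k} = mu ! k"
  shows "blocks n c (length mu) \<in> ordered_set_partitions n mu"
proof -
  have "map card (blocks n c (length mu)) = mu"
    using assms(2) by (intro nth_equalityI) (auto simp: blocks_def)
  moreover have "\<Union>(set (blocks n c (length mu))) = {1..n}"
    using assms(1) by (auto simp: blocks_def)
  ultimately show ?thesis by (auto simp: ordered_set_partitions_def blocks_def)
qed

lemma blocks_image:
  assumes "g permutes {1..n}"
  shows "map (image g) (blocks n c m) = blocks n (c \<circ> inv' g) m"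
proof -
  have "g ` {i \<in> {1..n}. c i = k} = {i \<in> {1..n}. c (inv' g i) = k}" for k
  proof (intro equalityI subsetI)
    fix i assume "i \<in> {i \<in> {1..n}. c (inv' g i) = k}"
    then have "inv' g i \<in> {i \<in> {1..n}. c i = k}" "i = g (inv' g i)"
      using permutes_in_image[OF permutes_inv[OF assms]] permutes_inverses[OF assms] by auto
    then show "i \<in> g ` {i \<in> {1..n}. c i = k}" by blast
  qed (use permutes_in_image[OF assms] permutes_inverses[OF assms] in auto)
  then show ?thesis by (simp add: blocks_def)
qed

lemma (in sym_grp) blocks_stab:
  assumes "g \<in> stab c"
  shows "map (image g) (blocks n c m) = blocks n c m"
proof -
  have "c \<circ> inv' g = c" using stab_eq[OF inv_stab[OF assms]] by auto
  then show ?thesis by (simp add: blocks_image[OF stab_perm[OF assms]])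
qed

lemma (in sym_grp) stab_blocks:
  assumes g: "g permutes {1..n}" and c: "\<And>i. i \<in> {1..n} \<Longrightarrow> c i < m"
    and eq: "map (image g) (blocks n c m) = blocks n c m"
  shows "g \<in> stab c"
proof (rule stabI[OF g])
  fix i assume i: "i \<in> {1..n}"
  have "map (image g) (blocks n c m) ! c i = g ` {j \<in> {1..n}. c j = c i}"
    using c[OF i] by (simp add: blocks_def)
  moreover have "blocks n c m ! c i = {j \<in> {1..n}. c j = c i}"
    using c[OF i] by (simp add: blocks_def)
  ultimately have "g ` {j \<in> {1..n}. c j = c i} = {j \<in> {1..n}. c j = c i}" using eq by simp
  then have "g i \<in> {j \<in> {1..n}. c j = c i}" using i by blast
  then show "c (g i) = c i" by simp
qed

lemma ex_bij_same_fibres: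
  assumes "finite A" "finite B"
    and "\<And>k. card {a \<in> A. c a = k} = card {b \<in> B. d b = k}"
  shows "\<exists>f. bij_betw f A B \<and> (\<forall>a\<in>A. d (f a) = c a)"
proof -
  have "\<exists>h. bij_betw h {a \<in> A. c a = k} {b \<in> B. d b = k}" for k
    using assms by (intro finite_same_card_bij) auto
  then obtain h where h: "\<And>k. bij_betw (h k) {a \<in> A. c a = k} {b \<in> B. d b = k}" by metis
  define f where "f a = h (c a) a" for a
  have f: "f a \<in> B \<and> d (f a) = c a" if "a \<in> A" for a
    using bij_betwE[OF h[of "c a"]] that by (auto simp: f_def)
  have "inj_on f A"
  proof (rule inj_onI)
    fix a a' assume a: "a \<in> A" "a' \<in> A" "f a = f a'"
    then have "c a = c a'" using f by metis
    then show "a = a'"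
      using a bij_betw_imp_inj_on[OF h[of "c a"]] by (auto simp: f_def inj_on_def)
  qed
  moreover have "f ` A = B"
  proof (intro equalityI subsetI)
    fix b assume b: "b \<in> B"
    then have "b \<in> h (d b) ` {a \<in> A. c a = d b}"
      using bij_betw_imp_surj_on[OF h[of "d b"]] by auto
    then obtain a where "a \<in> A" "c a = d b" "b = h (d b) a" by blast
    then show "b \<in> f ` A" by (intro image_eqI[of _ _ a]) (simp_all add: f_def)
  qed (use f in auto)
  ultimately show ?thesis using f by (auto simp: bij_betw_def)
qed

text \<open>Young's permutation module (\<open>s = 1\<close>) and its sign twist (\<open>s = sign\<close>) are treated together.\<close>

definition twisted_young :: "((nat \<Rightarrow> nat) \<Rightarrow> int) \<Rightarrow> nat \<Rightarrow> nat list \<Rightarrow>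
    (nat \<Rightarrow> nat, nat set list \<Rightarrow> complex) rep" where
  "twisted_young s n mu = \<lparr>rep_space = functions_on (ordered_set_partitions n mu),
     act = (\<lambda>g f x. of_int (s g) * f (map (image (inv\<^bsub>sym_group n\<^esub> g)) x))\<rparr>"

lemma young_perm_rep_twisted: "young_perm_rep n mu = twisted_young (\<lambda>_. 1) n mu"
  by (simp add: young_perm_rep_def perm_rep_def twisted_young_def)

lemma sign_twist_twisted: "sign_twist (young_perm_rep n mu) = twisted_young sign n mu"
  by (auto simp: young_perm_rep_def perm_rep_def twisted_young_def sign_twist_def fun_eq_iff fun_apply_simps)

lemma ordered_set_partitions_image:
  assumes g: "g permutes {1..n}"
  shows "map (image g) x \<in> ordered_set_partitions n mu \<longleftrightarrow> x \<in> ordered_set_partitions n mu"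
proof -
  have *: "map (image g) x \<in> ordered_set_partitions n mu"
    if g: "g permutes {1..n}" and x: "x \<in> ordered_set_partitions n mu" for g x
  proof -
    have inj: "inj g" using g by (rule permutes_inj)
    have x': "map card x = mu" "\<Union>(set x) = {1..n}"
      "\<And>i j. i < length x \<Longrightarrow> j < length x \<Longrightarrow> i \<noteq> j \<Longrightarrow> x ! i \<inter> x ! j = {}"
      using x by (auto simp: ordered_set_partitions_def)
    have 1: "map card (map (image g) x) = mu"
      using card_image[OF inj_on_subset[OF inj]] x'(1) by (simp add: o_def)
    have "\<Union>(set (map (image g) x)) = g ` \<Union>(set x)" by auto
    then have 2: "\<Union>(set (map (image g) x)) = {1..n}" using x'(2) permutes_image[OF g] by simp
    have 3: "g ` (x ! i) \<inter> g ` (x ! j) = {}" if "i < length x" "j < length x" "i \<noteq> j" for i j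
      using x'(3)[OF that] image_Int[OF inj] by (metis image_empty)
    show ?thesis
      unfolding ordered_set_partitions_def mem_Collect_eq 1 2 using 3 by simp
  qed
  have "map (image (inv' g)) (map (image g) x) = x"
    using permutes_inv_o(2)[OF g] by (simp add: image_comp map_idI)
  then show ?thesis using *[OF g, of x] *[OF permutes_inv[OF g], of "map (image g) x"] by auto
qed

context sym_grp
begin

definition char_fun :: "((nat \<Rightarrow> nat) \<Rightarrow> int) \<Rightarrow> (nat \<Rightarrow> nat) \<Rightarrow> (nat \<Rightarrow> nat) \<Rightarrow> complex" where
  "char_fun s c = (\<lambda>g. if g \<in> stab c then of_int (s g) else 0)"

lemma row_sum_char: "row_sum r = char_fun (\<lambda>_. 1) r"
  by (rule ext) (simp add: row_sum_def char_fun_def)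

lemma col_sum_char: "col_sum c = char_fun sign c"
  by (simp add: col_sum_def char_fun_def)

definition is_char :: "((nat \<Rightarrow> nat) \<Rightarrow> int) \<Rightarrow> bool" where
  "is_char s \<longleftrightarrow> s id = 1 \<and> (\<forall>g h. g permutes {1..n} \<longrightarrow> h permutes {1..n} \<longrightarrow> s (g \<circ> h) = s g * s h) \<and>
     (\<forall>g. s g * s g = 1)"

lemma is_char_one: "is_char (\<lambda>_. 1)"
  by (simp add: is_char_def)

lemma is_char_sign: "is_char sign"
  by (simp add: is_char_def sign_mult)

lemma twisted_young_representation:
  assumes s: "is_char s"
  shows "group_representation (sym_group n) (twisted_young s n mu)"
proof
  let ?R = "twisted_young s n mu"
  show "complex_vector.subspace (rep_space ?R)"
    by (simp add: twisted_young_def subspace_functions_on)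
  show "linear_map_on (rep_space ?R) (rep_space ?R) (act ?R g)" if g: "g \<in> carrier (sym_group n)" for g
    using g ordered_set_partitions_image[OF permutes_inv, of g n]
    unfolding linear_map_on_def twisted_young_def
    by (auto simp: functions_on_def fun_eq_iff fun_apply_simps sym_group_carrier inv_sym distrib_left)
  show "act ?R \<one>\<^bsub>sym_group n\<^esub> x = x" for x
    using s by (simp add: twisted_young_def sym_group_one is_char_def inv_sym permutes_id)
  show "act ?R (g \<otimes>\<^bsub>sym_group n\<^esub> h) x = act ?R g (act ?R h x)"
    if "g \<in> carrier (sym_group n)" "h \<in> carrier (sym_group n)" for g h x
  proof -
    have img: "image (f \<circ> k) = image f \<circ> image k" for f k :: "nat \<Rightarrow> nat"
      by (rule ext) (simp add: image_comp)
    show ?thesis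
    using that s by (auto simp: twisted_young_def sym_group_carrier sym_group_mult is_char_def inv_sym
        permutes_compose fun_eq_iff o_inv_distrib permutes_bij img mult.assoc)
  qed
qed

lemma alg_act_char_fun:
  "alg_act (twisted_young s' n mu) (char_fun s c) f x
   = (\<Sum>q\<in>stab c. of_int (s q * s' q) * f (map (image (inv' q)) x))"
proof -
  have "alg_act (twisted_young s' n mu) (char_fun s c) f x
      = (\<Sum>q\<in>carrier (sym_group n). char_fun s c q * (of_int (s' q) * f (map (image (inv' q)) x)))"
    unfolding alg_act_def
    by (auto simp: fun_apply_simps twisted_young_def inv_sym sym_group_carrier intro!: sum.cong)
  also have "\<dots> = (\<Sum>q\<in>stab c. char_fun s c q * (of_int (s' q) * f (map (image (inv' q)) x)))"
    using stab_carrier by (intro sum.mono_neutral_right) (auto simp: char_fun_def)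
  finally show ?thesis by (simp add: char_fun_def mult.assoc)
qed

lemma char_fun_blocks:
  assumes s: "is_char s"
  shows "alg_act (twisted_young s n mu) (char_fun s c) f (blocks n c m) = of_nat (card (stab c)) * f (blocks n c m)"
proof -
  have "of_int (s q * s q) * f (map (image (inv' q)) (blocks n c m)) = f (blocks n c m)" if "q \<in> stab c" for q
    using s blocks_stab[OF inv_stab[OF that]] unfolding is_char_def by simp
  then show ?thesis by (simp add: alg_act_char_fun)
qed

text \<open>A nonzero function of \<open>U\<close> is nonzero somewhere, and the transitive action
  on ordered set partitions moves that point to the blocks of \<open>c\<close>. There, summing over
  the stabilizer only multiplies the value by the order of the stabilizer.\<close>

lemma char_fun_nonzero_on_invariant:
  assumes s: "is_char s" and U: "invariant_subspace (sym_group n) (twisted_young s n mu) U" "U \<noteq> {0}"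
    and c: "\<And>i. i \<in> {1..n} \<Longrightarrow> c i < length mu"
      "\<And>k. k < length mu \<Longrightarrow> card {i \<in> {1..n}. c i = k} = mu ! k"
  shows "\<exists>u\<in>U. alg_act (twisted_young s n mu) (char_fun s c) u \<noteq> 0"
proof -
  let ?R = "twisted_young s n mu"
  obtain f where f: "f \<in> U" "f \<noteq> 0"
    using U complex_vector.subspace_0[of U] by (auto simp: invariant_subspace_def)
  then obtain x where x: "f x \<noteq> 0" by (auto simp: fun_eq_iff)
  have "f \<in> functions_on (ordered_set_partitions n mu)"
    using f(1) U(1) by (auto simp: invariant_subspace_def twisted_young_def)
  then have "x \<in> ordered_set_partitions n mu" using x by (auto simp: functions_on_def)
  then obtain d where d: "x = blocks n d (length mu)" "\<And>i. i \<in> {1..n} \<Longrightarrow> d i < length mu"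
    "\<And>k. k < length mu \<Longrightarrow> card {i \<in> {1..n}. d i = k} = mu ! k"
    using ordered_set_partition_blocks by blast
  have "card {i \<in> {1..n}. d i = k} = card {i \<in> {1..n}. c i = k}" for k
  proof (cases "k < length mu")
    case False
    then have "{i \<in> {1..n}. d i = k} = {}" "{i \<in> {1..n}. c i = k} = {}" using d(2) c(1) by auto
    then show ?thesis by (simp only:)
  qed (use c d in auto)
  then obtain h where h: "bij_betw h {1..n} {1..n}" "\<And>i. i \<in> {1..n} \<Longrightarrow> c (h i) = d i"
    using ex_bij_same_fibres[of "{1..n}" "{1..n}" d c] by auto
  define g where "g = (\<lambda>i. if i \<in> {1..n} then h i else i)"
  have g: "g permutes {1..n}" unfolding g_def by (rule permutes_of_bij_betw[OF h(1)])
  have "inv' g i \<in> {1..n}" if "i \<in> {1..n}" for i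
    using permutes_in_image[OF permutes_inv[OF g]] that by blast
  then have "d (inv' g i) = c i" if "i \<in> {1..n}" for i
    using h(2)[of "inv' g i"] that permutes_inverses(1)[OF g, of i] by (simp add: g_def split: if_splits)
  then have xg: "map (image g) x = blocks n c (length mu)"
    unfolding d(1) blocks_image[OF g] by (auto simp: blocks_def)
  have "map (image (inv' g)) (map (image g) x) = x"
    using permutes_inv_o(2)[OF g] by (simp add: image_comp map_idI)
  then have xg': "map (image (inv' g)) (blocks n c (length mu)) = x" unfolding xg .
  define u where "u = act ?R g f"
  have "u \<in> U" using U(1) f(1) g by (auto simp: u_def invariant_subspace_def sym_group_carrier)
  have "u (blocks n c (length mu)) = of_int (s g) * f x"
    using g xg' by (simp add: u_def twisted_young_def inv_sym)
  moreover have "s g \<noteq> 0" using s unfolding is_char_def by (metis mult_zero_left zero_neq_one)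
  ultimately have "alg_act ?R (char_fun s c) u (blocks n c (length mu)) \<noteq> 0"
    using x id_stab[of c] by (auto simp: char_fun_blocks[OF s])
  then have "alg_act ?R (char_fun s c) u \<noteq> 0" by (metis zero_fun_apply)
  then show ?thesis using \<open>u \<in> U\<close> by (rule bexI)
qed

text \<open>Only the identity of \<open>stab c\<close> fixes the ordered set partition
  \<open>blocks n r m\<close>, so a single term of the sum survives.\<close>

lemma char_fun_transversal:
  assumes r: "\<And>i. i \<in> {1..n} \<Longrightarrow> r i < m" and s: "is_char s" "is_char s'"
    and triv: "\<And>g. g \<in> stab r \<Longrightarrow> g \<in> stab c \<Longrightarrow> g = id"
  shows "alg_act (twisted_young s' n mu) (char_fun s c) (delta (blocks n r m)) (blocks n r m) = 1"
proof -
  have "of_int (s q * s' q) * delta (blocks n r m) (map (image (inv' q)) (blocks n r m))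
      = (if q = id then 1 else 0 :: complex)" if q: "q \<in> stab c" for q
  proof (cases "map (image (inv' q)) (blocks n r m) = blocks n r m")
    case True
    have "inv' q \<in> stab r"
      by (rule stab_blocks[of _ r m]) (use permutes_inv[OF stab_perm[OF q]] r True in auto)
    then have "q = id" using triv[OF _ q] by (simp add: inv_stab_iff stab_perm[OF q])
    then show ?thesis using True s by (simp add: delta_def is_char_def)
  next
    case False
    then have "q \<noteq> id" by (auto simp: map_idI)
    then show ?thesis using False by (simp add: delta_def)
  qed
  then show ?thesis
    unfolding alg_act_char_fun using id_stab by (simp cong: sum.cong)
qed

lemma char_fun_delta_blocks:
  assumes r: "\<And>i. i \<in> {1..n} \<Longrightarrow> c i < m" and s: "is_char s"
  shows "alg_act (twisted_young s n mu) (char_fun s c) (delta (blocks n c m))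
    = of_nat (card (stab c)) *\<^sub>C delta (blocks n c m)"
proof
  fix x
  have "of_int (s q * s q) * delta (blocks n c m) (map (image (inv' q)) x) = delta (blocks n c m) x"
    if q: "q \<in> stab c" for q
  proof -
    have "map (image q) (map (image (inv' q)) x) = x"
      using permutes_inv_o(1)[OF stab_perm[OF q]] by (simp add: image_comp map_idI)
    then have "map (image (inv' q)) x = blocks n c m \<longleftrightarrow> x = blocks n c m"
      using blocks_stab[OF q] blocks_stab[OF inv_stab[OF q]] by metis
    then show ?thesis using s unfolding is_char_def by (simp add: delta_def)
  qed
  then show "alg_act (twisted_young s n mu) (char_fun s c) (delta (blocks n c m)) x
      = (of_nat (card (stab c)) *\<^sub>C delta (blocks n c m)) x"
    by (simp add: alg_act_char_fun fun_apply_simps)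
qed

end

lemma rep_iso_irreducible:
  assumes iso: "rep_iso G R S" and R: "irreducible_rep G R"
  shows "irreducible_rep G S"
proof -
  obtain T where T: "linear_map_on (rep_space R) (rep_space S) T"
    "bij_betw T (rep_space R) (rep_space S)"
    "\<And>g x. g \<in> carrier G \<Longrightarrow> x \<in> rep_space R \<Longrightarrow> T (act R g x) = act S g (T x)"
    and rep: "group_representation G R" "group_representation G S"
    using iso by (auto simp: rep_iso_def)
  have T0: "T 0 = 0"
    using linear_map_on_zero[OF T(1) group_representation.subspace[OF rep(1)]] .
  have im: "T ` rep_space R = rep_space S" using T(2) by (simp add: bij_betw_def)
  have inj: "inj_on T (rep_space R)" using T(2) by (simp add: bij_betw_def)
  have R0: "0 \<in> rep_space R"
    using complex_vector.subspace_0[OF group_representation.subspace[OF rep(1)]] .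
  have ne: "rep_space S \<noteq> {0}"
  proof
    assume S0: "rep_space S = {0}"
    have "x = 0" if "x \<in> rep_space R" for x
      using inj_onD[OF inj, of x 0] R0 that T0 im S0 by auto
    then show False using R R0 by (auto simp: irreducible_rep_def)
  qed
  have "U = {0} \<or> U = rep_space S" if U: "invariant_subspace G S U" for U
  proof -
    let ?V = "{x \<in> rep_space R. T x \<in> U}"
    have sub: "complex_vector.subspace U" "U \<subseteq> rep_space S" using U by (auto simp: invariant_subspace_def)
    have "complex_vector.subspace ?V"
      using complex_vector.subspace_0[OF sub(1)] complex_vector.subspace_add[OF sub(1)]
        complex_vector.subspace_scale[OF sub(1)] group_representation.subspace[OF rep(1)]
      by (intro complex_vector.subspaceI)
        (auto simp: T0 R0 linear_map_onD[OF T(1)] complex_vector.subspace_add complex_vector.subspace_scale)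
    then have "invariant_subspace G R ?V"
      using U T(3) group_representation.act_in[OF rep(1)] by (auto simp: invariant_subspace_def)
    then have V: "?V = {0} \<or> ?V = rep_space R" using R by (auto simp: irreducible_rep_def)
    have "U = T ` ?V" using im sub(2) by auto
    then show ?thesis using V im T0 by auto
  qed
  then show ?thesis using ne rep(2) by (auto simp: irreducible_rep_def)
qed

section \<open>The irreducible representation of a partition\<close>

context sym_grp
begin

abbreviation young_of :: "nat list \<Rightarrow> (nat \<Rightarrow> nat) \<Rightarrow> complex" where
  "young_of lam \<equiv> young (row_of n lam) (col_of n lam)"

lemma primitive_young_of: "lam \<in> partitions n \<Longrightarrow> primitive (young_of lam)"
  by (rule young_primitive[OF tableau_row_col_of])

lemma row_of_blocks:
  assumes "lam \<in> partitions n"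
  shows "i \<in> {1..n} \<Longrightarrow> row_of n lam i < length lam"
    and "k < length lam \<Longrightarrow> card {i \<in> {1..n}. row_of n lam i = k} = lam ! k"
  using tableau_cell[OF tableau_row_col_of[OF assms], of i]
    partition_row_card[OF tableau_row_col_of[OF assms]]
  by (auto simp: diagram_def)

lemma col_of_blocks:
  assumes "lam \<in> partitions n"
  shows "i \<in> {1..n} \<Longrightarrow> col_of n lam i < length (conjugate lam)"
    and "k < length (conjugate lam) \<Longrightarrow> card {i \<in> {1..n}. col_of n lam i = k} = conjugate lam ! k"
  using tableau_cell[OF tableau_row_col_of[OF assms], of i] diagram_less_length_conjugate
    tableau_col_card[OF tableau_row_col_of[OF assms], of k] conjugate_nth[of k lam]
  by auto

text \<open>The product \<open>a b\<close> is tested on the indicator of the row partition, at that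
  same point: the column sum produces the value 1 there and the row sum multiplies it by the order
  of the row stabilizer.\<close>

lemma young_nonzero_on_young_perm_rep:
  assumes lam: "lam \<in> partitions n"
  shows "\<exists>v\<in>rep_space (young_perm_rep n lam). alg_act (young_perm_rep n lam) (young_of lam) v \<noteq> 0"
proof -
  let ?r = "row_of n lam" and ?c = "col_of n lam" and ?R = "twisted_young (\<lambda>_. 1) n lam"
  let ?x = "blocks n ?r (length lam)"
  have x: "?x \<in> ordered_set_partitions n lam" by (rule blocks_in) (use row_of_blocks[OF lam] in auto)
  have R: "group_representation (sym_group n) ?R" by (rule twisted_young_representation[OF is_char_one])
  have d: "delta ?x \<in> rep_space ?R" using x by (simp add: twisted_young_def)
  have "alg_act ?R (row_sum ?r \<star> col_sum ?c) (delta ?x) ?x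
      = of_nat (card (stab ?r)) * alg_act ?R (col_sum ?c) (delta ?x) ?x"
    unfolding alg_act_conv[OF R d] row_sum_char by (rule char_fun_blocks[OF is_char_one])
  also have "alg_act ?R (col_sum ?c) (delta ?x) ?x = 1"
    unfolding col_sum_char
    by (rule char_fun_transversal[OF row_of_blocks(1)[OF lam] is_char_sign is_char_one])
      (auto intro: stab_row_col[OF tableau_row_col_of[OF lam]])
  finally have "alg_act ?R (row_sum ?r \<star> col_sum ?c) (delta ?x) \<noteq> 0"
    using card_stab_pos[of ?r] by auto
  then show ?thesis
    using young_acts_nonzero[OF tableau_row_col_of[OF lam] R d] by (simp add: young_perm_rep_twisted)
qed

text \<open>The dual computation with the column partition: after the twist the column sum acts on
  its indicator as the order of the column stabilizer, and the row sum then leaves the value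
  1.\<close>

lemma young_nonzero_on_sign_twist:
  assumes lam: "lam \<in> partitions n"
  shows "\<exists>v\<in>rep_space (sign_twist (young_perm_rep n (conjugate lam))).
    alg_act (sign_twist (young_perm_rep n (conjugate lam))) (young_of lam) v \<noteq> 0"
proof -
  let ?r = "row_of n lam" and ?c = "col_of n lam" and ?R = "twisted_young sign n (conjugate lam)"
  let ?x = "blocks n ?c (length (conjugate lam))"
  have x: "?x \<in> ordered_set_partitions n (conjugate lam)"
    by (rule blocks_in) (use col_of_blocks[OF lam] in auto)
  have R: "group_representation (sym_group n) ?R" by (rule twisted_young_representation[OF is_char_sign])
  have d: "delta ?x \<in> rep_space ?R" using x by (simp add: twisted_young_def)
  have b: "alg_act ?R (col_sum ?c) (delta ?x) = of_nat (card (stab ?c)) *\<^sub>C delta ?x"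
    unfolding col_sum_char by (rule char_fun_delta_blocks[OF col_of_blocks(1)[OF lam] is_char_sign])
  have "alg_act ?R (row_sum ?r \<star> col_sum ?c) (delta ?x) ?x
      = of_nat (card (stab ?c)) * alg_act ?R (row_sum ?r) (delta ?x) ?x"
    unfolding alg_act_conv[OF R d] b linear_map_onD(3)[OF linear_alg_act[OF R] d]
    by (simp add: fun_apply_simps)
  also have "alg_act ?R (row_sum ?r) (delta ?x) ?x = 1"
    unfolding row_sum_char
    by (rule char_fun_transversal[OF col_of_blocks(1)[OF lam] is_char_one is_char_sign])
      (auto intro: stab_row_col[OF tableau_row_col_of[OF lam]])
  finally have "alg_act ?R (row_sum ?r \<star> col_sum ?c) (delta ?x) \<noteq> 0"
    using card_stab_pos[of ?c] by auto
  then show ?thesis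
    using young_acts_nonzero[OF tableau_row_col_of[OF lam] R d] by (simp add: sign_twist_twisted)
qed

text \<open>Uniqueness of the irreducible module of a partition: occurrence in the permutation
  module makes the row sum act nontrivially, occurrence in the twisted one the column sum, and for
  an irreducible module this suffices for the symmetrizer.\<close>

lemma young_iso:
  assumes lam: "lam \<in> partitions n" and S: "irreducible_rep (sym_group n) S"
    and occ: "occurs_in (sym_group n) S (young_perm_rep n lam)"
      "occurs_in (sym_group n) S (sign_twist (young_perm_rep n (conjugate lam)))"
  shows "rep_iso (sym_group n) S (ideal_rep (young_of lam))"
proof -
  have nz: "\<exists>s\<in>rep_space S. alg_act S (char_fun s' c) s \<noteq> 0"
    if s': "is_char s'" and occ: "occurs_in (sym_group n) S (twisted_young s' n mu)"
      and c: "\<And>i. i \<in> {1..n} \<Longrightarrow> c i < length mu"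
        "\<And>k. k < length mu \<Longrightarrow> card {i \<in> {1..n}. c i = k} = mu ! k" for s' mu c
  proof -
    obtain U where U: "invariant_subspace (sym_group n) (twisted_young s' n mu) U"
      "rep_iso (sym_group n) S (subrep (twisted_young s' n mu) U)"
      using occ by (auto simp: occurs_in_def)
    have "irreducible_rep (sym_group n) (subrep (twisted_young s' n mu) U)"
      using rep_iso_irreducible[OF U(2) S] .
    then have "U \<noteq> {0}" by (simp add: irreducible_rep_def)
    then obtain u where "u \<in> U" "alg_act (twisted_young s' n mu) (char_fun s' c) u \<noteq> 0"
      using char_fun_nonzero_on_invariant[OF s' U(1) _ c] by blast
    then show ?thesis
      using rep_iso_alg_act_nonzero[OF rep_iso_sym[OF U(2)], of u] by simp
  qed
  obtain s where s: "s \<in> rep_space S" "alg_act S (row_sum (row_of n lam)) s \<noteq> 0"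
    using nz[OF is_char_one occ(1)[unfolded young_perm_rep_twisted] row_of_blocks[OF lam]]
    by (auto simp: row_sum_char)
  obtain t where t: "t \<in> rep_space S" "alg_act S (col_sum (col_of n lam)) t \<noteq> 0"
    using nz[OF is_char_sign occ(2)[unfolded sign_twist_twisted] col_of_blocks[OF lam]]
    by (auto simp: col_sum_char)
  show ?thesis
    using irreducible_young_nonzero[OF tableau_row_col_of[OF lam] S s t]
      irreducible_iso_ideal[OF primitive_young_of[OF lam] S] by blast
qed

text \<open>The choice operator ranges over representations on functions of set lists, so the
  witness is the copy of the left ideal inside \<open>young_perm_rep n lam\<close>; whatever is
  chosen is identified by \<open>young_iso\<close>.\<close>

lemma irrep_of_partition_iso:
  assumes lam: "lam \<in> partitions n"
  shows "rep_iso (sym_group n) (irrep_of_partition n lam) (ideal_rep (young_of lam))"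
proof -
  let ?P = "\<lambda>R. irreducible_rep (sym_group n) R \<and> occurs_in (sym_group n) R (young_perm_rep n lam) \<and>
    occurs_in (sym_group n) R (sign_twist (young_perm_rep n (conjugate lam)))"
  note prim = primitive_young_of[OF lam]
  have R: "group_representation (sym_group n) (young_perm_rep n lam)"
    unfolding young_perm_rep_twisted by (rule twisted_young_representation[OF is_char_one])
  have R': "group_representation (sym_group n) (sign_twist (young_perm_rep n (conjugate lam)))"
    unfolding sign_twist_twisted by (rule twisted_young_representation[OF is_char_sign])
  obtain v where v: "v \<in> rep_space (young_perm_rep n lam)" "alg_act (young_perm_rep n lam) (young_of lam) v \<noteq> 0"
    using young_nonzero_on_young_perm_rep[OF lam] by blast
  define U where "U = (\<lambda>y. alg_act (young_perm_rep n lam) y v) ` left_ideal (young_of lam)"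
  note U = ideal_embeds[OF prim R v, folded U_def]
  obtain v' where v': "v' \<in> rep_space (sign_twist (young_perm_rep n (conjugate lam)))"
      "alg_act (sign_twist (young_perm_rep n (conjugate lam))) (young_of lam) v' \<noteq> 0"
    using young_nonzero_on_sign_twist[OF lam] by blast
  define U' where "U' = (\<lambda>y. alg_act (sign_twist (young_perm_rep n (conjugate lam))) y v') ` left_ideal (young_of lam)"
  note U' = ideal_embeds[OF prim R' v', folded U'_def]
  have "?P (subrep (young_perm_rep n lam) U)"
    using rep_iso_irreducible[OF U(2) ideal_rep_irreducible[OF prim]] U(1) U'(1)
      rep_iso_trans[OF rep_iso_sym[OF U(2)] U(2)] rep_iso_trans[OF rep_iso_sym[OF U(2)] U'(2)]
    unfolding occurs_in_def by blast
  then have "?P (irrep_of_partition n lam)"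
    unfolding irrep_of_partition_def by (rule someI)
  then show ?thesis using young_iso[OF lam] by blast
qed

end

section \<open>Conjugacy classes of the symmetric group\<close>

text \<open>Coincidences among iterates depend only on the length of the cycle, so they carry over
  between cycles of equal length.\<close>

lemma funpow_eq_iff_mod_card_orbit:
  assumes f: "permutation f"
  shows "(f ^^ m) x = (f ^^ k) x \<longleftrightarrow> m mod card (orbit f x) = k mod card (orbit f x)"
proof -
  have x: "x \<in> orbit f x" using f by (rule permutation_self_in_orbit)
  define d where "d = funpow_dist1 f x x"
  have d0: "d > 0" by (simp add: d_def)
  have inj: "inj_on (\<lambda>n. (f ^^ n) x) {0..<d}" unfolding d_def by (rule inj_on_funpow_dist1[OF x])
  have card: "card (orbit f x) = d"
    using orbit_conv_funpow_dist1[OF x] card_image[OF inj] by (simp add: d_def)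
  have per: "(f ^^ d) x = x" unfolding d_def by (rule funpow_dist1_prop[OF x])
  have "(f ^^ m) x = (f ^^ (m mod d)) x" for m
    by (rule funpow_mod_eq[OF per, symmetric])
  then show ?thesis
    unfolding card using inj_on_eq_iff[OF inj, of "m mod d" "k mod d"] d0 by simp
qed

context sym_grp
begin

definition orbits :: "(nat \<Rightarrow> nat) \<Rightarrow> nat set set" where
  "orbits g = orbit g ` {1..n}"

text \<open>A multiset is used because distinct orbits of equal size must each contribute a part;
  fixed points contribute parts equal to 1.\<close>

definition cycle_type :: "(nat \<Rightarrow> nat) \<Rightarrow> nat list" where
  "cycle_type g = rev (sorted_list_of_multiset (image_mset card (mset_set (orbits g))))"

lemma permutes_permutation: "g permutes {1..n} \<Longrightarrow> permutation g"
  by (auto simp: permutation_permutes)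

lemma finite_orbits [simp]: "finite (orbits g)"
  by (simp add: orbits_def)

lemma orbits_partition:
  assumes g: "g permutes {1..n}"
  shows "\<Union>(orbits g) = {1..n}" and "P \<in> orbits g \<Longrightarrow> finite P" and "P \<in> orbits g \<Longrightarrow> P \<noteq> {}"
    and "P \<in> orbits g \<Longrightarrow> x \<in> P \<Longrightarrow> orbit g x = P"
proof -
  note pg = permutes_permutation[OF g]
  show "\<Union>(orbits g) = {1..n}"
    using permutation_self_in_orbit[OF pg] permutes_orbit_subset[OF g] by (fastforce simp: orbits_def)
  show "P \<in> orbits g \<Longrightarrow> finite P"
    using finite_orbit[OF permutation_self_in_orbit[OF pg]] by (auto simp: orbits_def)
  show "P \<in> orbits g \<Longrightarrow> P \<noteq> {}" by (auto simp: orbits_def orbit_nonempty)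
  show "P \<in> orbits g \<Longrightarrow> x \<in> P \<Longrightarrow> orbit g x = P"
    using orbit_cyclic_eq3[OF cyclic_on_orbit'[OF pg]] by (auto simp: orbits_def)
qed

lemma cycle_type_partition:
  assumes g: "g permutes {1..n}"
  shows "cycle_type g \<in> partitions n"
proof -
  note O = orbits_partition[OF g]
  have "sum_list (cycle_type g) = sum_mset (mset (sorted_list_of_multiset (image_mset card (mset_set (orbits g)))))"
    unfolding cycle_type_def by (simp only: sum_mset_sum_list sum_list_rev)
  also have "\<dots> = (\<Sum>P\<in>orbits g. card P)" by (simp add: sum_unfold_sum_mset)
  also have "\<dots> = card (\<Union>(orbits g))"
  proof (rule card_Union_disjoint[symmetric])
    show "pairwise disjnt (orbits g)"
      using O(4) by (auto simp: pairwise_def disjnt_def)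
  qed (use O in auto)
  finally have "sum_list (cycle_type g) = n" using O(1) by simp
  moreover have "0 \<notin> set (cycle_type g)"
    using O(2,3) by (auto simp: cycle_type_def card_eq_0_iff)
  moreover have "sorted_wrt (\<ge>) (cycle_type g)"
    using sorted_sorted_list_of_multiset[of "image_mset card (mset_set (orbits g))"]
    by (simp add: cycle_type_def sorted_wrt_rev)
  ultimately show ?thesis by (simp add: partitions_def)
qed

text \<open>Orbits of \<open>g\<close> and \<open>h\<close> are matched by a size-preserving
  bijection \<open>F\<close>, and a base point \<open>a\<close> is chosen in each. The conjugating
  map sends the \<open>k\<close>-th iterate of a base point under \<open>g\<close> to the
  \<open>k\<close>-th iterate of the matching base point under \<open>h\<close>.\<close>

lemma cycle_type_eq_conjugate:
  assumes g: "g permutes {1..n}" and h: "h permutes {1..n}" and eq: "cycle_type g = cycle_type h"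
  shows "\<exists>p. p permutes {1..n} \<and> h = p \<circ> g \<circ> inv' p"
proof -
  note Og = orbits_partition[OF g] and Oh = orbits_partition[OF h]
  note pg = permutes_permutation[OF g] and ph = permutes_permutation[OF h]
  have "image_mset card (mset_set (orbits g)) = image_mset card (mset_set (orbits h))"
    using eq unfolding cycle_type_def by (metis mset_sorted_list_of_multiset rev_rev_ident)
  then have "count (image_mset card (mset_set (orbits g))) k = count (image_mset card (mset_set (orbits h))) k" for k
    by simp
  moreover have "count (image_mset card (mset_set X)) k = card {P \<in> X. card P = k}"
    if "finite X" for X :: "nat set set" and k
  proof -
    have "count (image_mset card (mset_set X)) k = (\<Sum>P\<in>card -` {k} \<inter> X. 1)"
      using that by (simp add: count_image_mset)
    then show ?thesis by (simp add: vimage_def Int_def conj_commute)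
  qed
  ultimately have "card {P \<in> orbits g. card P = k} = card {P \<in> orbits h. card P = k}" for k
    by simp
  then obtain F where F: "bij_betw F (orbits g) (orbits h)" "\<And>P. P \<in> orbits g \<Longrightarrow> card (F P) = card P"
    using ex_bij_same_fibres[of "orbits g" "orbits h" card card] by auto
  have FP: "F P \<in> orbits h" if "P \<in> orbits g" for P using bij_betwE[OF F(1)] that by blast
  define a where "a P = (SOME x. x \<in> P)" for P :: "nat set"
  have a: "a P \<in> P" if "P \<in> orbits g \<or> P \<in> orbits h" for P
    unfolding a_def using that Og(3) Oh(3) by (auto intro: some_in_eq[THEN iffD2])
  have og: "orbit g (a P) = P" if "P \<in> orbits g" for P using Og(4) a that by blast
  have oh: "orbit h (a (F P)) = F P" if "P \<in> orbits g" for P using Oh(4) a FP that by blast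
  define k where "k x = funpow_dist g (a (orbit g x)) x" for x
  have k: "(g ^^ k x) (a (orbit g x)) = x" and Px: "orbit g x \<in> orbits g" if "x \<in> {1..n}" for x
  proof -
    show P: "orbit g x \<in> orbits g" using that by (simp add: orbits_def)
    have "x \<in> orbit g (a (orbit g x))" unfolding og[OF P] by (rule permutation_self_in_orbit[OF pg])
    then show "(g ^^ k x) (a (orbit g x)) = x" unfolding k_def by (rule funpow_dist_prop)
  qed
  \<comment> \<open>This makes the conjugating map independent of the exponent used to reach a
    point, and yields both commutation and surjectivity.\<close>
  have transfer: "(h ^^ m) (a (F P)) = (h ^^ m') (a (F P))"
    if "P \<in> orbits g" "(g ^^ m) (a P) = (g ^^ m') (a P)" for P m m'
    using that funpow_eq_iff_mod_card_orbit[OF pg, of m "a P" m']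
      funpow_eq_iff_mod_card_orbit[OF ph, of m "a (F P)" m'] og oh F(2) by simp
  define f where "f x = (h ^^ k x) (a (F (orbit g x)))" for x
  have comm: "f (g x) = h (f x)" if x: "x \<in> {1..n}" for x
  proof -
    have gx: "g x \<in> {1..n}" using permutes_in_image[OF g] x by blast
    have o: "orbit g (g x) = orbit g x" by (rule permutation_orbit_step[OF pg])
    have "(g ^^ k (g x)) (a (orbit g x)) = (g ^^ Suc (k x)) (a (orbit g x))"
      using k[OF gx] k[OF x] o by simp
    from transfer[OF Px[OF x] this] show ?thesis by (simp add: f_def o)
  qed
  have "f ` {1..n} = {1..n}"
  proof (intro equalityI subsetI)
    fix y assume "y \<in> f ` {1..n}"
    then obtain x where x: "x \<in> {1..n}" "y = f x" by blast
    have "a (F (orbit g x)) \<in> {1..n}" using a[of "F (orbit g x)"] FP[OF Px[OF x(1)]] Oh(1) by blast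
    moreover have "(h ^^ m) z \<in> {1..n}" if "z \<in> {1..n}" for m z
      using that permutes_in_image[OF h] by (induction m) auto
    ultimately show "y \<in> {1..n}" by (simp only: x f_def)
  next
    fix y assume y: "y \<in> {1..n}"
    then have "orbit h y \<in> orbits h" by (simp add: orbits_def)
    then obtain P where P: "P \<in> orbits g" "orbit h y = F P"
      using F(1) by (auto simp: bij_betw_def)
    have "y \<in> orbit h (a (F P))"
      using permutation_self_in_orbit[OF ph, of y] by (simp add: oh[OF P(1)] P(2))
    then obtain m where m: "y = (h ^^ m) (a (F P))" using orbit_altdef_permutation[OF ph] by auto
    define x where "x = (g ^^ m) (a P)"
    have xP: "x \<in> P" unfolding x_def using orbit_altdef_permutation[OF pg, of "a P"] og[OF P(1)] by auto
    then have x: "x \<in> {1..n}" "orbit g x = P" using Og(1,4) P(1) by auto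
    have "(g ^^ k x) (a P) = (g ^^ m) (a P)" using k[OF x(1)] by (simp add: x(2) x_def[symmetric])
    from transfer[OF P(1) this] have "f x = y" by (simp add: f_def x(2) m)
    then show "y \<in> f ` {1..n}" using x(1) by blast
  qed
  moreover from this have "inj_on f {1..n}" by (intro finite_surj_inj) auto
  ultimately have bij: "bij_betw f {1..n} {1..n}" by (simp add: bij_betw_def)
  define p where "p = (\<lambda>i. if i \<in> {1..n} then f i else i)"
  have p: "p permutes {1..n}" unfolding p_def by (rule permutes_of_bij_betw[OF bij])
  have "p \<circ> g = h \<circ> p"
  proof
    fix x
    show "(p \<circ> g) x = (h \<circ> p) x"
    proof (cases "x \<in> {1..n}")
      case True
      then have "g x \<in> {1..n}" using permutes_in_image[OF g] by blast
      then show ?thesis using True comm[OF True] by (simp add: p_def)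
    next
      case False
      then show ?thesis using permutes_not_in[OF g False] permutes_not_in[OF h False] by (auto simp: p_def)
    qed
  qed
  then have "p \<circ> g \<circ> inv' p = h \<circ> (p \<circ> inv' p)" by (simp add: o_assoc)
  then have "h = p \<circ> g \<circ> inv' p" using permutes_inv_o(1)[OF p] by simp
  then show ?thesis using p by blast
qed

text \<open>Indexing by partitions bounds the number of indicators by the number of symmetrizers,
  which is the bound \<open>complete_family\<close> asks for.\<close>

definition class_indicators :: "((nat \<Rightarrow> nat) \<Rightarrow> complex) set" where
  "class_indicators = (\<lambda>mu g. if g permutes {1..n} \<and> cycle_type g = mu then 1 else 0) ` partitions n"

lemma class_function_in_span:
  assumes f: "f \<in> galg"
    and conj: "\<And>p g. p permutes {1..n} \<Longrightarrow> g permutes {1..n} \<Longrightarrow> f (p \<circ> g \<circ> inv' p) = f g"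
  shows "f \<in> complex_vector.span class_indicators"
proof -
  let ?ind = "\<lambda>mu g. if g permutes {1..n} \<and> cycle_type g = mu then 1 else 0 :: complex"
  define F where "F mu = f (SOME g. g permutes {1..n} \<and> cycle_type g = mu)" for mu
  have F: "F (cycle_type g) = f g" if g: "g permutes {1..n}" for g
  proof -
    let ?h = "SOME h. h permutes {1..n} \<and> cycle_type h = cycle_type g"
    have h: "?h permutes {1..n} \<and> cycle_type ?h = cycle_type g"
      by (rule someI[of _ g]) (simp add: g)
    then obtain p where p: "p permutes {1..n}" "g = p \<circ> ?h \<circ> inv' p"
      using cycle_type_eq_conjugate[of ?h g] g by auto
    have "f (p \<circ> ?h \<circ> inv' p) = f ?h" using conj[OF p(1)] h by blast
    then show ?thesis unfolding F_def using p(2) by simp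
  qed
  have "f = (\<Sum>mu\<in>partitions n. F mu *\<^sub>C ?ind mu)"
  proof
    fix g
    show "f g = (\<Sum>mu\<in>partitions n. F mu *\<^sub>C ?ind mu) g"
    proof (cases "g permutes {1..n}")
      case True
      have "(\<Sum>mu\<in>partitions n. F mu *\<^sub>C ?ind mu) g
          = (\<Sum>mu\<in>partitions n. if mu = cycle_type g then F mu else 0)"
        unfolding fun_apply_simps using True by (intro sum.cong) auto
      also have "\<dots> = f g"
        using cycle_type_partition[OF True] finite_partitions F[OF True] by simp
      finally show ?thesis ..
    next
      case False
      then show ?thesis using f by (simp add: fun_apply_simps functions_on_def sym_group_carrier)
    qed
  qed
  also have "\<dots> \<in> complex_vector.span class_indicators"
    by (intro complex_vector.span_sum complex_vector.span_scale complex_vector.span_base)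
      (auto simp: class_indicators_def)
  finally show ?thesis .
qed

end

sublocale sym_grp \<subseteq> complete_family "sym_group n" "partitions n" young_of class_indicators
proof unfold_locales
  show "finite (partitions n)" by (rule finite_partitions)
  show "primitive (young_of lam)" if "lam \<in> partitions n" for lam
    using that by (rule primitive_young_of)
  show "young_of lam \<star> x \<star> young_of mu = 0"
    if lm: "lam \<in> partitions n" "mu \<in> partitions n" "lam \<noteq> mu" and x: "x \<in> galg" for lam mu x
  proof (rule ccontr)
    assume "young_of lam \<star> x \<star> young_of mu \<noteq> 0"
    then obtain p where "p permutes {1..n}" "\<forall>i\<in>{1..n}. row_of n mu (p i) = row_of n lam i"
      using young_orthogonal[OF tableau_row_col_of[OF lm(1)] tableau_row_col_of[OF lm(2)] x] by blast
    then show False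
      using tableaux_same_rows[OF lm(1,2) tableau_row_col_of[OF lm(1)] tableau_row_col_of[OF lm(2)]] lm(3)
      by blast
  qed
  show "finite class_indicators" by (simp add: class_indicators_def finite_partitions)
  show "card class_indicators \<le> card (partitions n)"
    unfolding class_indicators_def by (rule card_image_le[OF finite_partitions])
  show "f \<in> complex_vector.span class_indicators"
    if f: "f \<in> galg" and conj: "\<And>h x. h \<in> carrier (sym_group n) \<Longrightarrow> x \<in> carrier (sym_group n) \<Longrightarrow>
        f (h \<otimes>\<^bsub>sym_group n\<^esub> x \<otimes>\<^bsub>sym_group n\<^esub> inv\<^bsub>sym_group n\<^esub> h) = f x" for f
  proof (rule class_function_in_span[OF f])
    fix p g assume "p permutes {1..n}" "g permutes {1..n}"
    then show "f (p \<circ> g \<circ> inv' p) = f g"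
      using conj[of p g] by (simp add: sym_group_carrier sym_group_mult inv_sym)
  qed
qed

section \<open>The signed conjugation action on involutions\<close>

lemma even_card_Un_of_bij_betw:
  assumes "finite A" "bij_betw f A B" "A \<inter> B = {}"
  shows "even (card (A \<union> B))"
proof -
  have "finite B" "card A = card B" using assms bij_betw_finite bij_betw_same_card by auto
  then show ?thesis using assms by (simp add: card_Un_disjoint)
qed

lemma i1_card:
  assumes w: "w permutes {1..n}"
  shows "i1 n g w = card {i \<in> {1..n}. i < w i \<and> g (w i) < g i}"
  unfolding i1_def
proof (rule bij_betw_same_card[of fst])
  have win: "w i \<in> {1..n}" if "i \<in> {1..n}" for i using permutes_in_image[OF w] that by blast
  show "bij_betw fst {(i, j). i \<in> {1..n} \<and> j \<in> {1..n} \<and> i < j \<and> w i = j \<and> g j < g i}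
      {i \<in> {1..n}. i < w i \<and> g (w i) < g i}"
    unfolding bij_betw_def
  proof
    show "fst ` {(i, j). i \<in> {1..n} \<and> j \<in> {1..n} \<and> i < j \<and> w i = j \<and> g j < g i}
        = {i \<in> {1..n}. i < w i \<and> g (w i) < g i}"
      using win by (auto simp: image_iff simp del: atLeastAtMost_iff)
  qed (auto simp: inj_on_def)
qed

lemma minus_one_power_card:
  assumes "finite A"
  shows "(-1) ^ card {i \<in> A. P i} = (\<Prod>i\<in>A. if P i then -1 else 1 :: complex)"
  using assms by (simp add: prod.If_cases Int_def)

text \<open>For an involution \<open>w\<close>, each 2-cycle is represented by its smaller element;
  the sign becomes a product over 2-cycles, which can be reindexed.\<close>

lemma i1_sign_prod:
  assumes w: "w permutes {1..n}"
  shows "(-1) ^ i1 n g w = (\<Prod>i\<in>{i \<in> {1..n}. i < w i}. if g (w i) < g i then -1 else 1 :: complex)"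
proof -
  have "{i \<in> {1..n}. i < w i \<and> g (w i) < g i} = {i \<in> {i \<in> {1..n}. i < w i}. g (w i) < g i}" by auto
  then have eq: "i1 n g w = card {i \<in> {i \<in> {1..n}. i < w i}. g (w i) < g i}"
    unfolding i1_card[OF w] by (rule arg_cong)
  show ?thesis unfolding eq by (rule minus_one_power_card) simp
qed

text \<open>The cocycle identity: a pair of \<open>w\<close> is reversed by
  \<open>a \<circ> b\<close> iff exactly one of two things happens, that \<open>b\<close> reverses
  it or that \<open>a\<close> reverses the image pair, which is a pair of the conjugated
  involution.\<close>

lemma i1_comp:
  assumes w: "w permutes {1..n}" "\<And>i. w (w i) = i"
    and a: "a permutes {1..n}" and b: "b permutes {1..n}"
  shows "(-1) ^ i1 n (a \<circ> b) w = (-1) ^ i1 n b w * ((-1) ^ i1 n a (b \<circ> w \<circ> inv' b) :: complex)"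
proof -
  define w' where "w' = b \<circ> w \<circ> inv' b"
  have w': "w' permutes {1..n}" unfolding w'_def by (intro permutes_compose permutes_inv w b)
  note ib = permutes_inverses[OF b]
  have w'b: "w' (b i) = b (w i)" for i by (simp add: w'_def ib)
  have w'w': "w' (w' j) = j" for j by (simp add: w'_def ib w)
  have wib: "inv' b (w' j) = w (inv' b j)" for j by (simp add: w'_def ib)
  have bin: "b i \<in> {1..n} \<longleftrightarrow> i \<in> {1..n}" "inv' b i \<in> {1..n} \<longleftrightarrow> i \<in> {1..n}" for i
    using permutes_in_image[OF b] permutes_in_image[OF permutes_inv[OF b]] by blast+
  have win: "w i \<in> {1..n} \<longleftrightarrow> i \<in> {1..n}" "w' i \<in> {1..n} \<longleftrightarrow> i \<in> {1..n}" for i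
    using permutes_in_image[OF w(1)] permutes_in_image[OF w'] by blast+
  have binj: "b i = b j \<longleftrightarrow> i = j" and ainj: "a i = a j \<longleftrightarrow> i = j" for i j
    using permutes_inj[OF a] permutes_inj[OF b] by (auto simp: inj_eq)
  have ibinj: "inv' b i = inv' b j \<longleftrightarrow> i = j" for i j
    using permutes_inj[OF permutes_inv[OF b]] by (simp add: inj_eq)
  let ?H = "\<lambda>w. {i \<in> {1..n}. i < w i}"
  let ?s = "\<lambda>g i. if g (w i) < g i then -1 else 1 :: complex"
  \<comment> \<open>\<open>b\<close> need not carry the smaller element of a pair to the smaller
    element of the image pair, so \<open>\<phi>\<close> and \<open>\<psi>\<close> pick the smaller
    one explicitly.\<close>
  define \<phi> where "\<phi> i = (if b i < b (w i) then b i else b (w i))" for i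
  define \<psi> where "\<psi> j = (if inv' b j < inv' b (w' j) then inv' b j else inv' b (w' j))" for j
  have "(\<Prod>i\<in>?H w. if a (w' (\<phi> i)) < a (\<phi> i) then -1 else 1 :: complex)
      = (\<Prod>j\<in>?H w'. if a (w' j) < a j then -1 else 1)"
  proof (rule prod.reindex_bij_witness[of _ \<psi> \<phi>])
    fix i assume i: "i \<in> ?H w"
    then have ne: "b i \<noteq> b (w i)" by (auto simp: binj)
    show "\<psi> (\<phi> i) = i"
      using i ne by (auto simp: \<phi>_def \<psi>_def w'b ib w)
    show "\<phi> i \<in> ?H w'"
      using i ne bin(1)[of i] bin(1)[of "w i"] win(1)[of i] by (auto simp: \<phi>_def w'b w)
  next
    fix j assume j: "j \<in> ?H w'"
    then have ne: "inv' b j \<noteq> inv' b (w' j)" by (auto simp: ibinj)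
    show "\<phi> (\<psi> j) = j"
      using j ne by (auto simp: \<phi>_def \<psi>_def wib[symmetric] ib w'w')
    show "\<psi> j \<in> ?H w"
      using j ne bin(2)[of j] bin(2)[of "w' j"] win(2)[of j] by (auto simp: \<psi>_def wib[symmetric] w'w')
  qed auto
  note reindex = this
  have s: "?s (a \<circ> b) i = ?s b i * (if a (w' (\<phi> i)) < a (\<phi> i) then -1 else 1)" if "i \<in> ?H w" for i
  proof -
    have "b i \<noteq> b (w i)" "a (b i) \<noteq> a (b (w i))" using that by (auto simp: binj ainj)
    then show ?thesis by (auto simp: \<phi>_def w'b w)
  qed
  have "(\<Prod>i\<in>?H w. ?s (a \<circ> b) i)
      = (\<Prod>i\<in>?H w. ?s b i * (if a (w' (\<phi> i)) < a (\<phi> i) then -1 else 1))"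
    by (rule prod.cong[OF refl s])
  also have "\<dots> = (\<Prod>i\<in>?H w. ?s b i) * (\<Prod>j\<in>?H w'. if a (w' j) < a j then -1 else 1)"
    unfolding prod.distrib reindex ..
  finally show ?thesis
    unfolding i1_sign_prod[OF w(1)] w'_def[symmetric] i1_sign_prod[OF w'] .
qed

text \<open>Preserving the order of the pairs, \<open>q\<close> permutes the set \<open>H\<close> of
  their smaller elements, and commuting with \<open>w\<close> it acts in the same way on the larger
  ones. Its sign is therefore a square.\<close>

lemma sign_eq_one_of_order_preserving:
  fixes w q :: "nat \<Rightarrow> nat"
  assumes w: "w permutes {1..n}" "\<And>i. w (w i) = i" and q: "q permutes {1..n}"
    and comm: "\<And>i. q (w i) = w (q i)" and fix_: "\<And>i. w i = i \<Longrightarrow> q i = i"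
    and pos: "\<And>i. i \<in> {1..n} \<Longrightarrow> i < w i \<Longrightarrow> q i < q (w i)"
  shows "sign q = 1"
proof -
  define H where "H = {i \<in> {1..n}. i < w i}"
  have qin: "q i \<in> {1..n} \<longleftrightarrow> i \<in> {1..n}" and win: "w i \<in> {1..n} \<longleftrightarrow> i \<in> {1..n}" for i
    using permutes_in_image[OF q] permutes_in_image[OF w(1)] by blast+
  have qH: "q i \<in> H" if "i \<in> H" for i
    using that pos[of i] qin[of i] by (simp add: H_def comm)
  have wH: "w i \<notin> H" if "i \<in> H" for i using that less_asym[of i "w i"] by (simp add: H_def w)
  have cases: "i \<in> H \<or> w i \<in> H \<or> w i = i" for i
  proof (cases "i \<in> {1..n}")
    case True
    then show ?thesis using win[of i] by (cases i "w i" rule: linorder_cases) (simp_all add: H_def w)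
  qed (use permutes_not_in[OF w(1)] in auto)
  have "finite H" by (simp add: H_def)
  have "inj_on q H" using permutes_inj[OF q] by (rule inj_on_subset) simp
  moreover from this have "q ` H = H" using qH \<open>finite H\<close> by (intro endo_inj_surj) auto
  ultimately have bij: "bij_betw q H H" by (simp add: bij_betw_def)
  define h where "h = (\<lambda>i. if i \<in> H then q i else i)"
  have "h permutes H" unfolding h_def by (rule permutes_of_bij_betw[OF bij])
  then have h: "h permutes {1..n}" by (rule permutes_subset) (auto simp: H_def)
  have hin: "h i = q i" if "i \<in> H" for i using that by (simp add: h_def)
  have hout: "h i = i" if "i \<notin> H" for i using that by (simp add: h_def)
  \<comment> \<open>\<open>h\<close> is the action on the smaller elements and
    \<open>w \<circ> h \<circ> w\<close> its mirror image on the larger ones.\<close>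
  have "q = h \<circ> (w \<circ> h \<circ> w)"
  proof
    fix i
    consider "i \<in> H" | "w i \<in> H" | "w i = i" "i \<notin> H" using cases by blast
    then show "q i = (h \<circ> (w \<circ> h \<circ> w)) i"
    proof cases
      case 1
      then show ?thesis by (simp add: hout[OF wH] w hin)
    next
      case 2
      have "w (q (w i)) = q i" using comm[of "w i"] by (simp add: w)
      moreover have "q i \<notin> H" using wH[OF qH[OF 2]] calculation by simp
      ultimately show ?thesis by (simp add: hin[OF 2] hout)
    next
      case 3
      then show ?thesis by (simp add: hout fix_)
    qed
  qed
  then have "sign q = sign h * (sign w * sign h * sign w)"
    using sym_grp.sign_mult[of _ n] w(1) h by (simp add: permutes_compose)
  also have "\<dots> = (sign h * sign h) * (sign w * sign w)" by (simp add: ac_simps del: sign_idempotent)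
  finally show ?thesis by simp
qed

text \<open>Induction on the number of reversed pairs: composing \<open>q\<close> with the
  transposition of one reversed pair repairs that pair, leaves the others alone and changes the
  sign.\<close>

lemma sign_eq_i1:
  assumes w: "w permutes {1..n}" "\<And>i. w (w i) = i" and q: "q permutes {1..n}"
    and comm: "\<And>i. q (w i) = w (q i)" and fix_: "\<And>i. w i = i \<Longrightarrow> q i = i"
  shows "sign q = (-1) ^ i1 n q w"
  using q comm fix_
proof (induction "i1 n q w" arbitrary: q)
  case 0
  have "{i \<in> {1..n}. i < w i \<and> q (w i) < q i} = {}"
    using 0(1) i1_card[OF w(1), of q] by simp
  then have pos: "q i < q (w i)" if i: "i \<in> {1..n}" "i < w i" for i
    using i permutes_inj[OF 0(2)] by (metis (mono_tags, lifting) empty_iff inj_eq linorder_neqE_nat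
        mem_Collect_eq order_less_irrefl)
  have "sign q = 1" by (rule sign_eq_one_of_order_preserving[OF w 0(2-4) pos])
  then show ?case using 0(1) by simp
next
  case (Suc m)
  define Dq where "Dq = (\<lambda>q :: nat \<Rightarrow> nat. {i \<in> {1..n}. i < w i \<and> q (w i) < q i})"
  have D: "i1 n q w = card (Dq q)" for q unfolding Dq_def by (rule i1_card[OF w(1)])
  then obtain i where i: "i \<in> Dq q" using Suc(2) by (metis card.empty ex_in_conv nat.distinct(1))
  then have i': "i \<in> {1..n}" "i < w i" "q (w i) < q i" by (auto simp: Dq_def)
  let ?t = "transpose i (w i)"
  have t: "?t permutes {1..n}"
    using i' permutes_in_image[OF w(1), of i] by (simp add: permutes_swap_id)
  define q' where "q' = q \<circ> ?t"
  have tw: "?t (w j) = w (?t j)" for j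
    using w(2) by (simp add: transpose_def) (metis w(2))
  have q'q: "q' j = q j" if "j \<noteq> i" "j \<noteq> w i" for j using that by (simp add: q'_def)
  have q'i: "q' i = q (w i)" "q' (w i) = q i" by (simp_all add: q'_def)
  \<comment> \<open>Distinct pairs of an involution are disjoint, so only the pair of
    \<open>i\<close> is affected.\<close>
  have "Dq q' = Dq q - {i}"
  proof (rule Set.set_eqI)
    fix j
    have "j = i \<or> j = w i \<or> j \<noteq> i \<and> j \<noteq> w i \<and> w j \<noteq> i \<and> w j \<noteq> w i" by (metis w(2))
    then show "j \<in> Dq q' \<longleftrightarrow> j \<in> Dq q - {i}"
    proof (elim disjE)
      assume "j = w i"
      then show ?thesis using i' by (simp add: Dq_def w(2))
    next
      assume "j = i"
      then show ?thesis using i' by (simp add: Dq_def q'i)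
    next
      assume "j \<noteq> i \<and> j \<noteq> w i \<and> w j \<noteq> i \<and> w j \<noteq> w i"
      then show ?thesis by (simp add: Dq_def q'q)
    qed
  qed
  then have m: "m = i1 n q' w" using Suc(2) i D by (simp add: Dq_def)
  have q': "q' permutes {1..n}" unfolding q'_def using t Suc(3) by (rule permutes_compose)
  have "sign q' = (-1) ^ i1 n q' w"
  proof (rule Suc(1)[OF m q'])
    show "q' (w j) = w (q' j)" for j by (simp add: q'_def tw Suc(4))
    show "q' j = j" if "w j = j" for j
    proof -
      have "j \<noteq> i" "j \<noteq> w i" using that i'(2) w(2) by auto
      then show ?thesis using q'q Suc(5)[OF that] by simp
    qed
  qed
  moreover have "sign q' = - sign q"
    using sym_grp.sign_mult[OF Suc(3) t] i'(2) by (simp add: q'_def sign_swap_id)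
  ultimately show ?case using m Suc(2) by (metis power_Suc minus_mult_commute mult_minus1 minus_minus)
qed

context sym_grp
begin

lemma involutions_fixD:
  assumes "w \<in> involutions_fix n k"
  shows "w permutes {1..n}" "w (w i) = i" "card {i \<in> {1..n}. w i = i} = k"
proof -
  show w: "w permutes {1..n}" and "card {i \<in> {1..n}. w i = i} = k"
    using assms by (auto simp: involutions_fix_def sym_group_carrier)
  have "w = inv' w" using assms inv_sym[OF w] by (simp add: involutions_fix_def)
  then show "w (w i) = i" using permutes_inverses(1)[OF w, of i] by simp
qed

lemma involutions_fixI:
  assumes w: "w permutes {1..n}" and ww: "\<And>i. w (w i) = i" and "card {i \<in> {1..n}. w i = i} = k"
  shows "w \<in> involutions_fix n k"
proof -
  have "inv' w = w" by (rule inv_unique_comp) (auto simp: ww)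
  then show ?thesis using assms by (simp add: involutions_fix_def sym_group_carrier inv_sym)
qed

lemma involutions_iff: "w \<in> involutions n \<longleftrightarrow> w permutes {1..n} \<and> (\<forall>i. w (w i) = i)"
  by (auto simp: involutions_def sym_group_carrier fun_eq_iff)

lemma Union_involutions_fix: "(\<Union>k. involutions_fix n k) = involutions n"
proof (intro equalityI subsetI)
  fix w assume "w \<in> involutions n"
  then have "w \<in> involutions_fix n (card {i \<in> {1..n}. w i = i})"
    by (intro involutions_fixI) (auto simp: involutions_iff)
  then show "w \<in> (\<Union>k. involutions_fix n k)" by blast
qed (auto simp: involutions_iff dest: involutions_fixD)

lemma involutions_fix_disjoint: "w \<in> involutions_fix n k \<Longrightarrow> w \<in> involutions_fix n l \<Longrightarrow> k = l"
  using involutions_fixD(3) by blast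

lemma finite_involutions: "finite (involutions n)"
  by (rule finite_subset[OF _ finite_permutations[of "{1..n}"]]) (auto simp: involutions_iff)

lemma involutions_fix_nonempty: "involutions_fix n k \<noteq> {} \<longleftrightarrow> k \<le> n \<and> even (n - k)"
proof
  assume "involutions_fix n k \<noteq> {}"
  then obtain w where w: "w permutes {1..n}" "\<And>i. w (w i) = i" "card {i \<in> {1..n}. w i = i} = k"
    using involutions_fixD by blast
  let ?A = "{i \<in> {1..n}. i < w i}" and ?B = "{i \<in> {1..n}. w i < i}" and ?F = "{i \<in> {1..n}. w i = i}"
  have win: "w i \<in> {1..n} \<longleftrightarrow> i \<in> {1..n}" for i using permutes_in_image[OF w(1)] by blast
  have "bij_betw w ?A ?B"
    by (rule bij_betw_byWitness[where f' = w]) (use win in \<open>auto simp: w(2) image_subset_iff\<close>)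
  then have "even (card (?A \<union> ?B))" by (intro even_card_Un_of_bij_betw) auto
  moreover have "card {1..n} = card (?A \<union> ?B) + card ?F"
  proof -
    have "{1..n} = (?A \<union> ?B) \<union> ?F" by (auto simp: not_less)
    then have "card {1..n} = card ((?A \<union> ?B) \<union> ?F)" by (rule arg_cong)
    also have "\<dots> = card (?A \<union> ?B) + card ?F" by (rule card_Un_disjoint) auto
    finally show ?thesis .
  qed
  moreover define m where "m = card (?A \<union> ?B)"
  ultimately have "n = m + k" "even m" using w(3) by simp_all
  then show "k \<le> n \<and> even (n - k)" by simp
next
  assume k: "k \<le> n \<and> even (n - k)"
  \<comment> \<open>Exchanges 1 and 2, 3 and 4, and so on up to the even number
    \<open>n - k\<close>, and fixes the last \<open>k\<close> points.\<close>
  define w where "w i = (if i \<in> {1..n - k} then if odd i then Suc i else i - 1 else i)" for i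
  have odd_step: "Suc i \<in> {1..n - k}" if "i \<in> {1..n - k}" "odd i" for i
  proof -
    have "i \<noteq> n - k" using k that(2) by auto
    then show ?thesis using that(1) by auto
  qed
  have even_step: "i - 1 \<in> {1..n - k}" "odd (i - 1)" "Suc (i - 1) = i"
    if "i \<in> {1..n - k}" "even i" for i
  proof -
    have "i \<noteq> 1" using that(2) by auto
    then have "i \<ge> 2" using that(1) by auto
    then show "i - 1 \<in> {1..n - k}" "odd (i - 1)" "Suc (i - 1) = i" using that by auto
  qed
  have ww: "w (w i) = i" for i
  proof (cases "i \<in> {1..n - k}")
    case True
    then show ?thesis
      using odd_step[OF True] even_step[OF True] by (cases "odd i") (simp_all only: w_def if_True if_False even_Suc simp_thms diff_Suc_1)
  qed (simp only: w_def if_False)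
  have "w permutes {1..n}"
    unfolding permutes_def
  proof (intro conjI allI impI)
    show "w i = i" if "i \<notin> {1..n}" for i using that by (auto simp: w_def)
    show "\<exists>!j. w j = i" for i by (metis ww)
  qed
  moreover have "{i \<in> {1..n}. w i = i} = {n - k<..n}"
    by (auto simp: w_def One_nat_def)
  then have "card {i \<in> {1..n}. w i = i} = k" using k by simp
  ultimately show "involutions_fix n k \<noteq> {}" using involutions_fixI[OF _ ww] by blast
qed

section \<open>The signed representation on a conjugation-invariant set of involutions\<close>

definition conj_invariant :: "(nat \<Rightarrow> nat) set \<Rightarrow> bool" where
  "conj_invariant M \<longleftrightarrow> M \<subseteq> involutions n \<and> (\<forall>g w. g permutes {1..n} \<longrightarrow> w \<in> M \<longrightarrow> g \<circ> w \<circ> inv' g \<in> M)"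

lemma conj_permutes: "g permutes {1..n} \<Longrightarrow> w permutes {1..n} \<Longrightarrow> g \<circ> w \<circ> inv' g permutes {1..n}"
  by (intro permutes_compose permutes_inv)

lemma conj_invariant_fix: "conj_invariant (involutions_fix n k)"
  unfolding conj_invariant_def
proof (intro conjI allI impI)
  show "involutions_fix n k \<subseteq> involutions n" using Union_involutions_fix by blast
  fix g w assume g: "g permutes {1..n}" and w: "w \<in> involutions_fix n k"
  note w = involutions_fixD[OF w]
  show "g \<circ> w \<circ> inv' g \<in> involutions_fix n k"
  proof (rule involutions_fixI)
    show "g \<circ> w \<circ> inv' g permutes {1..n}" by (rule conj_permutes[OF g w(1)])
    show "(g \<circ> w \<circ> inv' g) ((g \<circ> w \<circ> inv' g) i) = i" for i
      by (simp add: permutes_inverses[OF g] w)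
    have "bij_betw (inv' g) {i \<in> {1..n}. (g \<circ> w \<circ> inv' g) i = i} {i \<in> {1..n}. w i = i}"
    proof (rule bij_betw_byWitness[where f' = g])
      have "w (inv' g i) = inv' g i" if "(g \<circ> w \<circ> inv' g) i = i" for i
        using arg_cong[OF that, of "inv' g"] by (simp add: permutes_inverses[OF g])
      then show "inv' g ` {i \<in> {1..n}. (g \<circ> w \<circ> inv' g) i = i} \<subseteq> {i \<in> {1..n}. w i = i}"
        using permutes_in_image[OF permutes_inv[OF g]] by auto
      show "g ` {i \<in> {1..n}. w i = i} \<subseteq> {i \<in> {1..n}. (g \<circ> w \<circ> inv' g) i = i}"
        using permutes_in_image[OF g] by (auto simp: permutes_inverses[OF g])
    qed (simp_all add: permutes_inverses[OF g])
    from bij_betw_same_card[OF this] show "card {i \<in> {1..n}. (g \<circ> w \<circ> inv' g) i = i} = k"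
      by (simp only: w(3))
  qed
qed

lemma conj_invariant_involutions: "conj_invariant (involutions n)"
  unfolding conj_invariant_def
proof (intro conjI allI impI subset_refl)
  fix g w assume g: "g permutes {1..n}" and "w \<in> involutions n"
  then obtain k where "w \<in> involutions_fix n k" using Union_involutions_fix by blast
  then have "g \<circ> w \<circ> inv' g \<in> involutions_fix n k"
    using conj_invariant_fix g unfolding conj_invariant_def by blast
  then show "g \<circ> w \<circ> inv' g \<in> involutions n" using Union_involutions_fix by blast
qed

lemma conj_invariant_iff:
  assumes M: "conj_invariant M" and g: "g permutes {1..n}"
  shows "inv' g \<circ> w \<circ> g \<in> M \<longleftrightarrow> w \<in> M"
proof
  have e: "g \<circ> (inv' g \<circ> w \<circ> g) \<circ> inv' g = w"
    by (rule ext) (simp add: permutes_inverses[OF g])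
  show "w \<in> M" if "inv' g \<circ> w \<circ> g \<in> M"
  proof -
    have "g \<circ> (inv' g \<circ> w \<circ> g) \<circ> inv' g \<in> M" using M g that unfolding conj_invariant_def by blast
    then show ?thesis by (simp only: e)
  qed
  show "inv' g \<circ> w \<circ> g \<in> M" if "w \<in> M"
  proof -
    have "inv' g \<circ> w \<circ> inv' (inv' g) \<in> M"
      using M permutes_inv[OF g] that unfolding conj_invariant_def by blast
    then show ?thesis by (simp only: permutes_inv_inv[OF g])
  qed
qed

lemma act_rho1:
  assumes "g permutes {1..n}"
  shows "act (rho1 n M) g f w = (-1) ^ i1 n (inv' g) w * f (inv' g \<circ> w \<circ> g)"
  by (simp add: rho1_def inv_sym[OF assms])

lemma rep_space_rho1 [simp]: "rep_space (rho1 n M) = functions_on M"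
  by (simp add: rho1_def)

text \<open>The set enters \<open>rho1\<close> only through the underlying space, so computations
  pass freely between the whole model and its parts.\<close>

lemma alg_act_rho1: "alg_act (rho1 n M) = alg_act (rho1 n M')"
  by (simp add: alg_act_def rho1_def fun_eq_iff)

text \<open>Multiplicativity is the cocycle identity \<open>i1_comp\<close> on \<open>M\<close>;
  outside \<open>M\<close> both sides vanish by conjugation invariance.\<close>

lemma rho1_representation:
  assumes M: "conj_invariant M"
  shows "group_representation (sym_group n) (rho1 n M)"
proof
  let ?R = "rho1 n M"
  show "complex_vector.subspace (rep_space ?R)" by (simp add: subspace_functions_on)
  show "linear_map_on (rep_space ?R) (rep_space ?R) (act ?R g)" if "g \<in> carrier (sym_group n)" for g
  proof -
    have g: "g permutes {1..n}" using that by (simp add: sym_group_carrier)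
    show ?thesis
      unfolding linear_map_on_def
    proof (intro conjI ballI allI funcsetI)
      fix f assume "f \<in> rep_space ?R"
      then show "act ?R g f \<in> rep_space ?R"
        using conj_invariant_iff[OF M g] by (simp add: functions_on_def act_rho1[OF g])
      show "act ?R g (f + h) = act ?R g f + act ?R g h" for h
        by (rule ext) (simp add: act_rho1[OF g] distrib_left)
      show "act ?R g (a *\<^sub>C f) = a *\<^sub>C act ?R g f" for a
        by (rule ext) (simp add: act_rho1[OF g] fun_apply_simps)
    qed
  qed
  show "act ?R \<one>\<^bsub>sym_group n\<^esub> f = f" if f: "f \<in> rep_space ?R" for f
  proof
    fix w
    have "{(i, j). i \<in> {1..n} \<and> j \<in> {1..n} \<and> i < j \<and> w i = j \<and> id i > id j} = {}" by auto
    then have "i1 n id w = 0" unfolding i1_def by (simp only: card.empty)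
    then show "act ?R \<one>\<^bsub>sym_group n\<^esub> f w = f w"
      by (simp add: sym_group_one act_rho1[OF permutes_id])
  qed
  show "act ?R (g \<otimes>\<^bsub>sym_group n\<^esub> h) f = act ?R g (act ?R h f)"
    if gh: "g \<in> carrier (sym_group n)" "h \<in> carrier (sym_group n)" and f: "f \<in> rep_space ?R" for g h f
  proof
    fix w
    have g: "g permutes {1..n}" and h: "h permutes {1..n}" using gh by (simp_all add: sym_group_carrier)
    have inv: "inv' (g \<circ> h) = inv' h \<circ> inv' g"
      by (rule o_inv_distrib) (use g h permutes_bij in auto)
    have e: "inv' (g \<circ> h) \<circ> w \<circ> (g \<circ> h) = inv' h \<circ> (inv' g \<circ> w \<circ> g) \<circ> h"
      unfolding inv by (simp add: o_assoc)
    have L: "act ?R (g \<circ> h) f w = (-1) ^ i1 n (inv' h \<circ> inv' g) w * f (inv' h \<circ> (inv' g \<circ> w \<circ> g) \<circ> h)"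
      unfolding act_rho1[OF permutes_compose[OF h g]] by (simp only: e) (simp only: inv)
    have R: "act ?R g (act ?R h f) w
        = (-1) ^ i1 n (inv' g) w * ((-1) ^ i1 n (inv' h) (inv' g \<circ> w \<circ> g) * f (inv' h \<circ> (inv' g \<circ> w \<circ> g) \<circ> h))"
      unfolding act_rho1[OF g] act_rho1[OF h] ..
    show "act ?R (g \<otimes>\<^bsub>sym_group n\<^esub> h) f w = act ?R g (act ?R h f) w"
    proof (cases "w \<in> M")
      case True
      then have "w \<in> involutions n" using M unfolding conj_invariant_def by blast
      then have w: "w permutes {1..n}" "\<And>i. w (w i) = i" by (simp_all add: involutions_iff)
      show ?thesis
        unfolding sym_group_mult L R
          i1_comp[OF w permutes_inv[OF h] permutes_inv[OF g], unfolded permutes_inv_inv[OF g]]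
        by simp
    next
      case False
      then have "inv' h \<circ> (inv' g \<circ> w \<circ> g) \<circ> h \<notin> M"
        by (simp add: conj_invariant_iff[OF M g] conj_invariant_iff[OF M h])
      then show ?thesis using f unfolding sym_group_mult L R by (simp add: functions_on_def)
    qed
  qed
qed

lemma rho1_decomposes:
  "rep_iso (sym_group n) (rho1 n (involutions n)) (direct_sum_rep UNIV (\<lambda>k. rho1 n (involutions_fix n k)))"
proof (rule rep_iso_direct_sumI[where \<phi> = "\<lambda>_ f. f"])
  show "group_representation (sym_group n) (rho1 n (involutions n))"
    by (rule rho1_representation[OF conj_invariant_involutions])
  show "group_representation (sym_group n) (rho1 n (involutions_fix n k))" for k
    by (rule rho1_representation[OF conj_invariant_fix])
  show "linear_map_on (rep_space (rho1 n (involutions_fix n k))) (rep_space (rho1 n (involutions n))) (\<lambda>f. f)" for k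
    using Union_involutions_fix by (auto simp: linear_map_on_def functions_on_def)
  show "act (rho1 n (involutions_fix n k)) g f = act (rho1 n (involutions n)) g f" for k g f
    by (simp add: rho1_def)
next
  fix J :: "nat set" and f
  assume J: "finite J" and f: "\<And>k. k \<in> J \<Longrightarrow> f k \<in> rep_space (rho1 n (involutions_fix n k))"
    and sum: "(\<Sum>k\<in>J. f k) = 0"
  show "\<forall>k\<in>J. f k = 0"
  proof (intro ballI ext)
    fix k w assume k: "k \<in> J"
    show "f k w = 0 w"
    proof (cases "w \<in> involutions_fix n k")
      case True
      have "(\<Sum>l\<in>J. f l) w = (\<Sum>l\<in>J. if l = k then f k w else 0)"
        unfolding sum_fun_apply using f involutions_fix_disjoint[OF True]
        by (intro sum.cong) (auto simp: functions_on_def)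
      then show ?thesis using sum J k by simp
    qed (use f[OF k] in \<open>simp add: functions_on_def\<close>)
  qed
next
  fix r assume r: "r \<in> rep_space (rho1 n (involutions n))"
  let ?f = "\<lambda>k w. if w \<in> involutions_fix n k then r w else 0"
  \<comment> \<open>No permutation has more than \<open>n\<close> fixed points, so only finitely
    many parts contribute although the index set is infinite.\<close>
  have "r = (\<Sum>k\<in>{..n}. ?f k)"
  proof
    fix w
    show "r w = (\<Sum>k\<in>{..n}. ?f k) w"
    proof (cases "w \<in> involutions n")
      case True
      then obtain l where l: "w \<in> involutions_fix n l" using Union_involutions_fix by blast
      then have "l \<le> n" using involutions_fix_nonempty by blast
      have "w \<in> involutions_fix n k \<longleftrightarrow> k = l" for k
        using l involutions_fix_disjoint by blast
      then show ?thesis using \<open>l \<le> n\<close> by (simp add: sum_fun_apply)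
    next
      case False
      then have "w \<notin> involutions_fix n k" for k using Union_involutions_fix by blast
      then show ?thesis using r False by (simp add: functions_on_def sum_fun_apply)
    qed
  qed
  then show "\<exists>J f. finite J \<and> J \<subseteq> UNIV \<and>
      (\<forall>k\<in>J. f k \<in> rep_space (rho1 n (involutions_fix n k))) \<and> r = (\<Sum>k\<in>J. f k)"
    by (intro exI[of _ "{..n}"] exI[of _ ?f]) (auto simp: functions_on_def)
qed

end

section \<open>The model contains every irreducible representation\<close>

text \<open>Rows are numbered from 0, so row \<open>2 m\<close> is paired with row
  \<open>2 m + 1\<close>; the bottom cell of a column of odd length stays fixed.\<close>

definition row_partner :: "(nat \<times> nat) set \<Rightarrow> nat \<times> nat \<Rightarrow> nat \<times> nat" where
  "row_partner D = (\<lambda>(x, y). if odd x then (x - 1, y) else if (Suc x, y) \<in> D then (Suc x, y) else (x, y))"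

lemma row_partner_in:
  assumes "\<And>x y x'. (x, y) \<in> D \<Longrightarrow> x' < x \<Longrightarrow> (x', y) \<in> D" "z \<in> D"
  shows "row_partner D z \<in> D"
  using assms(2) assms(1)[of "fst z" "snd z" "fst z - 1"]
  by (cases z) (auto simp: row_partner_def elim: oddE)

lemma row_partner_idem:
  assumes "z \<in> D"
  shows "row_partner D (row_partner D z) = z"
  using assms by (cases z) (auto simp: row_partner_def dest: odd_pos)

definition (in sym_grp) pairing :: "(nat \<times> nat) set \<Rightarrow> (nat \<Rightarrow> nat) \<Rightarrow> (nat \<Rightarrow> nat) \<Rightarrow> nat \<Rightarrow> nat" where
  "pairing D r c i = (if i \<in> {1..n}
     then inv_into {1..n} (\<lambda>i. (r i, c i)) (row_partner D (r i, c i)) else i)"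

locale reading = sym_grp +
  fixes lam :: "nat list" and r c :: "nat \<Rightarrow> nat"
  assumes lam: "lam \<in> partitions n" and reading: "reading_tableau n lam r c"
begin

abbreviation D :: "(nat \<times> nat) set" where "D \<equiv> diagram lam"
abbreviation w :: "nat \<Rightarrow> nat" where "w \<equiv> pairing D r c"

lemma tableau_rc: "tableau n D r c"
  using reading by (simp add: reading_tableau_def)

lemma rows_increase: "i \<in> {1..n} \<Longrightarrow> j \<in> {1..n} \<Longrightarrow> r i < r j \<Longrightarrow> i < j"
  using reading unfolding reading_tableau_def by blast

lemma cell_eq_iff: "i \<in> {1..n} \<Longrightarrow> j \<in> {1..n} \<Longrightarrow> r i = r j \<Longrightarrow> c i = c j \<Longrightarrow> i = j"
  by (rule tableau_inj[OF tableau_rc])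

lemma cell_in: "i \<in> {1..n} \<Longrightarrow> (r i, c i) \<in> D"
  by (rule tableau_cell[OF tableau_rc])

lemma pairing_cell:
  assumes i: "i \<in> {1..n}"
  shows "w i \<in> {1..n}" "(r (w i), c (w i)) = row_partner D (r i, c i)"
proof -
  have "row_partner D (r i, c i) \<in> D"
    by (rule row_partner_in[OF diagram_column_closed[OF lam] cell_in[OF i]])
  then have im: "row_partner D (r i, c i) \<in> (\<lambda>i. (r i, c i)) ` {1..n}"
    using tableau_rc by (simp add: tableau_def bij_betw_def)
  have w: "w i = inv_into {1..n} (\<lambda>i. (r i, c i)) (row_partner D (r i, c i))"
    using i by (simp only: pairing_def if_True)
  show "w i \<in> {1..n}" unfolding w by (rule inv_into_into[OF im])
  show "(r (w i), c (w i)) = row_partner D (r i, c i)" unfolding w by (rule f_inv_into_f[OF im])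
qed

lemma pairing_outside: "i \<notin> {1..n} \<Longrightarrow> w i = i"
  by (simp only: pairing_def if_False)

lemma pairing_col: "c (w i) = c i"
proof (cases "i \<in> {1..n}")
  case True
  then show ?thesis using pairing_cell(2)[OF True] by (simp add: row_partner_def split: if_splits)
qed (simp add: pairing_outside)

lemma pairing_odd: "i \<in> {1..n} \<Longrightarrow> odd (r i) \<Longrightarrow> r (w i) = r i - 1"
  using pairing_cell(2)[of i] by (simp add: row_partner_def)

lemma pairing_even: "i \<in> {1..n} \<Longrightarrow> even (r i) \<Longrightarrow> (Suc (r i), c i) \<in> D \<Longrightarrow> r (w i) = Suc (r i)"
  using pairing_cell(2)[of i] by (simp add: row_partner_def)

lemma pairing_fixed:
  assumes "i \<in> {1..n}"
  shows "w i = i \<longleftrightarrow> even (r i) \<and> (Suc (r i), c i) \<notin> D"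
proof -
  have "w i = i \<longleftrightarrow> row_partner D (r i, c i) = (r i, c i)"
    using pairing_cell[OF assms] cell_eq_iff[OF pairing_cell(1)[OF assms] assms] by auto
  then show ?thesis by (auto simp: row_partner_def elim: oddE)
qed

lemma pairing_involution: "w (w i) = i"
proof (cases "i \<in> {1..n}")
  case True
  note 1 = pairing_cell[OF True]
  note 2 = pairing_cell[OF 1(1)]
  have "(r (w (w i)), c (w (w i))) = (r i, c i)"
    unfolding 2(2) 1(2) by (rule row_partner_idem[OF cell_in[OF True]])
  then show ?thesis using cell_eq_iff[OF 2(1) True] by simp
qed (simp add: pairing_outside)

lemma pairing_permutes: "w permutes {1..n}"
  unfolding permutes_def using pairing_outside pairing_involution by metis

lemma column_downset: "{x. (x, y) \<in> D} = {..<card {x. (x, y) \<in> D}}"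
proof -
  have "r ` {i \<in> {1..n}. c i = y} = {x. (x, y) \<in> D}"
    using cell_in by (auto elim!: tableau_cellE[OF tableau_rc] simp del: atLeastAtMost_iff)
  then show ?thesis
    using tableau_column(1)[OF tableau_rc, of y] tableau_col_card[OF tableau_rc, of y] by simp
qed

text \<open>The fixed points are the bottom cells of the odd columns, so the column function maps
  them bijectively onto the set of odd columns.\<close>

lemma pairing_in_fix: "w \<in> involutions_fix n (odd_columns lam)"
proof (rule involutions_fixI[OF pairing_permutes pairing_involution])
  let ?L = "length (conjugate lam)"
  define l where "l y = card {x. (x, y) \<in> D}" for y
  have D_iff: "(x, y) \<in> D \<longleftrightarrow> x < l y" for x y
    using column_downset[of y, folded l_def] by blast
  have fixed: "w i = i \<longleftrightarrow> even (r i) \<and> Suc (r i) = l (c i)" if i: "i \<in> {1..n}" for i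
    using pairing_fixed[OF i] cell_in[OF i] by (auto simp: D_iff)
  have "bij_betw c {i \<in> {1..n}. w i = i} {y. y < ?L \<and> odd (l y)}"
    unfolding bij_betw_def
  proof
    show "inj_on c {i \<in> {1..n}. w i = i}"
    proof (rule inj_onI)
      fix i j assume ij: "i \<in> {i \<in> {1..n}. w i = i}" "j \<in> {i \<in> {1..n}. w i = i}" "c i = c j"
      then have i: "i \<in> {1..n}" "w i = i" and j: "j \<in> {1..n}" "w j = j" by blast+
      have "Suc (r i) = Suc (r j)" using fixed[OF i(1)] fixed[OF j(1)] i(2) j(2) ij(3) by simp
      then show "i = j" using cell_eq_iff[OF i(1) j(1) _ ij(3)] by simp
    qed
    show "c ` {i \<in> {1..n}. w i = i} = {y. y < ?L \<and> odd (l y)}"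
    proof (intro equalityI subsetI)
      fix y assume "y \<in> c ` {i \<in> {1..n}. w i = i}"
      then obtain i where i: "i \<in> {1..n}" "w i = i" "y = c i" by blast
      have "y < ?L" using diagram_less_length_conjugate[OF cell_in[OF i(1)]] i(3) by simp
      moreover have "odd (l y)" using fixed[OF i(1)] i(2,3) by (metis even_Suc)
      ultimately show "y \<in> {y. y < ?L \<and> odd (l y)}" by blast
    next
      fix y assume y: "y \<in> {y. y < ?L \<and> odd (l y)}"
      \<comment> \<open>The bottom cell of a column of length \<open>l y\<close> is in row
        \<open>l y - 1\<close>, an even number when the length is odd.\<close>
      then have ly: "l y - 1 < l y" "even (l y - 1)" "Suc (l y - 1) = l y"
        using odd_pos[of "l y"] by auto
      then have "(l y - 1, y) \<in> D" by (simp only: D_iff)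
      then obtain i where i: "i \<in> {1..n}" "r i = l y - 1" "c i = y" by (rule tableau_cellE[OF tableau_rc])
      then have "w i = i" using fixed[OF i(1)] ly by simp
      then show "y \<in> c ` {i \<in> {1..n}. w i = i}" using i by blast
    qed
  qed
  then have "card {i \<in> {1..n}. w i = i} = card {y. y < ?L \<and> odd (l y)}"
    by (rule bij_betw_same_card)
  also have "{y. y < ?L \<and> odd (l y)} = {y. y < ?L \<and> odd (conjugate lam ! y)}"
    using conjugate_nth by (auto simp: l_def)
  also have "card \<dots> = odd_columns lam"
    unfolding odd_columns_def by (rule length_filter_conv_card[symmetric])
  finally show "card {i \<in> {1..n}. w i = i} = odd_columns lam" .
qed

text \<open>The involution \<open>v = p\<inverse> w p\<close> is also
  \<open>q w q\<inverse>\<close>. The first form controls the rows of its values, the second shows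
  that it preserves columns; together they force \<open>v = w\<close>.\<close>

lemma row_col_commute:
  assumes p: "p \<in> stab r" and q: "q \<in> stab c" and comm: "\<And>i. w (p (q i)) = p (q (w i))"
  shows "q (w i) = w (q i)" "w (p i) = p (w i)"
proof -
  note pp = stab_perm[OF p] and pq = stab_perm[OF q]
  define v where "v i = inv' p (w (p i))" for i
  have vq: "v (q i) = q (w i)" for i
    using comm[of i] permutes_inverses(2)[OF pp] by (simp add: v_def)
  have vin: "v i \<in> {1..n}" if "i \<in> {1..n}" for i
    using that permutes_in_image[OF pp] permutes_in_image[OF permutes_inv[OF pp]]
      permutes_in_image[OF pairing_permutes] unfolding v_def by blast
  have vv: "v (v i) = i" for i
    by (simp add: v_def permutes_inverses[OF pp] pairing_involution)
  have vc: "c (v i) = c i" for i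
  proof -
    have "v i = q (w (inv' q i))" using vq[of "inv' q i"] permutes_inverses(1)[OF pq] by simp
    then show ?thesis
      using stab_eq[OF q] stab_eq[OF inv_stab[OF q]] pairing_col by simp
  qed
  have vr: "r (v i) = r (w (p i))" for i
    using stab_eq[OF inv_stab[OF p]] by (simp add: v_def)
  have pin: "p i \<in> {1..n}" if "i \<in> {1..n}" for i using permutes_in_image[OF pp] that by blast
  \<comment> \<open>For an odd row, the partner is always one row up, and \<open>p\<close> does not
    change the row.\<close>
  have odd_case: "v i = w i" if i: "i \<in> {1..n}" "odd (r i)" for i
  proof (rule cell_eq_iff[OF vin[OF i(1)] pairing_cell(1)[OF i(1)]])
    show "r (v i) = r (w i)"
      using pairing_odd[OF i] pairing_odd[OF pin[OF i(1)]] i(2) stab_eq[OF p, of i] by (simp add: vr)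
    show "c (v i) = c (w i)" by (simp add: vc pairing_col)
  qed
  have vw: "v i = w i" for i
  proof (cases "i \<in> {1..n}")
    case i: True
    show ?thesis
    proof (cases "odd (r i)")
      case even: False
      show ?thesis
      proof (cases "(Suc (r i), c i) \<in> D")
        case True
        \<comment> \<open>The partner \<open>w i\<close> lies in an odd row, so the previous case
          applies to it; both maps being involutions, they also agree at \<open>i\<close>.\<close>
        then have "r (w i) = Suc (r i)" using pairing_even[OF i] even by simp
        then have "v (w i) = w (w i)" using odd_case[OF pairing_cell(1)[OF i]] even by simp
        then have "v (w i) = i" by (simp add: pairing_involution)
        then show ?thesis using vv[of "w i"] by simp
      next
        case False
        then have "w i = i" using pairing_fixed[OF i] even by simp
        \<comment> \<open>Here \<open>i\<close> is the bottom cell of an odd column: moving to the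
          next row within that column would leave the diagram.\<close>
        have "r (v i) = r i"
        proof (cases "(Suc (r i), c (p i)) \<in> D")
          case True
          then have "r (v i) = Suc (r i)"
            using pairing_even[OF pin[OF i]] even stab_eq[OF p, of i] by (simp add: vr)
          then show ?thesis using cell_in[OF vin[OF i]] False by (simp add: vc)
        next
          case no: False
          then have "w (p i) = p i" using pairing_fixed[OF pin[OF i]] even stab_eq[OF p, of i] by simp
          then show ?thesis using stab_eq[OF p, of i] by (simp add: vr)
        qed
        then have "v i = i" using cell_eq_iff[OF vin[OF i] i] vc by simp
        then show ?thesis using \<open>w i = i\<close> by simp
      qed
    qed (use odd_case[OF i] in blast)
  next
    case False
    then show ?thesis
      using permutes_not_in[OF pp False] permutes_not_in[OF permutes_inv[OF pp] False]
      by (simp add: v_def pairing_outside)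
  qed
  show "q (w i) = w (q i)" using vq[of i] vw by simp
  show "w (p i) = p (w i)"
    using vw[of i] permutes_inverses(1)[OF pp, of "w (p i)"] by (simp add: v_def)
qed

text \<open>Two paired entries share a column, so they lie in different rows, the smaller one higher
  up by the reading order. A row permutation keeps the rows, hence also this order.\<close>

lemma i1_row_stab:
  assumes p: "p \<in> stab r"
  shows "i1 n p w = 0"
proof -
  have "p i < p (w i)" if i: "i \<in> {1..n}" "i < w i" for i
  proof -
    have ne: "r i \<noteq> r (w i)" using cell_eq_iff[OF i(1) pairing_cell(1)[OF i(1)]] pairing_col i(2) by fastforce
    have "\<not> r (w i) < r i" using rows_increase[OF pairing_cell(1)[OF i(1)] i(1)] i(2) by linarith
    then have "r (p i) < r (p (w i))" using ne by (simp add: stab_eq[OF p])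
    moreover have "p i \<in> {1..n}" "p (w i) \<in> {1..n}"
      using permutes_in_image[OF stab_perm[OF p]] i(1) pairing_cell(1)[OF i(1)] by blast+
    ultimately show ?thesis using rows_increase by blast
  qed
  then have "{i \<in> {1..n}. i < w i \<and> p (w i) < p i} = {}" by (auto dest: less_asym simp del: atLeastAtMost_iff)
  then show ?thesis unfolding i1_card[OF pairing_permutes] by (simp only: card.empty)
qed

text \<open>Commuting with \<open>w\<close>, the permutation \<open>q\<close> sends a fixed point of
  \<open>w\<close> to a fixed point in the same column, and a column has at most one: its bottom
  cell.\<close>

lemma col_stab_fixes:
  assumes q: "q \<in> stab c" and comm: "\<And>i. q (w i) = w (q i)" and fixed: "w i = i"
  shows "q i = i"
proof (cases "i \<in> {1..n}")
  case True
  have qi: "q i \<in> {1..n}" using permutes_in_image[OF stab_perm[OF q]] True by blast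
  have "w (q i) = q i" using comm[of i] fixed by simp
  then have 1: "(Suc (r (q i)), c i) \<notin> D" using pairing_fixed[OF qi] stab_eq[OF q] by simp
  have 2: "(Suc (r i), c i) \<notin> D" using pairing_fixed[OF True] fixed by simp
  have 3: "(r i, c i) \<in> D" by (rule cell_in[OF True])
  have 4: "(r (q i), c i) \<in> D" using cell_in[OF qi] stab_eq[OF q] by simp
  have down: "(x', y) \<in> D" if "(x, y) \<in> D" "x' \<le> x" for x x' y
    using diagram_column_closed[OF lam that(1), of x'] that by (cases "x' = x") auto
  have "r (q i) = r i"
    using down[OF 3, of "Suc (r (q i))"] down[OF 4, of "Suc (r i)"] 1 2 by linarith
  then show ?thesis using cell_eq_iff[OF qi True] stab_eq[OF q] by simp
qed (use permutes_not_in[OF stab_perm[OF q]] in blast)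

text \<open>By \<open>i1_comp\<close> the exponent of \<open>(p q)\<inverse>\<close> splits into the
  contributions of \<open>p\<close> and \<open>q\<close>. The first is 0 by
  \<open>i1_row_stab\<close>; the second gives the sign of \<open>q\<close> by
  \<open>sign_eq_i1\<close> and cancels it.\<close>

lemma pairing_sign:
  assumes p: "p \<in> stab r" and q: "q \<in> stab c" and fixed: "inv' (p \<circ> q) \<circ> w \<circ> (p \<circ> q) = w"
  shows "of_int (sign q) * (-1) ^ i1 n (inv' (p \<circ> q)) w = (1 :: complex)"
proof -
  note pp = stab_perm[OF p] and pq = stab_perm[OF q]
  have c0: "w (p (q i)) = p (q (w i))" for i
  proof -
    have 1: "inv' (p \<circ> q) (w (p (q i))) = w i" using fun_cong[OF fixed, of i] by (simp only: o_apply)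
    have "(p \<circ> q) (inv' (p \<circ> q) (w (p (q i)))) = w (p (q i))"
      by (rule permutes_inverses(1)[OF permutes_compose[OF pq pp]])
    then show ?thesis unfolding 1 by (simp only: o_apply)
  qed
  have comm: "q (w i) = w (q i)" "w (p i) = p (w i)" for i
    by (rule row_col_commute[OF p q], rule c0)+
  have inv: "inv' (p \<circ> q) = inv' q \<circ> inv' p"
    by (rule o_inv_distrib[OF permutes_bij[OF pp] permutes_bij[OF pq]])
  have wp: "inv' p \<circ> w \<circ> inv' (inv' p) = w"
    unfolding permutes_inv_inv[OF pp]
    by (rule ext) (simp only: o_apply comm(2) permutes_inverses(2)[OF pp])
  have comm': "inv' q (w i) = w (inv' q i)" for i
  proof -
    have "q (w (inv' q i)) = w i" using comm(1)[of "inv' q i"] by (simp add: permutes_inverses(1)[OF pq])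
    then have "inv' q (w i) = inv' q (q (w (inv' q i)))" by simp
    then show ?thesis by (simp only: permutes_inverses(2)[OF pq])
  qed
  have "sign (inv' q) = (-1) ^ i1 n (inv' q) w"
  proof (rule sign_eq_i1[OF pairing_permutes pairing_involution permutes_inv[OF pq] comm'])
    show "inv' q i = i" if "w i = i" for i
      by (rule col_stab_fixes[OF inv_stab[OF q] comm' that])
  qed
  then have sq: "of_int (sign q) = ((-1) ^ i1 n (inv' q) w :: complex)"
    by (simp add: sign_inverse'[OF pq])
  have "(-1) ^ i1 n (inv' (p \<circ> q)) w = ((-1) ^ i1 n (inv' q) w :: complex)"
    unfolding inv i1_comp[OF pairing_permutes pairing_involution permutes_inv[OF pq] permutes_inv[OF pp]] wp
      i1_row_stab[OF inv_stab[OF p]] by simp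
  then show ?thesis using sign_mult_self[of q] by (simp only: sq)
qed

lemma young_nonzero_on_model:
  "\<exists>f\<in>functions_on (involutions_fix n (odd_columns lam)). alg_act (rho1 n M) (young r c) f \<noteq> 0"
proof -
  let ?R = "rho1 n (involutions_fix n (odd_columns lam))"
  have R: "group_representation (sym_group n) ?R" by (rule rho1_representation[OF conj_invariant_fix])
  interpret R: group_representation "sym_group n" ?R by fact
  have d: "delta w \<in> rep_space ?R" using pairing_in_fix by simp
  have cs: "alg_act ?R (col_sum c) (delta w) = (\<Sum>q\<in>stab c. of_int (sign q) *\<^sub>C act ?R q (delta w))"
    unfolding col_sum_delta alg_act_sum_left alg_act_scale_left
    by (intro sum.cong refl) (simp add: alg_act_delta stab_carrier)
  have in1: "act ?R q (delta w) \<in> rep_space ?R" if "q \<in> stab c" for q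
    by (rule R.act_in[OF stab_carrier[OF that] d])
  have "alg_act ?R (row_sum r \<star> col_sum c) (delta w)
      = (\<Sum>p\<in>stab r. act ?R p (alg_act ?R (col_sum c) (delta w)))"
    unfolding alg_act_conv[OF R d] row_sum_delta alg_act_sum_left
    by (intro sum.cong refl) (simp add: alg_act_delta stab_carrier)
  also have "\<dots> = (\<Sum>p\<in>stab r. \<Sum>q\<in>stab c. of_int (sign q) *\<^sub>C act ?R (p \<circ> q) (delta w))"
  proof (rule sum.cong[OF refl])
    fix p assume p: "p \<in> stab r"
    have "act ?R p (alg_act ?R (col_sum c) (delta w))
        = (\<Sum>q\<in>stab c. act ?R p (of_int (sign q) *\<^sub>C act ?R q (delta w)))"
      unfolding cs by (rule R.act_sum[OF stab_carrier[OF p]])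
        (rule complex_vector.subspace_scale[OF R.subspace in1])
    also have "\<dots> = (\<Sum>q\<in>stab c. of_int (sign q) *\<^sub>C act ?R (p \<circ> q) (delta w))"
    proof (rule sum.cong[OF refl])
      fix q assume q: "q \<in> stab c"
      show "act ?R p (of_int (sign q) *\<^sub>C act ?R q (delta w)) = of_int (sign q) *\<^sub>C act ?R (p \<circ> q) (delta w)"
        unfolding R.act_scale[OF stab_carrier[OF p] in1[OF q]]
          R.act_mult[OF stab_carrier[OF p] stab_carrier[OF q] d, symmetric, unfolded sym_group_mult] ..
    qed
    finally show "act ?R p (alg_act ?R (col_sum c) (delta w))
        = (\<Sum>q\<in>stab c. of_int (sign q) *\<^sub>C act ?R (p \<circ> q) (delta w))" .
  qed
  finally have "alg_act ?R (row_sum r \<star> col_sum c) (delta w) w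
      = (\<Sum>p\<in>stab r. \<Sum>q\<in>stab c. of_int (sign q) * act ?R (p \<circ> q) (delta w) w)"
    by (simp only: fun_apply_simps)
  \<comment> \<open>Writing the terms as natural numbers excludes cancellation: the pair
    \<open>p = q = id\<close> alone makes the sum nonzero.\<close>
  also have "\<dots> = (\<Sum>p\<in>stab r. \<Sum>q\<in>stab c. of_nat (if inv' (p \<circ> q) \<circ> w \<circ> (p \<circ> q) = w then 1 else 0))"
  proof (rule sum.cong[OF refl], rule sum.cong[OF refl])
    fix p q assume p: "p \<in> stab r" and q: "q \<in> stab c"
    have "act ?R (p \<circ> q) (delta w) w
        = (-1) ^ i1 n (inv' (p \<circ> q)) w * delta w (inv' (p \<circ> q) \<circ> w \<circ> (p \<circ> q))"
      by (rule act_rho1[OF permutes_compose[OF stab_perm[OF q] stab_perm[OF p]]])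
    then show "of_int (sign q) * act ?R (p \<circ> q) (delta w) w
        = of_nat (if inv' (p \<circ> q) \<circ> w \<circ> (p \<circ> q) = w then 1 else 0)"
      using pairing_sign[OF p q] by (simp add: delta_def)
  qed
  also have "\<dots> = of_nat (\<Sum>p\<in>stab r. \<Sum>q\<in>stab c. if inv' (p \<circ> q) \<circ> w \<circ> (p \<circ> q) = w then 1 else 0)"
    by (simp only: of_nat_sum)
  also have "\<dots> \<noteq> 0"
  proof -
    define F where "F p q = (if inv' (p \<circ> q) \<circ> w \<circ> (p \<circ> q) = w then 1 else 0 :: nat)"
      for p q :: "nat \<Rightarrow> nat"
    have "F id id \<noteq> 0" by (simp add: F_def)
    then have "(\<Sum>p\<in>stab r. \<Sum>q\<in>stab c. F p q) \<noteq> 0"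
      unfolding sum_eq_0_iff[OF finite_stab] by (metis id_stab)
    then have "(\<Sum>p\<in>stab r. \<Sum>q\<in>stab c. if inv' (p \<circ> q) \<circ> w \<circ> (p \<circ> q) = w then 1 else 0 :: nat) \<noteq> 0"
      unfolding F_def .
    then show ?thesis by (subst of_nat_eq_0_iff)
  qed
  finally have "alg_act ?R (row_sum r \<star> col_sum c) (delta w) \<noteq> 0" by (metis zero_fun_apply)
  then have "\<exists>f\<in>rep_space ?R. alg_act ?R (young r c) f \<noteq> 0"
    by (rule young_acts_nonzero[OF tableau_rc R d])
  then show ?thesis
    unfolding rep_space_rho1 alg_act_rho1[of "involutions_fix n (odd_columns lam)" M] .
qed

end

section \<open>Decomposition of the involution model\<close>

context sym_grp
begin

definition model_vector :: "nat list \<Rightarrow> (nat \<Rightarrow> nat) \<Rightarrow> complex" where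
  "model_vector lam = (SOME f. f \<in> functions_on (involutions_fix n (odd_columns lam)) \<and>
     alg_act (rho1 n (involutions n)) (young_of lam) f \<noteq> 0)"

lemma model_vector:
  assumes "lam \<in> partitions n"
  shows "model_vector lam \<in> functions_on (involutions_fix n (odd_columns lam))"
    "alg_act (rho1 n M) (young_of lam) (model_vector lam) \<noteq> 0"
proof -
  interpret reading n lam "row_of n lam" "col_of n lam"
    by unfold_locales (use assms reading_tableau in auto)
  have "\<exists>f. f \<in> functions_on (involutions_fix n (odd_columns lam)) \<and>
     alg_act (rho1 n (involutions n)) (young_of lam) f \<noteq> 0"
    using young_nonzero_on_model by blast
  from someI_ex[OF this]
  have 1: "model_vector lam \<in> functions_on (involutions_fix n (odd_columns lam)) \<and>
     alg_act (rho1 n (involutions n)) (young_of lam) (model_vector lam) \<noteq> 0"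
    unfolding model_vector_def .
  then show "model_vector lam \<in> functions_on (involutions_fix n (odd_columns lam))" by blast
  from 1 show "alg_act (rho1 n M) (young_of lam) (model_vector lam) \<noteq> 0"
    unfolding alg_act_rho1[of M "involutions n"] by blast
qed

lemma functions_on_mono: "X \<subseteq> Y \<Longrightarrow> functions_on X \<subseteq> functions_on Y"
  by (auto simp: functions_on_def)

lemma functions_on_involutions_fix: "functions_on (involutions_fix n k) \<subseteq> functions_on (involutions n)"
  by (rule functions_on_mono) (use Union_involutions_fix in blast)

lemma model_vector_involutions:
  assumes "lam \<in> partitions n"
  shows "model_vector lam \<in> rep_space (rho1 n (involutions n))"
  unfolding rep_space_rho1 by (rule subsetD[OF functions_on_involutions_fix model_vector(1)[OF assms]])

lemma card_involutions: "card (involutions n) = card {g \<in> carrier (sym_group n). inv\<^bsub>sym_group n\<^esub> g = g}"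
proof -
  have "{g \<in> carrier (sym_group n). inv\<^bsub>sym_group n\<^esub> g = g} = involutions n"
  proof (intro equalityI subsetI)
    fix g assume g: "g \<in> {g \<in> carrier (sym_group n). inv\<^bsub>sym_group n\<^esub> g = g}"
    then have p: "g permutes {1..n}" by (simp add: sym_group_carrier)
    then have "inv' g = g" using inv_sym[OF p] g by simp
    then have "g (g i) = i" for i using permutes_inverses(1)[OF p, of i] by simp
    then show "g \<in> involutions n" using p by (simp add: involutions_iff)
  next
    fix g assume "g \<in> involutions n"
    then have g: "g permutes {1..n}" "\<And>i. g (g i) = i" by (auto simp: involutions_iff)
    have "inv' g = g" by (rule inv_unique_comp) (auto simp: g)
    then show "g \<in> {g \<in> carrier (sym_group n). inv\<^bsub>sym_group n\<^esub> g = g}"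
      using g by (simp add: sym_group_carrier inv_sym)
  qed
  then show ?thesis by simp
qed

text \<open>Here the count of dimensions takes effect: the dimension of the whole model equals the
  sum of the dimensions of the ideals.\<close>

lemma involutions_expand:
  assumes "f \<in> functions_on (involutions n)"
  shows "\<exists>y. (\<forall>lam\<in>partitions n. y lam \<in> left_ideal (young_of lam)) \<and>
    f = (\<Sum>lam\<in>partitions n. alg_act (rho1 n (involutions n)) (y lam) (model_vector lam))"
proof (rule model_decomposition[OF rho1_representation[OF conj_invariant_involutions]
      rep_space_rho1 finite_involutions])
  show "card (involutions n) \<le> card {g \<in> carrier (sym_group n). inv\<^bsub>sym_group n\<^esub> g = g}"
    by (simp only: card_involutions)
  show "f \<in> rep_space (rho1 n (involutions n))" using assms by (simp only: rep_space_rho1)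
qed (rule model_vector_involutions model_vector(2); assumption)+

text \<open>The term of \<open>lam\<close> is supported on the involutions with
  \<open>odd_columns lam\<close> fixed points, so restricting the expansion in the whole model
  leaves exactly the partitions with \<open>k\<close> odd columns.\<close>

lemma involutions_fix_expand:
  assumes f: "f \<in> functions_on (involutions_fix n k)"
  shows "\<exists>y. (\<forall>lam\<in>partitions n. y lam \<in> left_ideal (young_of lam)) \<and>
    f = (\<Sum>lam\<in>{lam \<in> partitions n. odd_columns lam = k}.
      alg_act (rho1 n (involutions_fix n k)) (y lam) (model_vector lam))"
proof -
  have "f \<in> functions_on (involutions n)" by (rule subsetD[OF functions_on_involutions_fix f])
  then obtain y where y: "\<forall>lam\<in>partitions n. y lam \<in> left_ideal (young_of lam)"
    "f = (\<Sum>lam\<in>partitions n. alg_act (rho1 n (involutions n)) (y lam) (model_vector lam))"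
    using involutions_expand by blast
  let ?g = "\<lambda>lam. alg_act (rho1 n (involutions n)) (y lam) (model_vector lam)"
  let ?I = "{lam \<in> partitions n. odd_columns lam = k}"
  have g: "?g lam \<in> functions_on (involutions_fix n (odd_columns lam))" if "lam \<in> partitions n" for lam
    using alg_act_in[OF rho1_representation[OF conj_invariant_fix], of "model_vector lam" "odd_columns lam"]
      model_vector(1)[OF that]
    unfolding alg_act_rho1[of "involutions n" "involutions_fix n (odd_columns lam)"] by simp
  have "f = (\<Sum>lam\<in>?I. ?g lam)"
  proof
    fix w
    show "f w = (\<Sum>lam\<in>?I. ?g lam) w"
    proof (cases "w \<in> involutions_fix n k")
      case True
      have "?g lam w = 0" if "lam \<in> partitions n - ?I" for lam
        using g[of lam] that involutions_fix_disjoint[OF True] by (auto simp: functions_on_def)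
      then have "(\<Sum>lam\<in>?I. ?g lam w) = (\<Sum>lam\<in>partitions n. ?g lam w)"
        by (intro sum.mono_neutral_left finite_partitions) auto
      moreover have "f w = (\<Sum>lam\<in>partitions n. ?g lam w)"
        using fun_cong[OF y(2), of w] by (simp only: sum_fun_apply)
      ultimately show ?thesis by (simp only: sum_fun_apply)
    next
      case False
      have "?g lam w = 0" if "lam \<in> ?I" for lam
        using g[of lam] that False by (simp add: functions_on_def)
      then have "(\<Sum>lam\<in>?I. ?g lam) w = 0" by (simp add: sum_fun_apply)
      then show ?thesis using f False by (simp add: functions_on_def)
    qed
  qed
  then show ?thesis
    using y(1) unfolding alg_act_rho1[of "involutions_fix n k" "involutions n"] by blast
qed

text \<open>Each summand is mapped to its left ideal by an isomorphism \<open>T lam\<close> and from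
  there into the model by acting on \<open>model_vector lam\<close>.\<close>

lemma rho1_fix_decomposes:
  "rep_iso (sym_group n) (rho1 n (involutions_fix n k))
    (direct_sum_rep {lam \<in> partitions n. odd_columns lam = k} (irrep_of_partition n))"
proof -
  let ?R = "rho1 n (involutions_fix n k)" and ?I = "{lam \<in> partitions n. odd_columns lam = k}"
  have R: "group_representation (sym_group n) ?R" by (rule rho1_representation[OF conj_invariant_fix])
  have "\<forall>lam\<in>?I. \<exists>T. linear_map_on (rep_space (irrep_of_partition n lam)) (left_ideal (young_of lam)) T \<and>
      bij_betw T (rep_space (irrep_of_partition n lam)) (left_ideal (young_of lam)) \<and>
      (\<forall>g\<in>carrier (sym_group n). \<forall>x\<in>rep_space (irrep_of_partition n lam).
        T (act (irrep_of_partition n lam) g x) = act regular_rep g (T x))"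
    using irrep_of_partition_iso by (auto simp: rep_iso_def)
  then obtain T where T: "\<And>lam. lam \<in> ?I \<Longrightarrow>
        linear_map_on (rep_space (irrep_of_partition n lam)) (left_ideal (young_of lam)) (T lam)"
      "\<And>lam. lam \<in> ?I \<Longrightarrow> bij_betw (T lam) (rep_space (irrep_of_partition n lam)) (left_ideal (young_of lam))"
      "\<And>lam g x. lam \<in> ?I \<Longrightarrow> g \<in> carrier (sym_group n) \<Longrightarrow> x \<in> rep_space (irrep_of_partition n lam) \<Longrightarrow>
        T lam (act (irrep_of_partition n lam) g x) = act regular_rep g (T lam x)"
    unfolding bchoice_iff by blast
  have mv: "model_vector lam \<in> rep_space ?R" if "lam \<in> ?I" for lam
    using that model_vector(1)[of lam] by auto
  show ?thesis
  proof (rule rep_iso_direct_sumI[where \<phi> = "\<lambda>lam x. alg_act ?R (T lam x) (model_vector lam)", OF R])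
    fix lam assume lam: "lam \<in> ?I"
    show S: "group_representation (sym_group n) (irrep_of_partition n lam)"
      using irrep_of_partition_iso lam by (auto simp: rep_iso_def)
    show "linear_map_on (rep_space (irrep_of_partition n lam)) (rep_space ?R)
        (\<lambda>x. alg_act ?R (T lam x) (model_vector lam))"
      unfolding linear_map_on_def using alg_act_in[OF R mv[OF lam]] linear_map_onD[OF T(1)[OF lam]]
      by (auto simp: alg_act_add_left alg_act_scale_left)
    fix g x assume g: "g \<in> carrier (sym_group n)" and x: "x \<in> rep_space (irrep_of_partition n lam)"
    show "alg_act ?R (T lam (act (irrep_of_partition n lam) g x)) (model_vector lam)
        = act ?R g (alg_act ?R (T lam x) (model_vector lam))"
      by (simp only: T(3)[OF lam g x] act_regular[OF g] alg_act_conv[OF R mv[OF lam]] alg_act_delta[OF g])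
  next
    fix J f
    assume J: "finite J" "J \<subseteq> ?I" and f: "\<And>lam. lam \<in> J \<Longrightarrow> f lam \<in> rep_space (irrep_of_partition n lam)"
      and sum: "(\<Sum>lam\<in>J. alg_act ?R (T lam (f lam)) (model_vector lam)) = 0"
    have "\<forall>lam\<in>J. T lam (f lam) = 0"
    proof (rule ideal_sum_zero[OF R J(1)])
      show "J \<subseteq> partitions n" using J(2) by blast
      show "T lam (f lam) \<in> left_ideal (young_of lam)" if "lam \<in> J" for lam
        using linear_map_onD(1)[OF T(1) f[OF that]] that J(2) by blast
      show "model_vector lam \<in> rep_space ?R" if "lam \<in> J" for lam using mv that J(2) by blast
      show "alg_act ?R (young_of lam) (model_vector lam) \<noteq> 0" if "lam \<in> J" for lam
        using model_vector(2) that J(2) by blast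
    qed (rule sum)
    then show "\<forall>lam\<in>J. f lam = 0"
    proof (intro ballI)
      fix lam assume T0: "\<forall>lam\<in>J. T lam (f lam) = 0" and lam: "lam \<in> J"
      then have l: "lam \<in> ?I" using J(2) by blast
      have sub: "complex_vector.subspace (rep_space (irrep_of_partition n lam))"
        using irrep_of_partition_iso[of lam] l group_representation.subspace unfolding rep_iso_def by blast
      have "T lam (f lam) = T lam 0"
        using linear_map_on_zero[OF T(1)[OF l] sub] T0 lam by simp
      then show "f lam = 0"
        using bij_betw_imp_inj_on[OF T(2)[OF l]] f[OF lam] complex_vector.subspace_0[OF sub]
        by (simp add: inj_on_eq_iff)
    qed
  next
    fix s assume "s \<in> rep_space ?R"
    then obtain y where y: "\<forall>lam\<in>partitions n. y lam \<in> left_ideal (young_of lam)"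
      "s = (\<Sum>lam\<in>?I. alg_act ?R (y lam) (model_vector lam))"
      using involutions_fix_expand by auto
    define f where "f lam = inv_into (rep_space (irrep_of_partition n lam)) (T lam) (y lam)" for lam
    have "f lam \<in> rep_space (irrep_of_partition n lam)" "T lam (f lam) = y lam" if "lam \<in> ?I" for lam
    proof -
      have im: "y lam \<in> T lam ` rep_space (irrep_of_partition n lam)"
        using T(2)[OF that] y(1) that by (auto simp: bij_betw_def)
      show "f lam \<in> rep_space (irrep_of_partition n lam)" unfolding f_def by (rule inv_into_into[OF im])
      show "T lam (f lam) = y lam" unfolding f_def by (rule f_inv_into_f[OF im])
    qed
    then show "\<exists>J f. finite J \<and> J \<subseteq> ?I \<and> (\<forall>lam\<in>J. f lam \<in> rep_space (irrep_of_partition n lam)) \<and>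
        s = (\<Sum>lam\<in>J. alg_act ?R (T lam (f lam)) (model_vector lam))"
      using finite_partitions y(2) by (intro exI[of _ ?I] exI[of _ f]) simp
  qed
qed

abbreviation model :: "(nat \<Rightarrow> nat, (nat \<Rightarrow> nat) \<Rightarrow> complex) rep" where
  "model \<equiv> rho1 n (involutions n)"

definition model_part :: "nat list \<Rightarrow> ((nat \<Rightarrow> nat) \<Rightarrow> complex) set" where
  "model_part lam = (\<lambda>y. alg_act model y (model_vector lam)) ` left_ideal (young_of lam)"

lemma model_representation: "group_representation (sym_group n) model"
  by (rule rho1_representation[OF conj_invariant_involutions])

lemma model_part:
  assumes "lam \<in> partitions n"
  shows "invariant_subspace (sym_group n) model (model_part lam)"
    "rep_iso (sym_group n) (ideal_rep (young_of lam)) (subrep model (model_part lam))"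
  unfolding model_part_def
  by (rule ideal_embeds[OF primitive_young_of[OF assms] model_representation
        model_vector_involutions[OF assms] model_vector(2)[OF assms]])+

text \<open>The symmetrizers serve as labels: by orthogonality each acts as zero on the parts of all
  other partitions. This takes the place of a comparison of characters.\<close>

lemma young_of_model_part:
  assumes lam: "lam \<in> partitions n" and mu: "mu \<in> partitions n"
    and v: "v \<in> model_part mu" "alg_act model (young_of lam) v \<noteq> 0"
  shows "lam = mu"
proof (rule ccontr)
  assume ne: "lam \<noteq> mu"
  obtain x where x: "x \<in> galg" "v = alg_act model (x \<star> young_of mu) (model_vector mu)"
    using v(1) by (auto simp: model_part_def left_ideal_def)
  have "alg_act model (young_of lam) v = alg_act model (young_of lam \<star> x \<star> young_of mu) (model_vector mu)"
    by (simp only: x(2) conv_assoc alg_act_conv[OF model_representation model_vector_involutions[OF mu]])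
  also have "\<dots> = 0" using orthogonal[OF lam mu ne x(1)] by simp
  finally show False using v(2) by simp
qed

lemma young_of_nonzero_model_part:
  assumes lam: "lam \<in> partitions n"
  shows "\<exists>v\<in>model_part lam. alg_act model (young_of lam) v \<noteq> 0"
proof
  note prim = primitive_young_of[OF lam]
  let ?v = "alg_act model (young_of lam) (model_vector lam)"
  show "?v \<in> model_part lam"
    unfolding model_part_def using primitive_in_left_ideal[OF prim] by blast
  obtain k where k: "k \<noteq> 0" "young_of lam \<star> young_of lam = k *\<^sub>C young_of lam"
    using primitive_square[OF prim] by blast
  have "alg_act model (young_of lam) ?v = k *\<^sub>C ?v"
    by (simp only: alg_act_conv[OF model_representation model_vector_involutions[OF lam], symmetric]
        k(2) alg_act_scale_left)
  then show "alg_act model (young_of lam) ?v \<noteq> 0"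
    using k(1) model_vector(2)[OF lam, of "involutions n"] by simp
qed

text \<open>\<open>gelfand_model\<close> speaks of a set of subspaces, so different partitions must
  give different members.\<close>

lemma inj_model_part: "inj_on model_part (partitions n)"
  by (rule inj_onI) (metis young_of_nonzero_model_part young_of_model_part)

lemma model_direct_sum:
  "rep_iso (sym_group n) model (direct_sum_rep (model_part ` partitions n) (subrep model))"
proof (rule rep_iso_direct_sumI[where \<phi> = "\<lambda>_ f. f", OF model_representation])
  fix U assume "U \<in> model_part ` partitions n"
  then obtain lam where lam: "lam \<in> partitions n" "U = model_part lam" by blast
  note U = model_part(1)[OF lam(1), folded lam(2)]
  show "group_representation (sym_group n) (subrep model U)"
    by (rule group_representation.subrep_representation[OF model_representation U])
  show "linear_map_on (rep_space (subrep model U)) (rep_space model) (\<lambda>f. f)"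
    using U by (auto simp: linear_map_on_def invariant_subspace_def)
  show "act (subrep model U) g x = act model g x" for g x by simp
next
  fix J f
  assume J: "finite J" "J \<subseteq> model_part ` partitions n"
    and f: "\<And>U. U \<in> J \<Longrightarrow> f U \<in> rep_space (subrep model U)" and sum: "(\<Sum>U\<in>J. f U) = 0"
  define L where "L = {lam \<in> partitions n. model_part lam \<in> J}"
  have JL: "J = model_part ` L" using J(2) by (auto simp: L_def)
  have inj: "inj_on model_part L" by (rule inj_on_subset[OF inj_model_part]) (auto simp: L_def)
  have "\<exists>y\<in>left_ideal (young_of lam). f (model_part lam) = alg_act model y (model_vector lam)" if "lam \<in> L" for lam
    using f[of "model_part lam"] that by (auto simp: L_def model_part_def)
  then obtain y where y: "\<And>lam. lam \<in> L \<Longrightarrow> y lam \<in> left_ideal (young_of lam)"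
    "\<And>lam. lam \<in> L \<Longrightarrow> f (model_part lam) = alg_act model (y lam) (model_vector lam)" by metis
  have "(\<Sum>lam\<in>L. alg_act model (y lam) (model_vector lam)) = (\<Sum>lam\<in>L. f (model_part lam))"
    by (rule sum.cong[OF refl]) (simp only: y(2))
  also have "\<dots> = (\<Sum>U\<in>J. f U)" unfolding JL sum.reindex[OF inj] by (simp add: o_def)
  finally have zero: "(\<Sum>lam\<in>L. alg_act model (y lam) (model_vector lam)) = 0" using sum by simp
  have L: "finite L" "L \<subseteq> partitions n" using finite_partitions by (auto simp: L_def)
  have "\<forall>lam\<in>L. y lam = 0"
    by (rule ideal_sum_zero[OF model_representation L _ _ y(1) zero])
      (use L(2) model_vector_involutions model_vector(2) in blast)+
  then show "\<forall>U\<in>J. f U = 0" unfolding JL using y(2) by simp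
next
  fix s assume "s \<in> rep_space model"
  then obtain y where y: "\<forall>lam\<in>partitions n. y lam \<in> left_ideal (young_of lam)"
    "s = (\<Sum>lam\<in>partitions n. alg_act model (y lam) (model_vector lam))"
    using involutions_expand by auto
  \<comment> \<open>The sum is indexed by subspaces, so the partition has to be recovered from its
    part.\<close>
  define f where "f U = alg_act model (y (inv_into (partitions n) model_part U))
    (model_vector (inv_into (partitions n) model_part U))" for U
  have f: "f (model_part lam) = alg_act model (y lam) (model_vector lam)" if "lam \<in> partitions n" for lam
    by (simp only: f_def inv_into_f_f[OF inj_model_part that])
  have "s = (\<Sum>U\<in>model_part ` partitions n. f U)"
    unfolding sum.reindex[OF inj_model_part] y(2) using f by (intro sum.cong) auto
  moreover have "\<forall>U\<in>model_part ` partitions n. f U \<in> rep_space (subrep model U)"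
    using f y(1) by (auto simp: model_part_def)
  ultimately show "\<exists>J f. finite J \<and> J \<subseteq> model_part ` partitions n \<and>
      (\<forall>U\<in>J. f U \<in> rep_space (subrep model U)) \<and> s = (\<Sum>U\<in>J. f U)"
    using finite_partitions by (intro exI[of _ "model_part ` partitions n"] exI[of _ f]) simp
qed

text \<open>Existence of the summand is the classification of irreducibles by symmetrizers. For
  uniqueness, an isomorphism between two parts transports the nonvanishing of
  \<open>young_of lam\<close>, which by \<open>young_of_model_part\<close> determines the
  partition.\<close>

lemma model_gelfand: "gelfand_model TYPE('v::complex_vector) (sym_group n) model"
  unfolding gelfand_model_def
proof (intro exI[of _ "model_part ` partitions n"] conjI ballI allI impI)
  fix U assume "U \<in> model_part ` partitions n"
  then obtain lam where lam: "lam \<in> partitions n" "U = model_part lam" by blast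
  show "invariant_subspace (sym_group n) model U" using model_part(1)[OF lam(1)] lam(2) by simp
  show "irreducible_rep (sym_group n) (subrep model U)"
    unfolding lam(2)
    by (rule rep_iso_irreducible[OF model_part(2)[OF lam(1)] ideal_rep_irreducible[OF primitive_young_of[OF lam(1)]]])
next
  show "rep_iso (sym_group n) model (direct_sum_rep (model_part ` partitions n) (subrep model))"
    by (rule model_direct_sum)
next
  fix S :: "(nat \<Rightarrow> nat, 'v) rep" assume "irreducible_rep (sym_group n) S"
  then obtain lam where lam: "lam \<in> partitions n" "rep_iso (sym_group n) S (ideal_rep (young_of lam))"
    using irreducible_classification by blast
  have iso: "rep_iso (sym_group n) S (subrep model (model_part lam))"
    by (rule rep_iso_trans[OF lam(2) model_part(2)[OF lam(1)]])
  show "\<exists>!U. U \<in> model_part ` partitions n \<and> rep_iso (sym_group n) S (subrep model U)"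
  proof (rule ex1I[of _ "model_part lam"])
    show "model_part lam \<in> model_part ` partitions n \<and> rep_iso (sym_group n) S (subrep model (model_part lam))"
      using lam(1) iso by blast
    fix U assume U: "U \<in> model_part ` partitions n \<and> rep_iso (sym_group n) S (subrep model U)"
    then obtain mu where mu: "mu \<in> partitions n" "U = model_part mu" by blast
    have "rep_iso (sym_group n) (subrep model (model_part lam)) (subrep model (model_part mu))"
      by (rule rep_iso_trans[OF rep_iso_sym[OF iso]]) (use U mu(2) in simp)
    moreover obtain v where v: "v \<in> model_part lam" "alg_act model (young_of lam) v \<noteq> 0"
      using young_of_nonzero_model_part[OF lam(1)] by blast
    ultimately have "\<exists>u\<in>model_part mu. alg_act model (young_of lam) u \<noteq> 0"
      using rep_iso_alg_act_nonzero[of "subrep model (model_part lam)" "subrep model (model_part mu)" v "young_of lam"]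
      by simp
    then have "lam = mu" using young_of_model_part[OF lam(1) mu(1)] by blast
    then show "U = model_part lam" using mu(2) by simp
  qed
qed

end

theorem theorem40:
  fixes n :: nat
  assumes "n \<ge> 1"
  shows
    "(\<forall>k. involutions_fix n k \<noteq> {} \<longleftrightarrow> k \<le> n \<and> even (n - k)) \<and>
     (\<forall>k. involutions_fix n k \<noteq> {} \<longrightarrow>
        rep_iso (sym_group n) (rho1 n (involutions_fix n k))
          (direct_sum_rep {lam \<in> partitions n. odd_columns lam = k} (irrep_of_partition n))) \<and>
     (\<Union>k. involutions_fix n k) = involutions n \<and>
     rep_iso (sym_group n) (rho1 n (involutions n))
       (direct_sum_rep UNIV (\<lambda>k. rho1 n (involutions_fix n k))) \<and>
     gelfand_model TYPE('v::complex_vector) (sym_group n) (rho1 n (involutions n))"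
  using sym_grp.involutions_fix_nonempty[of n] sym_grp.rho1_fix_decomposes[of n]
    sym_grp.Union_involutions_fix[of n] sym_grp.rho1_decomposes[of n] sym_grp.model_gelfand[of n]
  by blast

end
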